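(* Consider the following three cases of operators $(B_h,A_h)$: 1. $n=2$, $(B_h,A_h)=(s_{N\beta},A_N)$; 2. $n=3$, $(B_h,A_h)=(s_{N\beta\gamma},A_{N\theta})$; 3. $n\ge1$, $(B_h,A_h)=(\bar s_N,\bar A_N)$; and in each case the finite-difference scheme for a function $v$ on $\bar\omega_h\times\{t_m\}_{m=0}^M$: $$B_h(\rho\Lambda_tv)+\tfrac1{12}h_t^2A_h\Lambda_tv+A_hv=f_N\quad\text{on }\omega_h\times\omega_{h_t},$$ $$v|_{\partial\omega_h\times\{t_m\}_{m=1}^M}=g,\qquad B_h(\rho\delta_tv^0)+\tfrac1{12}h_t^2A_h\delta_tv^0+\tfrac12h_tA_hv^0=u_{1N}+\tfrac12h_tf_N^0\quad\text{on }\omega_h,$$ with $v^0=u_0$ on $\bar\omega_h$ and with $f_N,u_{1N},f_N^0$ given in the context. Let the coefficient $\rho$ and the solution $u$ to the initial-boundary value problem given in the context be sufficiently smooth respectively in $\bar\Omega$ and $\bar Q_T$. Let the real parameters $\beta,\gamma,\theta$ be such that $B_h>0$ and $A_h>0$ in $H_h$, and let $A_h\le\alpha_h^2B_h$ in $H_h$ with some $\alpha_h$ for the first and second schemes. Let $\nu_0I\le B_h\le\nu I$ in $H_h$ with some $\nu\ge\nu_0>0$ independent of $\mathbf h$. Let $0<\varepsilon_0<1$, and let the condition $\frac16h_t^2\alpha_h^2\le(1-\varepsilon_0^2)\underline\rho$ for the first and second schemes, or the condition $h_t^2\big(\frac{a_1^2}{h_1^2}+\ldots+\frac{a_n^2}{h_n^2}\big)\le(1-\varepsilon_0^2)\underline\rho$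 for the third scheme, be valid. Then for all three schemes the following 4th order error bound in the strong energy norm holds: $$\max_{1\le m\le M}\big[\varepsilon_0\|\sqrt\rho\,\bar\delta_t(u-v)^m\|_h+\|\bar s_t(u-v)^m\|_{A_h}\big]=\mathcal O(|\mathbf h|^4).$$ Moreover, let $a_{\min}=\min_{1\le i\le n}a_i$, $\Delta_h=\Lambda_1+\ldots+\Lambda_n$, and let $\varepsilon_2=1$ for the first and third schemes or $0<\varepsilon_2\le\theta\le1$ for the second one. Then $$\sqrt{\varepsilon_2}\,a_{\min}\big(\tfrac23\big)^{(n-1)/2}\|w\|_{-\Delta_h}\le\|w\|_{A_h}\quad\forall w\in H_h.$$
   Context: Initial-boundary value problem: $\Omega=(0,X_1)\times\ldots\times(0,X_n)$, $Q_T=\Omega\times(0,T)$, $\Gamma_T=\partial\Omega\times(0,T)$, $a_1,\ldots,a_n>0$ constants, $0<\underline\rho\le\rho(x)$ in $\bar\Omega$ ($\underline\rho$ constant), and $$\rho(x)\partial_t^2u-(a_1^2\partial_1^2+\ldots+a_n^2\partial_n^2)u=f(x,t)\ \text{in }Q_T,\quad u|_{\Gamma_T}=g(x,t),\quad u|_{t=0}=u_0(x),\ \partial_tu|_{t=0}=u_1(x),\ x\in\Omega.$$ Spatial mesh: $\bar\omega_h=\{x_{\mathbf k}=(k_1h_1,\ldots,k_nh_n);\ 0\le k_i\le N_i\}$, $h_i=X_i/N_i$, $h=(h_1,\ldots,h_n)$; $\omega_h$ is the set of nodes with $1\le k_i\le N_i-1$ for all $i$, $\partial\omega_h=\bar\omega_h\setminus\omega_h$.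 Time mesh: $t_m=mh_t$, $0\le m\le M$, $h_t=T/M>0$, $M\ge2$; $\omega_{h_t}=\{t_m\}_{m=1}^{M-1}$. $\mathbf h=(h,h_t)$ and $|\mathbf h|$ is its Euclidean norm. The constant in $\mathcal O(|\mathbf h|^4)$ is independent of the meshes. $H_h$ is the space of real functions on $\bar\omega_h$ equal to $0$ on $\partial\omega_h$, with $(v,w)_h=h_1\cdots h_n\sum_{x_{\mathbf k}\in\omega_h}v_{\mathbf k}w_{\mathbf k}$ and norm $\|\cdot\|_h$; for $C_h=C_h^*>0$ in $H_h$, $\|w\|_{C_h}=(C_hw,w)_h^{1/2}$. As operators in $H_h$, difference expressions are evaluated on $\omega_h$ and set to $0$ on $\partial\omega_h$; in the scheme they are applied on $\omega_h$ to functions on $\bar\omega_h$ (with possibly nonzero boundary values). Difference operators: $(\Lambda_lw)_{\mathbf k}=\frac1{h_l^2}(w_{\mathbf k+\mathbf e_l}-2w_{\mathbf k}+w_{\mathbf k-\mathbf e_l})$, where $\mathbf e_l$ is the $l$-th standard basis vector; $I$ is the identity; $$s_N=I+\tfrac1{12}\sum_{i=1}^nh_i^2\Lambda_i,\quad s_{N\widehat j}=I+\tfrac1{12}\sum_{i\ne j}h_i^2\Lambda_i,\quad A_N=-\sum_{l=1}^na_l^2s_{N\widehat l}\Lambda_l,$$ $$s_{kN}=I+\tfrac1{12}h_k^2\Lambda_k,\quad\bar s_N=\prod_{k=1}^ns_{kN},\quad\bar s_{N\widehat l}=\prod_{k\ne l}s_{kN},\quad\bar A_N=-\sum_{l=1}^na_l^2\bar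 s_{N\widehat l}\Lambda_l$$ (for $n=1$, $s_{N\widehat1}=\bar s_{N\widehat1}=I$). For $n=2$: $s_{N\beta}=s_N+\beta\frac{h_1^2}{12}\frac{h_2^2}{12}\Lambda_1\Lambda_2$. For $n=3$: $s_{N\beta\gamma}=s_N+\beta\bar s_N^{(2)}+\gamma\bar s_N^{(3)}$, $A_{N\theta}=A_N+\theta\bar A_N^{(3)}$, where $$\bar s_N^{(2)}=\tfrac1{12^2}(h_1^2h_2^2\Lambda_1\Lambda_2+h_1^2h_3^2\Lambda_1\Lambda_3+h_2^2h_3^2\Lambda_2\Lambda_3),\quad\bar s_N^{(3)}=\tfrac1{12^3}h_1^2h_2^2h_3^2\Lambda_1\Lambda_2\Lambda_3,$$ $$\bar A_N^{(3)}=-\tfrac1{12^2}(a_1^2h_2^2h_3^2+a_2^2h_1^2h_3^2+a_3^2h_1^2h_2^2)\Lambda_1\Lambda_2\Lambda_3.$$ The parameters $\beta,\gamma,\theta$ and $\varepsilon_0$ are fixed (independent of the meshes). In time, with $y^m=y(t_m)$, $\check y^m=y^{m-1}$, $\hat y^m=y^{m+1}$: $\bar s_ty=\frac{\check y+y}2$, $\bar\delta_ty=\frac{y-\check y}{h_t}$, $\delta_ty=\frac{\hat y-y}{h_t}$, $\Lambda_ty=\frac{\hat y-2y+\check y}{h_t^2}$; $\delta_tv^0=(\delta_tv)^0$. Right-hand sides: $f_N=s_Nf+\frac1{12}h_t^2\Lambda_tf$ on $\omega_h\times\omega_{h_t}$, and on $\omega_h$ $$u_{1N}=s_N(\rho u_1)+\tfrac1{12}h_t^2(a_1^2\Lambda_1+\ldots+a_n^2\Lambda_n)u_1,\qquad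 f_N^0=f^{(0)}_{dh_t}+\tfrac1{12}(h_1^2\Lambda_1+\ldots+h_n^2\Lambda_n)f_0,$$ where $f^{(0)}_{dh_t}$ is any function with $f^{(0)}_{dh_t}=f^{(0)}_d+\mathcal O(h_t^3)$, $f_d^{(0)}=f_0+\frac13h_t(\partial_tf)_0+\frac1{12}h_t^2(\partial_t^2f)_0$, and $y_0:=y|_{t=0}$. *)

theory Defs
  imports "HOL-Analysis.Analysis"
begin

section \<open>The initial-boundary value problem\<close>

text \<open>
  The space \<open>C\<^sup>k(S)\<close> for a closed box \<open>S\<close> with nonempty interior. Derivatives are taken within
  \<open>S\<close>, hence one-sided on the boundary; \<open>f' i\<close> is the partial derivative in the direction \<open>i\<close>.
\<close>

primrec Ck_on :: "nat \<Rightarrow> 'a::euclidean_space set \<Rightarrow> ('a \<Rightarrow> real) \<Rightarrow> bool" where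
  "Ck_on 0 S f \<longleftrightarrow> continuous_on S f"
| "Ck_on (Suc k) S f \<longleftrightarrow>
     (\<exists>f'. (\<forall>x\<in>S. (f has_derivative (\<lambda>y. \<Sum>i\<in>Basis. (y \<bullet> i) * f' i x)) (at x within S)) \<and>
           (\<forall>i\<in>Basis. Ck_on k S (f' i)))"

definition dtime :: "real \<Rightarrow> (real \<Rightarrow> real) \<Rightarrow> real \<Rightarrow> real" where
  "dtime T \<phi> t = vector_derivative \<phi> (at t within {0..T})"

definition dspace2 :: "'n::finite \<Rightarrow> (real^'n \<Rightarrow> real) \<Rightarrow> real^'n \<Rightarrow> real" where
  "dspace2 i w x = (deriv ^^ 2) (\<lambda>s. w (x + s *\<^sub>R axis i 1)) 0"

definition solves_ibvp ::
  "real^'n::finite \<Rightarrow> real \<Rightarrow> real^'n \<Rightarrow> (real^'n \<Rightarrow> real) \<Rightarrow>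
   (real^'n \<Rightarrow> real \<Rightarrow> real) \<Rightarrow> (real^'n \<Rightarrow> real \<Rightarrow> real) \<Rightarrow> (real^'n \<Rightarrow> real) \<Rightarrow> (real^'n \<Rightarrow> real) \<Rightarrow>
   (real^'n \<Rightarrow> real \<Rightarrow> real) \<Rightarrow> bool" where
  "solves_ibvp X T a \<rho> f g u\<^sub>0 u\<^sub>1 u \<longleftrightarrow>
     (\<forall>x\<in>box 0 X. \<forall>t\<in>{0<..<T}.
        \<rho> x * (dtime T ^^ 2) (u x) t - (\<Sum>i\<in>UNIV. (a $ i)\<^sup>2 * dspace2 i (\<lambda>y. u y t) x) = f x t) \<and>
     (\<forall>x\<in>frontier (box 0 X). \<forall>t\<in>{0<..<T}. u x t = g x t) \<and>
     (\<forall>x\<in>box 0 X. u x 0 = u\<^sub>0 x \<and> dtime T (u x) 0 = u\<^sub>1 x)"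

text \<open>
  The scheme also samples the data at mesh points on the boundary of their domains of definition,
  where they denote the values by continuity.
\<close>

definition data_continuous ::
  "real^'n::finite \<Rightarrow> real \<Rightarrow> (real^'n \<Rightarrow> real \<Rightarrow> real) \<Rightarrow> (real^'n \<Rightarrow> real \<Rightarrow> real) \<Rightarrow>
   (real^'n \<Rightarrow> real) \<Rightarrow> (real^'n \<Rightarrow> real) \<Rightarrow> bool" where
  "data_continuous X T f g u\<^sub>0 u\<^sub>1 \<longleftrightarrow>
     continuous_on (cbox 0 X \<times> {0..T}) (\<lambda>(x, t). f x t) \<and>
     continuous_on (frontier (box 0 X) \<times> {0..T}) (\<lambda>(x, t). g x t) \<and>
     continuous_on (cbox 0 X) u\<^sub>0 \<and> continuous_on (cbox 0 X) u\<^sub>1"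


section \<open>Meshes and mesh functions\<close>

text \<open>
  A function on the mesh is a function of the multi-index; its values at multi-indices off the
  mesh are irrelevant, because no expression below refers to them when evaluated at inner nodes.
\<close>

type_synonym 'n mesh_fun = "int^'n \<Rightarrow> real"

definition nodes :: "nat^'n::finite \<Rightarrow> (int^'n) set" where
  "nodes N = {k. \<forall>i. 0 \<le> k $ i \<and> k $ i \<le> int (N $ i)}"

definition inner_nodes :: "nat^'n::finite \<Rightarrow> (int^'n) set" where
  "inner_nodes N = {k. \<forall>i. 1 \<le> k $ i \<and> k $ i \<le> int (N $ i) - 1}"

definition bdry_nodes :: "nat^'n::finite \<Rightarrow> (int^'n) set" where
  "bdry_nodes N = nodes N - inner_nodes N"

definition mesh_step :: "real^'n::finite \<Rightarrow> nat^'n \<Rightarrow> real^'n" where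
  "mesh_step X N = (\<chi> i. X $ i / real (N $ i))"

definition node :: "real^'n::finite \<Rightarrow> int^'n \<Rightarrow> real^'n" where
  "node h k = (\<chi> i. of_int (k $ i) * h $ i)"

definition mesh_size :: "real^'n::finite \<Rightarrow> real \<Rightarrow> real" where
  "mesh_size h ht = sqrt ((\<Sum>i\<in>UNIV. (h $ i)\<^sup>2) + ht\<^sup>2)"

text \<open>Elements of \<open>H\<^sub>h\<close> are represented by their extensions by zero.\<close>

definition Hspace :: "nat^'n::finite \<Rightarrow> 'n mesh_fun set" where
  "Hspace N = {w. \<forall>k. k \<notin> inner_nodes N \<longrightarrow> w k = 0}"

definition mesh_inner :: "real^'n::finite \<Rightarrow> nat^'n \<Rightarrow> 'n mesh_fun \<Rightarrow> 'n mesh_fun \<Rightarrow> real" where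
  "mesh_inner h N v w = (\<Prod>i\<in>UNIV. h $ i) * (\<Sum>k\<in>inner_nodes N. v k * w k)"

definition mesh_norm :: "real^'n::finite \<Rightarrow> nat^'n \<Rightarrow> 'n mesh_fun \<Rightarrow> real" where
  "mesh_norm h N w = sqrt (mesh_inner h N w w)"

definition op_norm ::
  "real^'n::finite \<Rightarrow> nat^'n \<Rightarrow> ('n mesh_fun \<Rightarrow> 'n mesh_fun) \<Rightarrow> 'n mesh_fun \<Rightarrow> real" where
  "op_norm h N C w = sqrt (mesh_inner h N (C w) w)"

definition op_pos :: "real^'n::finite \<Rightarrow> nat^'n \<Rightarrow> ('n mesh_fun \<Rightarrow> 'n mesh_fun) \<Rightarrow> bool" where
  "op_pos h N C \<longleftrightarrow> (\<forall>w\<in>Hspace N. w \<noteq> (\<lambda>_. 0) \<longrightarrow> 0 < mesh_inner h N (C w) w)"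

definition op_le ::
  "real^'n::finite \<Rightarrow> nat^'n \<Rightarrow> ('n mesh_fun \<Rightarrow> 'n mesh_fun) \<Rightarrow> ('n mesh_fun \<Rightarrow> 'n mesh_fun) \<Rightarrow> bool"
  where
  "op_le h N C D \<longleftrightarrow> (\<forall>w\<in>Hspace N. mesh_inner h N (C w) w \<le> mesh_inner h N (D w) w)"


section \<open>Difference operators in space\<close>

definition Lam :: "real^'n::finite \<Rightarrow> 'n \<Rightarrow> 'n mesh_fun \<Rightarrow> 'n mesh_fun" where
  "Lam h l w = (\<lambda>k. (w (k + axis l 1) - 2 * w k + w (k - axis l 1)) / (h $ l)\<^sup>2)"

definition Lam_sum :: "real^'n::finite \<Rightarrow> 'n mesh_fun \<Rightarrow> 'n mesh_fun" where
  "Lam_sum h w = (\<lambda>k. \<Sum>l\<in>UNIV. Lam h l w k)"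

definition sN :: "real^'n::finite \<Rightarrow> 'n mesh_fun \<Rightarrow> 'n mesh_fun" where
  "sN h w = (\<lambda>k. w k + (1/12) * (\<Sum>i\<in>UNIV. (h $ i)\<^sup>2 * Lam h i w k))"

definition sN_hat :: "real^'n::finite \<Rightarrow> 'n \<Rightarrow> 'n mesh_fun \<Rightarrow> 'n mesh_fun" where
  "sN_hat h j w = (\<lambda>k. w k + (1/12) * (\<Sum>i\<in>UNIV - {j}. (h $ i)\<^sup>2 * Lam h i w k))"

definition AN :: "real^'n::finite \<Rightarrow> real^'n \<Rightarrow> 'n mesh_fun \<Rightarrow> 'n mesh_fun" where
  "AN a h w = (\<lambda>k. - (\<Sum>l\<in>UNIV. (a $ l)\<^sup>2 * sN_hat h l (Lam h l w) k))"

definition s1 :: "real^'n::finite \<Rightarrow> 'n \<Rightarrow> 'n mesh_fun \<Rightarrow> 'n mesh_fun" where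
  "s1 h i w = (\<lambda>k. w k + (1/12) * (h $ i)\<^sup>2 * Lam h i w k)"

text \<open>
  Products (compositions) of the operators over a set of directions. The order of the factors is
  immaterial by the lemmas \<open>comp_fun_commute_Lam\<close> and \<open>comp_fun_commute_s1\<close>.
\<close>

definition Lam_prod :: "real^'n::finite \<Rightarrow> 'n set \<Rightarrow> 'n mesh_fun \<Rightarrow> 'n mesh_fun" where
  "Lam_prod h S w = Finite_Set.fold (Lam h) w S"

definition s1_prod :: "real^'n::finite \<Rightarrow> 'n set \<Rightarrow> 'n mesh_fun \<Rightarrow> 'n mesh_fun" where
  "s1_prod h S w = Finite_Set.fold (s1 h) w S"

lemma Lam_commute: "Lam h i (Lam h j w) = Lam h j (Lam h i w)"
  by (rule ext) (simp add: Lam_def algebra_simps diff_divide_distrib add_divide_distrib)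

lemma Lam_add: "Lam h i (\<lambda>k. v k + c * w k) = (\<lambda>k. Lam h i v k + c * Lam h i w k)"
  by (rule ext) (simp add: Lam_def algebra_simps diff_divide_distrib add_divide_distrib)

lemma s1_commute: "s1 h i (s1 h j w) = s1 h j (s1 h i w)"
  unfolding s1_def Lam_add by (rule ext) (simp add: Lam_commute[of h i j] algebra_simps)

lemma comp_fun_commute_Lam: "comp_fun_commute (Lam h)"
  by unfold_locales (simp add: fun_eq_iff Lam_commute)

lemma comp_fun_commute_s1: "comp_fun_commute (s1 h)"
  by unfold_locales (simp add: fun_eq_iff s1_commute)

lemma Lam_prod_empty: "Lam_prod h {} w = w"
  by (simp add: Lam_prod_def)

lemma Lam_prod_insert:
  assumes "i \<notin> S"
  shows "Lam_prod h (insert i S) w = Lam h i (Lam_prod h S w)"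
proof -
  interpret comp_fun_commute "Lam h" by (rule comp_fun_commute_Lam)
  show ?thesis using assms by (simp add: Lam_prod_def)
qed

lemma s1_prod_empty: "s1_prod h {} w = w"
  by (simp add: s1_prod_def)

lemma s1_prod_insert:
  assumes "i \<notin> S"
  shows "s1_prod h (insert i S) w = s1 h i (s1_prod h S w)"
proof -
  interpret comp_fun_commute "s1 h" by (rule comp_fun_commute_s1)
  show ?thesis using assms by (simp add: s1_prod_def)
qed

definition sN_bar :: "real^'n::finite \<Rightarrow> 'n mesh_fun \<Rightarrow> 'n mesh_fun" where
  "sN_bar h w = s1_prod h UNIV w"

definition AN_bar :: "real^'n::finite \<Rightarrow> real^'n \<Rightarrow> 'n mesh_fun \<Rightarrow> 'n mesh_fun" where
  "AN_bar a h w = (\<lambda>k. - (\<Sum>l\<in>UNIV. (a $ l)\<^sup>2 * s1_prod h (UNIV - {l}) (Lam h l w) k))"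

text \<open>For two directions.\<close>

definition sN_beta :: "real \<Rightarrow> real^'n::finite \<Rightarrow> 'n mesh_fun \<Rightarrow> 'n mesh_fun" where
  "sN_beta \<beta> h w = (\<lambda>k. sN h w k + \<beta> * (\<Prod>i\<in>UNIV. (h $ i)\<^sup>2 / 12) * Lam_prod h UNIV w k)"

text \<open>
  For three directions. The summation over the unordered pairs of distinct directions is the
  summation over the two-element sets of directions.
\<close>

definition sN_bar2 :: "real^'n::finite \<Rightarrow> 'n mesh_fun \<Rightarrow> 'n mesh_fun" where
  "sN_bar2 h w = (\<lambda>k. (1/12^2) * (\<Sum>S\<in>{S. card S = 2}. (\<Prod>i\<in>S. (h $ i)\<^sup>2) * Lam_prod h S w k))"

definition sN_bar3 :: "real^'n::finite \<Rightarrow> 'n mesh_fun \<Rightarrow> 'n mesh_fun" where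
  "sN_bar3 h w = (\<lambda>k. (1/12^3) * (\<Prod>i\<in>UNIV. (h $ i)\<^sup>2) * Lam_prod h UNIV w k)"

definition sN_beta_gamma :: "real \<Rightarrow> real \<Rightarrow> real^'n::finite \<Rightarrow> 'n mesh_fun \<Rightarrow> 'n mesh_fun" where
  "sN_beta_gamma \<beta> \<gamma> h w = (\<lambda>k. sN h w k + \<beta> * sN_bar2 h w k + \<gamma> * sN_bar3 h w k)"

definition AN_bar3 :: "real^'n::finite \<Rightarrow> real^'n \<Rightarrow> 'n mesh_fun \<Rightarrow> 'n mesh_fun" where
  "AN_bar3 a h w =
     (\<lambda>k. - (1/12^2) * (\<Sum>l\<in>UNIV. (a $ l)\<^sup>2 * (\<Prod>i\<in>UNIV - {l}. (h $ i)\<^sup>2)) * Lam_prod h UNIV w k)"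

definition AN_theta :: "real \<Rightarrow> real^'n::finite \<Rightarrow> real^'n \<Rightarrow> 'n mesh_fun \<Rightarrow> 'n mesh_fun" where
  "AN_theta \<theta> a h w = (\<lambda>k. AN a h w k + \<theta> * AN_bar3 a h w k)"


section \<open>The three schemes\<close>

datatype scheme =
    Scheme1 real
  | Scheme2 real real real
  | Scheme3

fun scheme_dim :: "scheme \<Rightarrow> nat \<Rightarrow> bool" where
  "scheme_dim (Scheme1 \<beta>) n \<longleftrightarrow> n = 2"
| "scheme_dim (Scheme2 \<beta> \<gamma> \<theta>) n \<longleftrightarrow> n = 3"
| "scheme_dim Scheme3 n \<longleftrightarrow> n \<ge> 1"

fun Bop :: "scheme \<Rightarrow> real^'n::finite \<Rightarrow> 'n mesh_fun \<Rightarrow> 'n mesh_fun" where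
  "Bop (Scheme1 \<beta>) h = sN_beta \<beta> h"
| "Bop (Scheme2 \<beta> \<gamma> \<theta>) h = sN_beta_gamma \<beta> \<gamma> h"
| "Bop Scheme3 h = sN_bar h"

fun Aop :: "scheme \<Rightarrow> real^'n::finite \<Rightarrow> real^'n \<Rightarrow> 'n mesh_fun \<Rightarrow> 'n mesh_fun" where
  "Aop (Scheme1 \<beta>) a h = AN a h"
| "Aop (Scheme2 \<beta> \<gamma> \<theta>) a h = AN_theta \<theta> a h"
| "Aop Scheme3 a h = AN_bar a h"

text \<open>Functions on the time mesh are indexed by the time level.\<close>

definition st_bar :: "(nat \<Rightarrow> 'n::finite mesh_fun) \<Rightarrow> nat \<Rightarrow> 'n mesh_fun" where
  "st_bar y m = (\<lambda>k. (y (m - 1) k + y m k) / 2)"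

definition dt_bar :: "real \<Rightarrow> (nat \<Rightarrow> 'n::finite mesh_fun) \<Rightarrow> nat \<Rightarrow> 'n mesh_fun" where
  "dt_bar ht y m = (\<lambda>k. (y m k - y (m - 1) k) / ht)"

definition dt_fwd :: "real \<Rightarrow> (nat \<Rightarrow> 'n::finite mesh_fun) \<Rightarrow> nat \<Rightarrow> 'n mesh_fun" where
  "dt_fwd ht y m = (\<lambda>k. (y (m + 1) k - y m k) / ht)"

definition Lam_t :: "real \<Rightarrow> (nat \<Rightarrow> 'n::finite mesh_fun) \<Rightarrow> nat \<Rightarrow> 'n mesh_fun" where
  "Lam_t ht y m = (\<lambda>k. (y (m + 1) k - 2 * y m k + y (m - 1) k) / ht\<^sup>2)"

definition restr :: "real^'n::finite \<Rightarrow> (real^'n \<Rightarrow> real) \<Rightarrow> 'n mesh_fun" where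
  "restr h w = (\<lambda>k. w (node h k))"

definition restr_t ::
  "real^'n::finite \<Rightarrow> real \<Rightarrow> (real^'n \<Rightarrow> real \<Rightarrow> real) \<Rightarrow> nat \<Rightarrow> 'n mesh_fun" where
  "restr_t h ht w m = (\<lambda>k. w (node h k) (real m * ht))"

definition fN ::
  "real^'n::finite \<Rightarrow> real \<Rightarrow> (real^'n \<Rightarrow> real \<Rightarrow> real) \<Rightarrow> nat \<Rightarrow> 'n mesh_fun" where
  "fN h ht f m =
     (\<lambda>k. sN h (restr_t h ht f m) k + (1/12) * ht\<^sup>2 * Lam_t ht (restr_t h ht f) m k)"

definition u1N ::
  "real^'n::finite \<Rightarrow> real^'n \<Rightarrow> real \<Rightarrow> (real^'n \<Rightarrow> real) \<Rightarrow> (real^'n \<Rightarrow> real) \<Rightarrow> 'n mesh_fun" where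
  "u1N a h ht \<rho> u\<^sub>1 =
     (\<lambda>k. sN h (restr h (\<lambda>x. \<rho> x * u\<^sub>1 x)) k
        + (1/12) * ht\<^sup>2 * (\<Sum>i\<in>UNIV. (a $ i)\<^sup>2 * Lam h i (restr h u\<^sub>1) k))"

definition fd0 :: "real \<Rightarrow> real \<Rightarrow> (real^'n::finite \<Rightarrow> real \<Rightarrow> real) \<Rightarrow> real^'n \<Rightarrow> real" where
  "fd0 T ht f x = f x 0 + (1/3) * ht * dtime T (f x) 0 + (1/12) * ht\<^sup>2 * (dtime T ^^ 2) (f x) 0"

text \<open>The argument \<open>fdh\<close> is the approximation of \<^const>\<open>fd0\<close> at the inner nodes.\<close>

definition fN0 ::
  "real^'n::finite \<Rightarrow> 'n mesh_fun \<Rightarrow> (real^'n \<Rightarrow> real \<Rightarrow> real) \<Rightarrow> 'n mesh_fun" where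
  "fN0 h fdh f =
     (\<lambda>k. fdh k + (1/12) * (\<Sum>i\<in>UNIV. (h $ i)\<^sup>2 * Lam h i (restr h (\<lambda>x. f x 0)) k))"

definition solves_scheme ::
  "scheme \<Rightarrow> real^'n::finite \<Rightarrow> real^'n \<Rightarrow> nat^'n \<Rightarrow> real \<Rightarrow> nat \<Rightarrow> (real^'n \<Rightarrow> real) \<Rightarrow>
   (real^'n \<Rightarrow> real \<Rightarrow> real) \<Rightarrow> (real^'n \<Rightarrow> real \<Rightarrow> real) \<Rightarrow> (real^'n \<Rightarrow> real) \<Rightarrow> (real^'n \<Rightarrow> real) \<Rightarrow>
   'n mesh_fun \<Rightarrow> (nat \<Rightarrow> 'n mesh_fun) \<Rightarrow> bool" where
  "solves_scheme sch a h N ht M \<rho> f g u\<^sub>0 u\<^sub>1 fdh v \<longleftrightarrow>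
     (\<forall>m\<in>{1..M - 1}. \<forall>k\<in>inner_nodes N.
        Bop sch h (\<lambda>j. restr h \<rho> j * Lam_t ht v m j) k
        + (1/12) * ht\<^sup>2 * Aop sch a h (Lam_t ht v m) k
        + Aop sch a h (v m) k = fN h ht f m k) \<and>
     (\<forall>m\<in>{1..M}. \<forall>k\<in>bdry_nodes N. v m k = restr_t h ht g m k) \<and>
     (\<forall>k\<in>inner_nodes N.
        Bop sch h (\<lambda>j. restr h \<rho> j * dt_fwd ht v 0 j) k
        + (1/12) * ht\<^sup>2 * Aop sch a h (dt_fwd ht v 0) k
        + (1/2) * ht * Aop sch a h (v 0) k
        = u1N a h ht \<rho> u\<^sub>1 k + (1/2) * ht * fN0 h fdh f k) \<and>
     (\<forall>k\<in>nodes N. v 0 k = restr h u\<^sub>0 k)"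

definition step_condition ::
  "scheme \<Rightarrow> real^'n::finite \<Rightarrow> real^'n \<Rightarrow> nat^'n \<Rightarrow> real \<Rightarrow> real \<Rightarrow> real \<Rightarrow> bool" where
  "step_condition sch a h N ht \<rho>min \<epsilon>\<^sub>0 \<longleftrightarrow>
     (if sch = Scheme3
      then ht\<^sup>2 * (\<Sum>i\<in>UNIV. (a $ i)\<^sup>2 / (h $ i)\<^sup>2) \<le> (1 - \<epsilon>\<^sub>0\<^sup>2) * \<rho>min
      else (\<exists>\<alpha>. op_le h N (Aop sch a h) (\<lambda>w k. \<alpha>\<^sup>2 * Bop sch h w k) \<and>
                (1/6) * ht\<^sup>2 * \<alpha>\<^sup>2 \<le> (1 - \<epsilon>\<^sub>0\<^sup>2) * \<rho>min))"

end

theory Submission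
  imports Defs
begin

text \<open>
  Why the theorem is true. The error \<open>e = u - v\<close> vanishes initially and on the boundary and satisfies the
  scheme with the truncation residuals \<open>\<psi>\<^sup>m\<close> in place of the data. Two things have to be shown: the
  residuals are of the fourth order, and the scheme is stable in the energy norm.

  Stability. As operators in \<open>H\<^sub>h\<close>, \<open>A\<^sub>h\<close> and \<open>B\<^sub>h\<close> are polynomials in the commuting symmetric operators
  \<open>\<Lambda>\<^sub>1, \<dots>, \<Lambda>\<^sub>n\<close>. Multiplying the error equation by \<open>B\<^sub>h\<^sup>-\<^sup>1\<close> gives
  \<open>\<rho> \<Lambda>\<^sub>t e + (\<tau>\<^sup>2/12) G \<Lambda>\<^sub>t e + G e = B\<^sub>h\<^sup>-\<^sup>1 \<psi>\<close> with the symmetric operator \<open>G = A\<^sub>h B\<^sub>h\<^sup>-\<^sup>1\<close>. Testing with the sum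
  \<open>d\<^sup>m\<^sup>+\<^sup>1 + d\<^sup>m\<close> of consecutive difference quotients shows that the energy
  \<open>(\<rho> d, d) - (\<tau>\<^sup>2/6) (G d, d) + (G s, s)\<close>, where \<open>s\<close> is the mean value of consecutive levels, grows by
  \<open>\<tau> (B\<^sub>h\<^sup>-\<^sup>1 \<psi>\<^sup>m, d\<^sup>m\<^sup>+\<^sup>1 + d\<^sup>m)\<close> only. The stability condition makes it dominate \<open>\<epsilon>\<^sub>0\<^sup>2 (\<rho> d, d) + (G s, s)\<close>, and
  \<open>B\<^sub>h \<le> \<nu> I\<close> makes \<open>\<nu> (G s, s)\<close> dominate \<open>(A\<^sub>h s, s)\<close>. The result is \<open>energy_estimate\<close>. All operator
  inequalities on the way, also those of the second claim of the theorem, say that a product of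
  commuting positive operators is positive, which is \<open>psd_comp\<close>.

  Consistency. Along one line Taylor's formula gives
  \<open>\<Lambda> w = \<partial>\<^sup>2 w + (h\<^sup>2/12) \<Lambda> \<partial>\<^sup>2 w + \<O>(h\<^sup>4)\<close>. This correction, taken in all directions and in time, is what the
  averages in \<open>B\<^sub>h\<close>, \<open>A\<^sub>h\<close> and the right-hand side reproduce, so that the differential equation cancels
  all terms below the fourth order; products of differences in two or more directions come with
  factors \<open>h\<^sub>i\<^sup>2 h\<^sub>j\<^sup>2\<close> and are themselves of the fourth order. These are the theorems
  \<open>truncation_error\<close> and \<open>initial_truncation_error\<close>. They treat space and time alike, as directions of a box
  in \<open>\<real>\<^sup>n \<times> \<real>\<close>, and in terms of \<open>W = \<rho> u\<close>, which removes the variable coefficient.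

  The norm bound. The factors of \<open>-\<Lambda>\<^sub>l\<close> in \<open>A\<^sub>h\<close> are products of operators \<open>s\<^sub>k\<^sub>N \<ge> 2/3\<close> for the third scheme, and the other
  two schemes reduce to it (\<open>Aop_lower_bound\<close>).
\<close>

section \<open>Commuting operators on functions of a finite set\<close>

text \<open>
  The inner product of \<open>H\<^sub>h\<close> without its constant weight \<open>h\<^sub>1\<dots>h\<^sub>n\<close>, which cancels from all
  operator inequalities.
\<close>

definition ip :: "'k set \<Rightarrow> ('k \<Rightarrow> real) \<Rightarrow> ('k \<Rightarrow> real) \<Rightarrow> real" where
  "ip S v w = (\<Sum>k\<in>S. v k * w k)"

text \<open>
  The projection onto functions supported in \<open>S\<close>. Elements of \<open>H\<^sub>h\<close> are their own extensions by
  zero, so \<open>zext S\<close> is the identity operator of \<open>H\<^sub>h\<close>, written as an operator on all functions.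
\<close>

definition zext :: "'k set \<Rightarrow> ('k \<Rightarrow> real) \<Rightarrow> 'k \<Rightarrow> real" where
  "zext S w = (\<lambda>k. if k \<in> S then w k else 0)"

lemma ip_commute: "ip S v w = ip S w v"
  by (simp add: ip_def mult.commute)

lemma ip_cong: "(\<And>k. k \<in> S \<Longrightarrow> v k = v' k) \<Longrightarrow> (\<And>k. k \<in> S \<Longrightarrow> w k = w' k) \<Longrightarrow> ip S v w = ip S v' w'"
  by (simp add: ip_def)

lemma ip_zext [simp]: "ip S (zext S v) w = ip S v w" "ip S v (zext S w) = ip S v w"
  by (simp_all add: ip_def zext_def)

lemma ip_lin_left: "ip S (\<lambda>k. v k + c * w k) u = ip S v u + c * ip S w u"
  by (simp add: ip_def algebra_simps sum.distrib sum_distrib_left)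

lemma ip_lin_right: "ip S u (\<lambda>k. v k + c * w k) = ip S u v + c * ip S u w"
  by (simp add: ip_def algebra_simps sum.distrib sum_distrib_left)

lemma ip_add_right: "ip S u (\<lambda>k. v k + w k) = ip S u v + ip S u w"
  using ip_lin_right[of S u v 1 w] by simp

lemma ip_diff_left: "ip S (\<lambda>k. v k - w k) u = ip S v u - ip S w u"
  using ip_lin_left[of S v "-1" w u] by simp

lemma ip_diff_right: "ip S u (\<lambda>k. v k - w k) = ip S u v - ip S u w"
  using ip_lin_right[of S u v "-1" w] by simp

lemma ip_scale_left: "ip S (\<lambda>k. c * w k) u = c * ip S w u"
  using ip_lin_left[of S "\<lambda>_. 0" c w u] by (simp add: ip_def)

lemma ip_scale_right: "ip S u (\<lambda>k. c * w k) = c * ip S u w"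
  using ip_lin_right[of S u "\<lambda>_. 0" c w] by (simp add: ip_def)

lemma ip_self_nonneg [simp]: "0 \<le> ip S w w"
  by (simp add: ip_def sum_nonneg)

lemma ip_self_zero: "finite S \<Longrightarrow> ip S w w \<le> 0 \<Longrightarrow> k \<in> S \<Longrightarrow> w k = 0"
  using sum_nonneg_eq_0_iff[of S "\<lambda>k. w k * w k"] ip_self_nonneg[of S w]
  by (auto simp: ip_def)

lemma ip_Cauchy_Schwarz: "\<bar>ip S v w\<bar> \<le> sqrt (ip S v v) * sqrt (ip S w w)"
proof -
  have "(ip S v w)\<^sup>2 \<le> ip S v v * ip S w w"
    using Cauchy_Schwarz_ineq_sum[of v w S] by (simp add: ip_def power2_eq_square)
  then show ?thesis
    by (metis real_sqrt_abs real_sqrt_le_mono real_sqrt_mult)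
qed

lemma ip_Cauchy_Schwarz': "ip S v w \<le> sqrt (ip S v v) * sqrt (ip S w w)"
  using ip_Cauchy_Schwarz[of S v w] by linarith

definition psd :: "'k set \<Rightarrow> (('k \<Rightarrow> real) \<Rightarrow> ('k \<Rightarrow> real)) \<Rightarrow> bool" where
  "psd S T \<longleftrightarrow> (\<forall>w. 0 \<le> ip S (T w) w)"

text \<open>
  Gaussian elimination of one index \<open>s\<close>: the vector \<open>y\<close> with \<open>y s = 1\<close> that \<open>T\<close> annihilates at the
  other indices carries the Schur complement as its pivot, which positivity keeps away from zero.
\<close>

lemma positive_definite_imp_surjective:
  fixes T :: "('k \<Rightarrow> real) \<Rightarrow> 'k \<Rightarrow> real"
  assumes "finite S"
    and lin: "\<And>v c w k. T (\<lambda>k. v k + c * w k) k = T v k + c * T w k"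
    and pos: "\<And>w. (\<And>k. k \<notin> S \<Longrightarrow> w k = 0) \<Longrightarrow> (\<exists>k. w k \<noteq> 0) \<Longrightarrow> 0 < ip S (T w) w"
  shows "\<exists>z. (\<forall>k. k \<notin> S \<longrightarrow> z k = 0) \<and> (\<forall>k\<in>S. T z k = b k)"
  using assms(1) pos
proof (induction S arbitrary: b rule: finite_induct)
  case empty
  then show ?case by (intro exI[of _ "\<lambda>_. 0"]) auto
next
  case (insert s S)
  have "0 < ip S (T w) w" if "\<And>k. k \<notin> S \<Longrightarrow> w k = 0" "\<exists>k. w k \<noteq> 0" for w
  proof -
    have "0 < ip (insert s S) (T w) w"
      by (rule insert.prems) (use that in auto)
    then show ?thesis using that(1)[OF insert.hyps(2)] insert.hyps by (simp add: ip_def)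
  qed
  note solve = insert.IH[OF this]
  obtain z where z: "\<And>k. k \<notin> S \<Longrightarrow> z k = 0" "\<And>k. k \<in> S \<Longrightarrow> T z k = b k"
    using solve[of b] by blast
  define \<delta> :: "'k \<Rightarrow> real" where "\<delta> = (\<lambda>k. if k = s then 1 else 0)"
  obtain y where y: "\<And>k. k \<notin> S \<Longrightarrow> y k = 0" "\<And>k. k \<in> S \<Longrightarrow> T y k = - T \<delta> k"
    using solve[of "\<lambda>k. - T \<delta> k"] by blast
  define Y where "Y = (\<lambda>k. \<delta> k + 1 * y k)"
  have Ys: "Y s = 1" using y(1) insert.hyps by (simp add: Y_def \<delta>_def)
  have TY: "T Y k = 0" if "k \<in> S" for k
    unfolding Y_def lin[of \<delta> 1 y k] using y(2)[OF that] by simp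
  have "0 < ip (insert s S) (T Y) Y"
  proof (rule insert.prems)
    show "Y k = 0" if "k \<notin> insert s S" for k
      using that y(1)[of k] by (simp add: Y_def \<delta>_def)
    show "\<exists>k. Y k \<noteq> 0" using Ys by (metis zero_neq_one)
  qed
  also have "\<dots> = T Y s"
    using insert.hyps TY Ys by (simp add: ip_def)
  finally have piv: "T Y s > 0" .
  let ?Z = "\<lambda>k. z k + ((b s - T z s) / T Y s) * Y k"
  have "?Z k = 0" if "k \<notin> insert s S" for k
    using that z(1) y(1) by (simp add: Y_def \<delta>_def)
  moreover have "T ?Z k = b k" if "k \<in> insert s S" for k
  proof (cases "k = s")
    case True
    then show ?thesis unfolding lin[of z _ Y k] using piv by simp
  next
    case False
    then have "k \<in> S" using that by simp
    then show ?thesis unfolding lin[of z _ Y k] using z(2) TY by simp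
  qed
  ultimately show ?case by (intro exI[of _ ?Z] conjI allI impI ballI)
qed


text \<open>
  The abstract setting of the stability analysis. The generators stand for \<open>\<Lambda>\<^sub>1, \<dots>, \<Lambda>\<^sub>n\<close> as operators
  in \<open>H\<^sub>h\<close>. Since \<open>A\<^sub>h\<close> and \<open>B\<^sub>h\<close> are polynomials in them, both lie in the commutative algebra
  \<open>alg\<close> of symmetric operators that the generators span.
\<close>

locale commuting_ops =
  fixes S :: "'k set" and gen :: "'i \<Rightarrow> ('k \<Rightarrow> real) \<Rightarrow> ('k \<Rightarrow> real)"
  assumes fin: "finite S"
    and gen_lin: "\<And>i v c w. gen i (\<lambda>k. v k + c * w k) = (\<lambda>k. gen i v k + c * gen i w k)"
    and gen_supp: "\<And>i w k. k \<notin> S \<Longrightarrow> gen i w k = 0"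
    and gen_sym: "\<And>i v w. ip S (gen i v) w = ip S v (gen i w)"
    and gen_comm: "\<And>i j w. gen i (gen j w) = gen j (gen i w)"
begin

inductive_set alg :: "(('k \<Rightarrow> real) \<Rightarrow> ('k \<Rightarrow> real)) set" where
  alg_one: "zext S \<in> alg"
| alg_gen: "gen i \<in> alg"
| alg_lincomb: "T \<in> alg \<Longrightarrow> U \<in> alg \<Longrightarrow> (\<lambda>w k. T w k + c * U w k) \<in> alg"
| alg_comp: "T \<in> alg \<Longrightarrow> U \<in> alg \<Longrightarrow> (\<lambda>w. T (U w)) \<in> alg"

lemma alg_lin: "T \<in> alg \<Longrightarrow> T (\<lambda>k. v k + c * w k) = (\<lambda>k. T v k + c * T w k)"
proof (induction arbitrary: v c w rule: alg.induct)
  case alg_one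
  show ?case by (auto simp: zext_def)
next
  case (alg_gen i)
  show ?case by (rule gen_lin)
next
  case (alg_lincomb T U a)
  show ?case unfolding alg_lincomb.IH by (simp add: algebra_simps)
next
  case (alg_comp T U)
  show ?case unfolding alg_comp.IH ..
qed

lemma alg_supp: "T \<in> alg \<Longrightarrow> k \<notin> S \<Longrightarrow> T w k = 0"
  by (induction arbitrary: w rule: alg.induct) (simp_all add: gen_supp zext_def)

lemma zext_alg: "T \<in> alg \<Longrightarrow> zext S (T w) = T w"
  by (rule ext) (simp add: zext_def alg_supp)

lemma eq_if_ip_eq:
  assumes "\<And>k. k \<notin> S \<Longrightarrow> v k = 0" "\<And>k. k \<notin> S \<Longrightarrow> w k = 0" "\<And>u. ip S v u = ip S w u"
  shows "v = w"
proof
  fix k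
  have "ip S (\<lambda>k. v k - w k) (\<lambda>k. v k - w k) \<le> 0"
    using assms(3) by (simp add: ip_diff_left)
  from ip_self_zero[OF fin this, of k] show "v k = w k"
    using assms(1,2)[of k] by (cases "k \<in> S") auto
qed

lemma gen_zext: "gen i (zext S w) = gen i w"
  by (rule eq_if_ip_eq) (simp_all add: gen_supp gen_sym)

lemma alg_zext: "T \<in> alg \<Longrightarrow> T (zext S w) = T w"
proof (induction arbitrary: w rule: alg.induct)
  case alg_one
  show ?case by (auto simp: zext_def)
qed (simp_all add: gen_zext)

lemma alg_comm_gen: "T \<in> alg \<Longrightarrow> T (gen i w) = gen i (T w)"
proof (induction arbitrary: w rule: alg.induct)
  case alg_one
  then show ?case using gen_zext zext_alg[OF alg_gen] by simp
next
  case (alg_gen j)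
  then show ?case by (rule gen_comm)
next
  case (alg_lincomb T U c)
  then show ?case by (simp add: gen_lin)
next
  case (alg_comp T U)
  then show ?case by simp
qed

lemma alg_comm: "T \<in> alg \<Longrightarrow> U \<in> alg \<Longrightarrow> T (U w) = U (T w)"
proof (induction arbitrary: w rule: alg.induct)
  case alg_one
  then show ?case by (simp only: alg_zext zext_alg)
next
  case (alg_gen i)
  show ?case by (rule alg_comm_gen[OF alg_gen, symmetric])
next
  case (alg_lincomb T U' c)
  then show ?case by (simp only: alg_lin[OF \<open>U \<in> alg\<close>])
next
  case (alg_comp T U')
  then show ?case by simp
qed

lemma alg_sym: "T \<in> alg \<Longrightarrow> ip S (T v) w = ip S v (T w)"
proof (induction arbitrary: v w rule: alg.induct)
  case alg_one
  then show ?case by simp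
next
  case (alg_gen i)
  show ?case by (rule gen_sym)
next
  case (alg_lincomb T U c)
  then show ?case by (simp only: ip_lin_left ip_lin_right)
next
  case (alg_comp T U)
  then show ?case by (simp only: alg_comm[of T U])
qed

lemma alg_0: "T \<in> alg \<Longrightarrow> T (\<lambda>_. 0) = (\<lambda>_. 0)"
  using alg_lin[of T "\<lambda>_. 0" "-1" "\<lambda>_. 0"] by (simp add: fun_eq_iff)

lemma alg_scaled: "T \<in> alg \<Longrightarrow> T (\<lambda>k. c * w k) = (\<lambda>k. c * T w k)"
  using alg_lin[of T "\<lambda>_. 0" c w] alg_0[of T] by simp

lemma alg_minus: "T \<in> alg \<Longrightarrow> T (\<lambda>k. v k - w k) = (\<lambda>k. T v k - T w k)"
  using alg_lin[of T v "-1" w] by simp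

lemma alg_plus: "T \<in> alg \<Longrightarrow> T (\<lambda>k. v k + w k) = (\<lambda>k. T v k + T w k)"
  using alg_lin[of T v 1 w] by simp

lemma alg_diff: "T \<in> alg \<Longrightarrow> U \<in> alg \<Longrightarrow> (\<lambda>w k. T w k - U w k) \<in> alg"
  using alg_lincomb[of T U "-1"] by simp

lemma alg_add: "T \<in> alg \<Longrightarrow> U \<in> alg \<Longrightarrow> (\<lambda>w k. T w k + U w k) \<in> alg"
  using alg_lincomb[of T U 1] by simp

lemma alg_zero: "(\<lambda>w k. 0) \<in> alg"
  using alg_diff[OF alg_one alg_one] by simp

lemma alg_scale: "T \<in> alg \<Longrightarrow> (\<lambda>w k. c * T w k) \<in> alg"
  using alg_lincomb[OF alg_zero, of T c] by simp

lemma alg_sum: "(\<And>i. i \<in> I \<Longrightarrow> T i \<in> alg) \<Longrightarrow> (\<lambda>w k. \<Sum>i\<in>I. T i w k) \<in> alg"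
proof (induction I rule: infinite_finite_induct)
  case (insert i I)
  have "(\<lambda>w k. T i w k + (\<Sum>i\<in>I. T i w k)) \<in> alg"
    by (rule alg_add) (use insert in auto)
  with insert.hyps show ?case by simp
qed (simp_all only: sum.infinite sum.empty not_False_eq_True alg_zero)

text \<open>
  Products of commuting positive operators are positive. The iteration \<open>X' = X - X\<^sup>2\<close> keeps
  \<open>0 \<le> X \<le> I\<close>, writes \<open>X\<^sub>0\<close> as the sum of the squares \<open>X\<^sub>j\<^sup>2\<close>, and \<open>U X\<^sub>j\<^sup>2 = X\<^sub>j U X\<^sub>j \<ge> 0\<close>; no
  square roots or eigenvectors are needed.
\<close>

lemma psd_comp:
  assumes T: "T \<in> alg" and U: "U \<in> alg" and pT: "psd S T" and pU: "psd S U"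
    and c: "0 < c" and le: "\<And>w. ip S (T w) w \<le> c * ip S w w"
  shows "psd S (\<lambda>w. U (T w))"
  unfolding psd_def
proof
  fix w
  define X where "X = rec_nat (\<lambda>w k. (1/c) * T w k) (\<lambda>_ Y w k. Y w k - Y (Y w) k)"
  have X0: "X 0 = (\<lambda>w k. (1/c) * T w k)" and XS: "\<And>n. X (Suc n) = (\<lambda>w k. X n w k - X n (X n w) k)"
    by (simp_all add: X_def)
  have inv: "X n \<in> alg \<and> (\<forall>w. 0 \<le> ip S (X n w) w \<and> ip S (X n w) w \<le> ip S w w)" for n
  proof (induction n)
    case 0
    have "(1/c) * ip S (T w) w \<le> ip S w w \<and> 0 \<le> (1/c) * ip S (T w) w" for w
      using c le[of w] pT by (simp add: psd_def field_simps)
    then show ?case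
      unfolding X0 ip_scale_left by (intro conjI alg_scale[OF T] allI) auto
  next
    case (Suc n)
    let ?X = "X n"
    have A: "?X \<in> alg" and nn: "\<And>w. 0 \<le> ip S (?X w) w" and ub: "\<And>w. ip S (?X w) w \<le> ip S w w"
      using Suc by auto
    have mem: "X (Suc n) \<in> alg" unfolding XS by (rule alg_diff[OF A alg_comp[OF A A]])
    have "0 \<le> ip S (X (Suc n) w) w \<and> ip S (X (Suc n) w) w \<le> ip S w w" for w
    proof -
      let ?a = "ip S (?X w) w" and ?b = "ip S (?X w) (?X w)" and ?d = "ip S (?X (?X w)) (?X w)"
      have eq: "ip S (X (Suc n) w) w = ?a - ?b"
        by (simp add: XS ip_diff_left alg_sym[OF A, of "?X w"])
      have "?d \<le> ?b" by (rule ub)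
      moreover have "0 \<le> ip S (?X (\<lambda>k. w k - ?X w k)) (\<lambda>k. w k - ?X w k)" by (rule nn)
      then have "0 \<le> ?a - 2 * ?b + ?d"
        by (simp add: alg_minus[OF A] ip_diff_left ip_diff_right alg_sym[OF A, of "?X w" w])
      moreover have "?a \<le> ip S w w" by (rule ub)
      moreover have "0 \<le> ?b" by simp
      ultimately show ?thesis unfolding eq by linarith
    qed
    with mem show ?case by simp
  qed
  then have XA: "X n \<in> alg" and Xnn: "0 \<le> ip S (X n w) w" for n w by simp_all
  have tele: "ip S (X 0 w) w = (\<Sum>j<n. ip S (X j w) (X j w)) + ip S (X n w) w" for n
  proof (induction n)
    case (Suc n)
    have "ip S (X (Suc n) w) w = ip S (X n w) w - ip S (X n w) (X n w)"
      by (simp add: XS ip_diff_left alg_sym[OF XA, of n "X n w"])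
    with Suc show ?case by simp
  qed simp
  have "(\<Sum>j<n. ip S (X j w) (X j w)) \<le> ip S (X 0 w) w" for n
    using tele[of n] Xnn[of n w] by linarith
  then have "summable (\<lambda>j. ip S (X j w) (X j w))"
    by (intro summableI_nonneg_bounded) auto
  then have lim: "(\<lambda>n. ip S (X n w) (X n w)) \<longlonglongrightarrow> 0"
    by (rule summable_LIMSEQ_zero)
  have UX: "ip S (U (X n (X n w))) w = ip S (U (X n w)) (X n w)" for n
    unfolding alg_comm[OF U XA, of n "X n w"] alg_sym[OF XA] ..
  have teleU: "ip S (U (X 0 w)) w \<ge> ip S (U (X n w)) w" for n
  proof (induction n)
    case (Suc n)
    have "ip S (U (X (Suc n) w)) w = ip S (U (X n w)) w - ip S (U (X n w)) (X n w)"
      by (simp add: XS alg_minus[OF U] ip_diff_left UX)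
    moreover have "0 \<le> ip S (U (X n w)) (X n w)" using pU by (simp add: psd_def)
    ultimately show ?case using Suc by linarith
  qed simp
  have low: "- (sqrt (ip S (X n w) (X n w)) * sqrt (ip S (U w) (U w))) \<le> ip S (U (X 0 w)) w" for n
    using teleU[of n] ip_Cauchy_Schwarz[of S "X n w" "U w"] by (simp add: alg_sym[OF U])
  have "(\<lambda>n. - (sqrt (ip S (X n w) (X n w)) * sqrt (ip S (U w) (U w)))) \<longlonglongrightarrow> - (sqrt 0 * sqrt (ip S (U w) (U w)))"
    by (intro tendsto_intros lim)
  then have "(\<lambda>n. - (sqrt (ip S (X n w) (X n w)) * sqrt (ip S (U w) (U w)))) \<longlonglongrightarrow> 0"
    by simp
  then have "0 \<le> ip S (U (X 0 w)) w"
    by (rule LIMSEQ_le_const2) (use low in auto)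
  also have "\<dots> = (1/c) * ip S (U (T w)) w"
    unfolding X0 alg_scaled[OF U] ip_scale_left ..
  finally show "0 \<le> ip S (U (T w)) w" using c by (simp add: zero_le_divide_iff)
qed

end

section \<open>The energy method\<close>

lemma le_if_mult_right_le:
  fixes x y c :: real
  assumes "x * y \<le> c * y" "0 \<le> y" "y = 0 \<Longrightarrow> x \<le> c"
  shows "x \<le> c"
  using assms by (cases "y = 0") auto

text \<open>
  The variable coefficient makes \<open>v \<mapsto> B\<^sub>h(\<rho> v)\<close> nonsymmetric. Applying \<open>B\<^sub>h\<^sup>-\<^sup>1\<close> leaves multiplication by \<open>\<rho>\<close>,
  which is symmetric, and replaces \<open>A\<^sub>h\<close> by \<open>G = A\<^sub>h B\<^sub>h\<^sup>-\<^sup>1\<close>; as \<open>A\<^sub>h\<close> and \<open>B\<^sub>h\<close> commute, \<open>G\<close> is symmetric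
  too. The bounds that relate \<open>A\<^sub>h\<close>, \<open>B\<^sub>h\<close> and the identity have to be carried over to \<open>G\<close>: with
  \<open>w = B\<^sub>h z\<close> they turn into positivity of products of commuting operators, that is, into
  instances of \<open>psd_comp\<close>.
\<close>

locale energy_ops = commuting_ops +
  fixes A B :: "('a \<Rightarrow> real) \<Rightarrow> 'a \<Rightarrow> real" and \<nu>\<^sub>0 \<nu> q :: real
  assumes A: "A \<in> alg" and B: "B \<in> alg" and A_psd: "psd S A"
    and \<nu>\<^sub>0: "0 < \<nu>\<^sub>0" and \<nu>: "0 < \<nu>"
    and B_ge: "\<And>w. \<nu>\<^sub>0 * ip S w w \<le> ip S (B w) w"
    and B_le: "\<And>w. ip S (B w) w \<le> \<nu> * ip S w w"
    and A_le_B: "\<And>w. ip S (A w) w \<le> q * ip S (B w) w"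
begin

definition Binv :: "('a \<Rightarrow> real) \<Rightarrow> 'a \<Rightarrow> real" where
  "Binv w = (SOME z. (\<forall>k. k \<notin> S \<longrightarrow> z k = 0) \<and> (\<forall>k\<in>S. B z k = w k))"

lemma Binv: "(\<forall>k. k \<notin> S \<longrightarrow> Binv w k = 0) \<and> (\<forall>k\<in>S. B (Binv w) k = w k)"
proof -
  have "\<exists>z. (\<forall>k. k \<notin> S \<longrightarrow> z k = 0) \<and> (\<forall>k\<in>S. B z k = w k)"
  proof (rule positive_definite_imp_surjective[OF fin])
  show "B (\<lambda>k. v k + c * w k) k = B v k + c * B w k" for v c w k
    by (simp only: alg_lin[OF B])
  show "0 < ip S (B w) w" if "\<And>k. k \<notin> S \<Longrightarrow> w k = 0" "\<exists>k. w k \<noteq> 0" for w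
  proof -
    from that obtain k where "k \<in> S" "w k \<noteq> 0" by metis
    with ip_self_zero[OF fin, of w k] have "0 < ip S w w" by fastforce
    then show ?thesis using B_ge[of w] \<nu>\<^sub>0 by (smt (verit) mult_pos_pos)
  qed
qed
  then show ?thesis unfolding Binv_def by (rule someI_ex)
qed

lemma Binv_supp: "k \<notin> S \<Longrightarrow> Binv w k = 0"
  using Binv by simp

lemma B_Binv: "B (Binv w) = zext S w"
proof
  fix k show "B (Binv w) k = zext S w k"
    using Binv[of w] alg_supp[OF B] by (cases "k \<in> S") (simp_all add: zext_def)
qed

lemma B_inj:
  assumes "\<And>k. k \<notin> S \<Longrightarrow> v k = 0" "\<And>k. k \<notin> S \<Longrightarrow> w k = 0" "B v = B w"
  shows "v = w"
proof
  fix k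
  have "\<nu>\<^sub>0 * ip S (\<lambda>k. v k - w k) (\<lambda>k. v k - w k) \<le> ip S (B (\<lambda>k. v k - w k)) (\<lambda>k. v k - w k)"
    by (rule B_ge)
  also have "\<dots> = 0" unfolding alg_minus[OF B] assms(3) by (simp add: ip_def)
  finally have "ip S (\<lambda>k. v k - w k) (\<lambda>k. v k - w k) \<le> 0"
    using \<nu>\<^sub>0 by (simp add: mult_le_0_iff)
  from ip_self_zero[OF fin this, of k] show "v k = w k"
    using assms(1,2)[of k] by (cases "k \<in> S") auto
qed

lemma Binv_lin: "Binv (\<lambda>k. v k + c * w k) = (\<lambda>k. Binv v k + c * Binv w k)"
proof (rule B_inj)
  show "B (Binv (\<lambda>k. v k + c * w k)) = B (\<lambda>k. Binv v k + c * Binv w k)"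
    unfolding alg_lin[OF B] B_Binv by (auto simp: zext_def)
qed (simp_all add: Binv_supp)

definition G :: "('a \<Rightarrow> real) \<Rightarrow> 'a \<Rightarrow> real" where
  "G w = A (Binv w)"

lemma G_lin: "G (\<lambda>k. v k + c * w k) = (\<lambda>k. G v k + c * G w k)"
  unfolding G_def Binv_lin alg_lin[OF A] ..

lemma G_scale: "G (\<lambda>k. c * w k) = (\<lambda>k. c * G w k)"
proof -
  have "G (\<lambda>k. w k + (c - 1) * w k) = (\<lambda>k. G w k + (c - 1) * G w k)" by (rule G_lin)
  then show ?thesis by (simp add: algebra_simps)
qed

lemma G_sym: "ip S (G v) w = ip S v (G w)"
proof -
  let ?y = "Binv v" and ?z = "Binv w"
  have "ip S (G v) w = ip S (A ?y) (B ?z)" by (simp add: G_def B_Binv)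
  also have "\<dots> = ip S ?y (B (A ?z))" unfolding alg_sym[OF A] alg_comm[OF A B, of ?z] ..
  also have "\<dots> = ip S (B ?y) (A ?z)" unfolding alg_sym[OF B] ..
  finally show ?thesis by (simp add: G_def B_Binv)
qed

lemma B_psd: "psd S B"
  unfolding psd_def using B_ge \<nu>\<^sub>0 by (meson ip_self_nonneg less_eq_real_def mult_nonneg_nonneg order_trans)

lemma ip_G: "ip S (G w) w = ip S (A (B (Binv w))) (Binv w)"
  unfolding alg_comm[OF A B, of "Binv w"] alg_sym[OF B] by (simp add: G_def B_Binv)

lemma G_nonneg: "0 \<le> ip S (G w) w"
  unfolding ip_G using psd_comp[OF B A B_psd A_psd \<nu> B_le] by (simp add: psd_def)

lemma G_le: "ip S (G w) w \<le> q * ip S w w"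
proof -
  let ?U = "\<lambda>w k. q * B w k - A w k" and ?z = "Binv w"
  have U: "?U \<in> alg" by (rule alg_diff[OF alg_scale[OF B] A])
  have "psd S ?U" unfolding psd_def by (simp add: ip_diff_left ip_scale_left A_le_B)
  from psd_comp[OF B U B_psd this \<nu> B_le] have "0 \<le> ip S (?U (B ?z)) ?z"
    by (simp add: psd_def)
  then have "ip S (A (B ?z)) ?z \<le> q * ip S (B (B ?z)) ?z"
    by (simp add: ip_diff_left ip_scale_left)
  also have "ip S (B (B ?z)) ?z = ip S w w"
    unfolding alg_sym[OF B, of "B ?z"] by (simp add: B_Binv)
  finally show ?thesis by (simp add: ip_G)
qed

text \<open>
  In terms of \<open>z = B\<^sup>-\<^sup>1 w\<close> this is positivity of the product of the commuting operators \<open>A\<close> and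
  \<open>B (\<nu> I - B)\<close>.
\<close>

lemma A_le_G: "ip S (A w) w \<le> \<nu> * ip S (G w) w"
proof -
  let ?V = "\<lambda>w k. \<nu> * zext S w k - B w k" and ?z = "Binv w"
  have V: "?V \<in> alg" by (rule alg_diff[OF alg_scale[OF alg_one] B])
  have "psd S ?V" unfolding psd_def by (simp add: ip_diff_left ip_scale_left B_le)
  from psd_comp[OF B V B_psd this \<nu> B_le] have W: "psd S (\<lambda>w. ?V (B w))" .
  have le: "ip S (?V (B w)) w \<le> \<nu>\<^sup>2 * ip S w w" for w
  proof -
    have "ip S (?V (B w)) w = \<nu> * ip S (B w) w - ip S (B w) (B w)"
      by (simp add: ip_diff_left ip_scale_left alg_sym[OF B, of "B w"])
    also have "\<dots> \<le> \<nu> * ip S (B w) w" by simp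
    also have "\<dots> \<le> \<nu> * (\<nu> * ip S w w)" using B_le \<nu> by (simp add: mult_left_mono)
    finally show ?thesis by (simp add: power2_eq_square mult.assoc)
  qed
  have "0 \<le> ip S (A (?V (B ?z))) ?z"
    using psd_comp[OF alg_comp[OF V B] A W A_psd _ le] \<nu> by (simp add: psd_def)
  also have "A (?V (B ?z)) = (\<lambda>k. \<nu> * A (B ?z) k - A (B (B ?z)) k)"
    unfolding alg_minus[OF A] alg_scaled[OF A] alg_zext[OF A] ..
  also have "ip S \<dots> ?z = \<nu> * ip S (A (B ?z)) ?z - ip S (A (B ?z)) (B ?z)"
    unfolding ip_diff_left ip_scale_left alg_comm[OF A B, of "B ?z"] alg_sym[OF B] ..
  also have "ip S (A (B ?z)) (B ?z) = ip S (A w) w"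
    unfolding B_Binv alg_zext[OF A] by simp
  finally show ?thesis by (simp add: ip_G)
qed

lemma Binv_norm: "sqrt (ip S (Binv w) (Binv w)) \<le> sqrt (ip S w w) / \<nu>\<^sub>0"
proof -
  let ?z = "Binv w"
  have "\<nu>\<^sub>0 * ip S ?z ?z \<le> ip S (B ?z) ?z" by (rule B_ge)
  also have "\<dots> = ip S w ?z" by (simp add: B_Binv)
  also have "\<dots> \<le> sqrt (ip S w w) * sqrt (ip S ?z ?z)" by (rule ip_Cauchy_Schwarz')
  finally have "(\<nu>\<^sub>0 * sqrt (ip S ?z ?z)) * sqrt (ip S ?z ?z) \<le> sqrt (ip S w w) * sqrt (ip S ?z ?z)"
    by (simp add: mult.assoc)
  then have "\<nu>\<^sub>0 * sqrt (ip S ?z ?z) \<le> sqrt (ip S w w)"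
    by (rule le_if_mult_right_le) simp_all
  then show ?thesis using \<nu>\<^sub>0 by (simp add: field_simps)
qed

text \<open>
  The error equation after multiplication by \<open>B\<^sup>-\<^sup>1\<close>: both sides have the same image under \<open>B\<close>,
  and \<open>B\<close> is injective on functions supported in \<open>S\<close>.
\<close>

lemma apply_Binv:
  assumes "\<And>k. k \<in> S \<Longrightarrow> B l k + c * A d k + A y k = \<psi> k" and "k \<in> S"
  shows "l k + c * G d k + G y k = Binv \<psi> k"
proof -
  let ?r = "\<lambda>k. (zext S l k + c * G d k) + G y k"
  have "?r = Binv \<psi>"
  proof (rule B_inj)
    show "?r k = 0" if "k \<notin> S" for k
      using that by (simp add: zext_def G_def alg_supp[OF A])
    have BG: "B (G w) = A w" for w
      unfolding G_def alg_comm[OF B A] B_Binv alg_zext[OF A] ..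
    have "B ?r = (\<lambda>k. (B l k + c * A d k) + A y k)"
      unfolding alg_plus[OF B, of "\<lambda>k. zext S l k + c * G d k" "G y"]
        alg_lin[OF B, of "zext S l" c "G d"] alg_zext[OF B] BG ..
    also have "\<dots> = zext S \<psi>"
      using assms(1) by (auto simp: zext_def alg_supp[OF A] alg_supp[OF B])
    finally show "B ?r = B (Binv \<psi>)" by (simp only: B_Binv)
  qed (rule Binv_supp)
  from fun_cong[OF this, of k] assms(2) show ?thesis by (simp add: zext_def)
qed

end

text \<open>
  The inequality \<open>\<tau>\<^sup>2 q / 6 \<le> (1 - \<epsilon>\<^sup>2) \<rho>\<^sub>m\<^sub>i\<^sub>n\<close> with \<open>A \<le> q B\<close> is the common form of the stability conditions
  of the three schemes.
\<close>

locale energy_scheme = energy_ops +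
  fixes \<rho> :: "'a \<Rightarrow> real" and \<rho>min \<tau> \<epsilon> :: real
  assumes \<rho>min: "0 < \<rho>min" and \<rho>: "\<And>k. k \<in> S \<Longrightarrow> \<rho>min \<le> \<rho> k"
    and \<tau>: "0 < \<tau>" and \<epsilon>: "0 < \<epsilon>" "\<epsilon> < 1"
    and step: "(1/6) * \<tau>\<^sup>2 * q \<le> (1 - \<epsilon>\<^sup>2) * \<rho>min"
begin

text \<open>
  The conserved quantity in terms of \<open>d = (e\<^sup>m - e\<^sup>m\<^sup>-\<^sup>1)/\<tau>\<close> and \<open>s = (e\<^sup>m\<^sup>-\<^sup>1 + e\<^sup>m)/2\<close>. The weight \<open>-\<tau>\<^sup>2/6\<close> of
  \<open>(G d, d)\<close> is \<open>\<tau>\<^sup>2/12 - \<tau>\<^sup>2/4\<close>: the first part comes from the scheme, the second from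
  \<open>(G e\<^sup>m\<^sup>-\<^sup>1, e\<^sup>m) = (G s, s) - (\<tau>\<^sup>2/4) (G d, d)\<close>.
\<close>

definition energy :: "('a \<Rightarrow> real) \<Rightarrow> ('a \<Rightarrow> real) \<Rightarrow> real" where
  "energy d s = ip S (\<lambda>k. \<rho> k * d k) d - (1/6) * \<tau>\<^sup>2 * ip S (G d) d + ip S (G s) s"

lemma rho_ge: "\<rho>min * ip S d d \<le> ip S (\<lambda>k. \<rho> k * d k) d"
  unfolding ip_def sum_distrib_left
  by (rule sum_mono) (simp add: \<rho> mult.assoc mult_right_mono)

text \<open>
  The negative term of the energy is absorbed by the stability condition, because
  \<open>G \<le> q\<close>.
\<close>

lemma energy_ge: "\<epsilon>\<^sup>2 * ip S (\<lambda>k. \<rho> k * d k) d + ip S (G s) s \<le> energy d s"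
proof -
  let ?r = "ip S (\<lambda>k. \<rho> k * d k) d"
  have "(1/6) * \<tau>\<^sup>2 * ip S (G d) d \<le> (1/6) * \<tau>\<^sup>2 * (q * ip S d d)"
    by (intro mult_left_mono G_le) simp
  also have "\<dots> = ((1/6) * \<tau>\<^sup>2 * q) * ip S d d" by simp
  also have "\<dots> \<le> ((1 - \<epsilon>\<^sup>2) * \<rho>min) * ip S d d"
    by (intro mult_right_mono step) simp
  also have "\<dots> = (1 - \<epsilon>\<^sup>2) * (\<rho>min * ip S d d)" by simp
  also have "\<dots> \<le> (1 - \<epsilon>\<^sup>2) * ?r"
    using \<epsilon> by (intro mult_left_mono rho_ge) (simp add: power_le_one_iff abs_square_le_1)
  finally show ?thesis by (simp add: energy_def algebra_simps)
qed

lemma rho_nonneg: "0 \<le> ip S (\<lambda>k. \<rho> k * d k) d"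
  using rho_ge[of d] \<rho>min by (meson ip_self_nonneg less_eq_real_def mult_nonneg_nonneg order_trans)

lemma energy_nonneg: "0 \<le> energy d s"
  using energy_ge[of d s] rho_nonneg[of d] G_nonneg[of s]
  by (smt (verit) mult_nonneg_nonneg zero_le_power2)

definition \<kappa> :: real where "\<kappa> = \<epsilon> * sqrt \<rho>min"

lemma \<kappa>_pos: "0 < \<kappa>"
  using \<epsilon> \<rho>min by (simp add: \<kappa>_def)

lemma norm_le_energy: "\<kappa> * sqrt (ip S d d) \<le> sqrt (energy d s)"
proof (rule real_le_rsqrt)
  have "(\<kappa> * sqrt (ip S d d))\<^sup>2 = \<epsilon>\<^sup>2 * (\<rho>min * ip S d d)"
    using \<rho>min by (simp add: \<kappa>_def power_mult_distrib)
  also have "\<dots> \<le> \<epsilon>\<^sup>2 * ip S (\<lambda>k. \<rho> k * d k) d"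
    by (intro mult_left_mono rho_ge) simp
  also have "\<dots> \<le> energy d s" using energy_ge[of d s] G_nonneg[of s] by linarith
  finally show "(\<kappa> * sqrt (ip S d d))\<^sup>2 \<le> energy d s" .
qed

text \<open>
  Testing the difference equation with \<open>d' + d\<close>, the sum of two consecutive difference quotients
  in time: each of its three terms turns into a difference of quadratic forms.
\<close>

lemma energy_balance:
  assumes "\<And>k. k \<in> S \<Longrightarrow> \<rho> k * ((d' k - d k) / \<tau>) + (1/12) * \<tau>\<^sup>2 * G (\<lambda>k. (d' k - d k) / \<tau>) k + G e k = \<phi> k"
  shows "energy d' (\<lambda>k. e k + (\<tau>/2) * d' k) - energy d (\<lambda>k. e k + (-\<tau>/2) * d k)
    = \<tau> * ip S \<phi> (\<lambda>k. d' k + d k)"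
proof -
  let ?D = "\<lambda>k. d' k + d k" and ?L = "\<lambda>k. d' k + (-1) * d k"
  have L: "(\<lambda>k. (d' k - d k) / \<tau>) = (\<lambda>k. (1/\<tau>) * ?L k)"
    by auto
  have "\<tau> * ip S \<phi> ?D = ip S (\<lambda>k. \<tau> * \<phi> k) ?D" by (simp only: ip_scale_left)
  also have "\<dots> = ip S (\<lambda>k. (\<rho> k * ?L k + ((1/12) * \<tau>\<^sup>2) * G ?L k) + \<tau> * G e k) ?D"
  proof (rule ip_cong)
    fix k assume "k \<in> S"
    have "\<tau> * (r * (l / \<tau>) + (1/12) * \<tau>\<^sup>2 * ((1/\<tau>) * x) + g) = (r * l + ((1/12) * \<tau>\<^sup>2) * x) + \<tau> * g"
      for r l x g :: real
      using \<tau> by (simp add: field_simps power2_eq_square)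
    then show "\<tau> * \<phi> k = (\<rho> k * ?L k + ((1/12) * \<tau>\<^sup>2) * G ?L k) + \<tau> * G e k"
      unfolding assms[OF \<open>k \<in> S\<close>, symmetric] L G_scale by simp
  qed simp
  also have "\<dots> = ip S (\<lambda>k. \<rho> k * ?L k) ?D + ((1/12) * \<tau>\<^sup>2) * ip S (G ?L) ?D + \<tau> * ip S (G e) ?D"
    unfolding ip_lin_left ..
  also have "ip S (\<lambda>k. \<rho> k * ?L k) ?D = ip S (\<lambda>k. \<rho> k * d' k) d' - ip S (\<lambda>k. \<rho> k * d k) d"
    by (simp add: ip_def sum_subtractf[symmetric] algebra_simps)
  also have "ip S (G ?L) ?D = ip S (G d') d' - ip S (G d) d"
    unfolding G_lin ip_lin_left ip_add_right G_sym[of d d'] ip_commute[of S d] by simp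
  also have "ip S (G e) ?D = ip S (G e) d' + ip S (G e) d" by (rule ip_add_right)
  finally have rhs: "\<tau> * ip S \<phi> ?D = ip S (\<lambda>k. \<rho> k * d' k) d' - ip S (\<lambda>k. \<rho> k * d k) d
      + ((1/12) * \<tau>\<^sup>2) * (ip S (G d') d' - ip S (G d) d) + \<tau> * (ip S (G e) d' + ip S (G e) d)" .
  have quad: "ip S (G (\<lambda>k. e k + c * y k)) (\<lambda>k. e k + c * y k)
      = ip S (G e) e + 2 * c * ip S (G e) y + c\<^sup>2 * ip S (G y) y" for c y
    unfolding G_lin ip_lin_left ip_lin_right G_sym[of y e] ip_commute[of S y "G e"]
    by (simp add: power2_eq_square algebra_simps)
  show ?thesis
    unfolding rhs energy_def quad by (simp add: power2_eq_square algebra_simps)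
qed

text \<open>
  By the balance and the Cauchy-Schwarz inequality the energy difference is at most a multiple of
  the sum of the two square roots; dividing by that sum leaves a bound for their difference.
\<close>

lemma energy_growth:
  assumes "\<And>k. k \<in> S \<Longrightarrow> \<rho> k * ((d' k - d k) / \<tau>) + (1/12) * \<tau>\<^sup>2 * G (\<lambda>k. (d' k - d k) / \<tau>) k + G e k = \<phi> k"
    and "sqrt (ip S \<phi> \<phi>) \<le> b"
  shows "sqrt (energy d' (\<lambda>k. e k + (\<tau>/2) * d' k))
    \<le> sqrt (energy d (\<lambda>k. e k + (-\<tau>/2) * d k)) + \<tau> * b / \<kappa>"
proof -
  let ?E' = "energy d' (\<lambda>k. e k + (\<tau>/2) * d' k)" and ?E = "energy d (\<lambda>k. e k + (-\<tau>/2) * d k)"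
  have b: "0 \<le> b" using assms(2) ip_self_nonneg[of S \<phi>] by (meson order_trans real_sqrt_ge_zero)
  have bd: "ip S \<phi> y \<le> b * (sqrt (energy y s) / \<kappa>)" for y s
  proof -
    have "ip S \<phi> y \<le> sqrt (ip S \<phi> \<phi>) * sqrt (ip S y y)" by (rule ip_Cauchy_Schwarz')
    also have "\<dots> \<le> b * (sqrt (energy y s) / \<kappa>)"
      using norm_le_energy[of y s] \<kappa>_pos b assms(2)
      by (intro mult_mono) (simp_all add: field_simps)
    finally show ?thesis .
  qed
  have "?E' - ?E = \<tau> * (ip S \<phi> d' + ip S \<phi> d)"
    using energy_balance[OF assms(1)] by (simp only: ip_add_right)
  also have "\<dots> \<le> \<tau> * (b * (sqrt ?E' / \<kappa>) + b * (sqrt ?E / \<kappa>))"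
    using \<tau> by (intro mult_left_mono add_mono bd) simp
  also have "\<dots> = (\<tau> * b / \<kappa>) * (sqrt ?E' + sqrt ?E)"
    by (simp add: algebra_simps add_divide_distrib)
  finally have *: "?E' - ?E \<le> (\<tau> * b / \<kappa>) * (sqrt ?E' + sqrt ?E)" .
  have "?E' - ?E = (sqrt ?E' - sqrt ?E) * (sqrt ?E' + sqrt ?E)"
    using energy_nonneg by (simp add: algebra_simps flip: power2_eq_square)
  with * have "(sqrt ?E' - sqrt ?E) * (sqrt ?E' + sqrt ?E) \<le> (\<tau> * b / \<kappa>) * (sqrt ?E' + sqrt ?E)"
    by simp
  moreover have "0 \<le> sqrt ?E" "0 \<le> sqrt ?E'" "0 \<le> \<tau> * b / \<kappa>"
    using energy_nonneg \<tau> b \<kappa>_pos by simp_all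
  ultimately show ?thesis
    using le_if_mult_right_le[of "sqrt ?E' - sqrt ?E" "sqrt ?E' + sqrt ?E" "\<tau> * b / \<kappa>"] by linarith
qed

text \<open>
  Starting from rest, the first energy is the work \<open>(\<phi>\<^sup>0, d\<^sup>1)\<close> of the initial residual; later
  residuals enter with the weight \<open>\<tau>\<close>, and there are at most \<open>M\<close> of them.
\<close>

theorem energy_estimate:
  fixes e :: "nat \<Rightarrow> 'a \<Rightarrow> real"
  assumes e0: "\<And>k. k \<in> S \<Longrightarrow> e 0 k = 0"
    and eq: "\<And>m k. 1 \<le> m \<Longrightarrow> m < M \<Longrightarrow> k \<in> S \<Longrightarrow>
      B (\<lambda>j. \<rho> j * ((e (m + 1) j - 2 * e m j + e (m - 1) j) / \<tau>\<^sup>2)) k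
      + (1/12) * \<tau>\<^sup>2 * A (\<lambda>j. (e (m + 1) j - 2 * e m j + e (m - 1) j) / \<tau>\<^sup>2) k + A (e m) k = \<psi> m k"
    and eq0: "\<And>k. k \<in> S \<Longrightarrow> B (\<lambda>j. \<rho> j * ((e 1 j - e 0 j) / \<tau>)) k
      + (1/12) * \<tau>\<^sup>2 * A (\<lambda>j. (e 1 j - e 0 j) / \<tau>) k = \<psi> 0 k"
    and \<psi>: "\<And>m. m < M \<Longrightarrow> sqrt (ip S (\<psi> m) (\<psi> m)) \<le> \<delta>"
    and m: "1 \<le> m" "m \<le> M"
  defines "d \<equiv> \<lambda>m k. (e m k - e (m - 1) k) / \<tau>" and "s \<equiv> \<lambda>m k. (e (m - 1) k + e m k) / 2"
  shows "\<epsilon> * sqrt (ip S (\<lambda>k. \<rho> k * d m k) (d m)) + sqrt (ip S (A (s m)) (s m))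
    \<le> (1 + sqrt \<nu>) * ((1 + real M * \<tau>) * (\<delta> / (\<nu>\<^sub>0 * \<kappa>)))"
proof -
  define E where "E = (\<lambda>m. sqrt (energy (d m) (s m)))"
  let ?b = "\<delta> / \<nu>\<^sub>0"
  have bd: "sqrt (ip S (Binv (\<psi> m)) (Binv (\<psi> m))) \<le> ?b" if "m < M" for m
    using Binv_norm[of "\<psi> m"] \<psi>[OF that] \<nu>\<^sub>0 by (meson divide_right_mono less_imp_le order_trans)
  have "0 \<le> sqrt (ip S (Binv (\<psi> 0)) (Binv (\<psi> 0)))" by simp
  also have "\<dots> \<le> ?b" using bd[of 0] m by simp
  finally have b: "0 \<le> ?b" .
  have E1: "E 1 \<le> ?b / \<kappa>"
  proof -
    have eq1: "\<rho> k * d 1 k + (1/12) * \<tau>\<^sup>2 * G (d 1) k + G (\<lambda>_. 0) k = Binv (\<psi> 0) k" if "k \<in> S" for k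
      by (rule apply_Binv[OF _ that]) (use eq0 in \<open>simp add: d_def alg_0[OF A]\<close>)
    have G0: "G (\<lambda>_. 0) = (\<lambda>_. 0)" using G_scale[of 0 "\<lambda>_. 0"] by simp
    \<comment> \<open>as the initial error vanishes, s 1 is d 1 scaled by half a time step\<close>
    have s1: "ip S (G (s 1)) (s 1) = (\<tau>/2)\<^sup>2 * ip S (G (d 1)) (d 1)"
    proof -
      have "ip S (G (s 1)) (s 1) = ip S (G (s 1)) (\<lambda>k. (\<tau>/2) * d 1 k)"
        by (rule ip_cong) (use e0 \<tau> in \<open>auto simp: s_def d_def\<close>)
      also have "\<dots> = ip S (s 1) (G (\<lambda>k. (\<tau>/2) * d 1 k))" by (rule G_sym)
      also have "\<dots> = ip S (\<lambda>k. (\<tau>/2) * d 1 k) (G (\<lambda>k. (\<tau>/2) * d 1 k))"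
        by (rule ip_cong) (use e0 \<tau> in \<open>auto simp: s_def d_def\<close>)
      also have "\<dots> = (\<tau>/2)\<^sup>2 * ip S (G (d 1)) (d 1)"
        unfolding G_scale ip_scale_left ip_scale_right ip_commute[of S "d 1"] power2_eq_square by simp
      finally show ?thesis .
    qed
    have "energy (d 1) (s 1) = ip S (\<lambda>k. \<rho> k * d 1 k + ((1/12) * \<tau>\<^sup>2) * G (d 1) k) (d 1)"
      unfolding energy_def s1 ip_lin_left by (simp add: power2_eq_square algebra_simps)
    also have "\<dots> = ip S (Binv (\<psi> 0)) (d 1)"
      by (rule ip_cong) (use eq1 G0 in auto)
    also have "\<dots> \<le> sqrt (ip S (Binv (\<psi> 0)) (Binv (\<psi> 0))) * sqrt (ip S (d 1) (d 1))"
      by (rule ip_Cauchy_Schwarz')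
    also have "\<dots> \<le> ?b * (E 1 / \<kappa>)"
      using norm_le_energy[of "d 1" "s 1"] \<kappa>_pos bd[of 0] m b
      by (intro mult_mono) (simp_all add: field_simps E_def)
    finally have "E 1 * E 1 \<le> (?b / \<kappa>) * E 1"
      using energy_nonneg by (simp add: E_def)
    moreover have "0 \<le> E 1" "0 \<le> ?b / \<kappa>"
      using energy_nonneg b \<kappa>_pos by (simp_all add: E_def del: divide_divide_eq_left)
    ultimately show ?thesis by (metis le_if_mult_right_le)
  qed
  have ES: "E (m + 1) \<le> E m + \<tau> * ?b / \<kappa>" if m: "1 \<le> m" "m < M" for m
  proof -
    have "s (m + 1) = (\<lambda>k. e m k + (\<tau>/2) * d (m + 1) k)" "s m = (\<lambda>k. e m k + (-\<tau>/2) * d m k)"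
      using \<tau> by (auto simp: s_def d_def field_simps)
    moreover have "sqrt (energy (d (m + 1)) (\<lambda>k. e m k + (\<tau>/2) * d (m + 1) k))
      \<le> sqrt (energy (d m) (\<lambda>k. e m k + (-\<tau>/2) * d m k)) + \<tau> * ?b / \<kappa>"
    proof (rule energy_growth[OF _ bd[OF m(2)]])
      fix k assume k: "k \<in> S"
      have L: "(\<lambda>j. (d (m + 1) j - d m j) / \<tau>) = (\<lambda>j. (e (m + 1) j - 2 * e m j + e (m - 1) j) / \<tau>\<^sup>2)"
        using \<tau> by (auto simp: d_def field_simps power2_eq_square)
      show "\<rho> k * ((d (m + 1) k - d m k) / \<tau>) + (1/12) * \<tau>\<^sup>2 * G (\<lambda>k. (d (m + 1) k - d m k) / \<tau>) k
        + G (e m) k = Binv (\<psi> m) k"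
        unfolding L fun_cong[OF L, of k] by (rule apply_Binv[OF _ k]) (rule eq[OF m])
    qed
    ultimately show ?thesis by (simp add: E_def)
  qed
  have Em: "E m \<le> (1 + (real m - 1) * \<tau>) * (?b / \<kappa>)"
    using m
  proof (induction m rule: dec_induct)
    case (step m)
    then have "E (Suc m) \<le> (1 + (real m - 1) * \<tau>) * (?b / \<kappa>) + \<tau> * ?b / \<kappa>"
      using ES[of m] by simp
    then show ?case by (simp add: algebra_simps)
  qed (use E1 in simp)
  also have "\<dots> \<le> (1 + real M * \<tau>) * (?b / \<kappa>)"
  proof (rule mult_right_mono)
    have "(real m - 1) * \<tau> \<le> real M * \<tau>"
      using m \<tau> by (intro mult_right_mono) auto
    then show "1 + (real m - 1) * \<tau> \<le> 1 + real M * \<tau>" by simp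
    show "0 \<le> ?b / \<kappa>" by (rule divide_nonneg_pos[OF b \<kappa>_pos])
  qed
  finally have EM: "E m \<le> (1 + real M * \<tau>) * (\<delta> / (\<nu>\<^sub>0 * \<kappa>))" by simp
  have "\<epsilon> * sqrt (ip S (\<lambda>k. \<rho> k * d m k) (d m)) = sqrt (\<epsilon>\<^sup>2 * ip S (\<lambda>k. \<rho> k * d m k) (d m))"
    using \<epsilon> by (simp add: real_sqrt_mult)
  also have "\<dots> \<le> E m"
    unfolding E_def using energy_ge[of "d m" "s m"] G_nonneg[of "s m"] by (intro real_sqrt_le_mono) linarith
  finally have 1: "\<epsilon> * sqrt (ip S (\<lambda>k. \<rho> k * d m k) (d m)) \<le> E m" .
  have "ip S (G (s m)) (s m) \<le> energy (d m) (s m)"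
    using energy_ge[of "d m" "s m"] rho_nonneg[of "d m"] by (smt (verit) mult_nonneg_nonneg zero_le_power2)
  then have "ip S (A (s m)) (s m) \<le> \<nu> * energy (d m) (s m)"
    using A_le_G[of "s m"] \<nu> by (meson less_imp_le mult_left_mono order_trans)
  then have 2: "sqrt (ip S (A (s m)) (s m)) \<le> sqrt \<nu> * E m"
    unfolding E_def real_sqrt_mult[symmetric] by (rule real_sqrt_le_mono)
  have "\<epsilon> * sqrt (ip S (\<lambda>k. \<rho> k * d m k) (d m)) + sqrt (ip S (A (s m)) (s m)) \<le> (1 + sqrt \<nu>) * E m"
    using 1 2 by (simp add: algebra_simps)
  also have "\<dots> \<le> (1 + sqrt \<nu>) * ((1 + real M * \<tau>) * (\<delta> / (\<nu>\<^sub>0 * \<kappa>)))"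
    using EM \<nu> by (intro mult_left_mono) auto
  finally show ?thesis .
qed

end

section \<open>Smooth functions on a box\<close>

lemma Ck_on_cong:
  assumes "Ck_on k S f" "\<And>x. x \<in> S \<Longrightarrow> f x = g x"
  shows "Ck_on k S g"
proof (cases k)
  case 0
  then show ?thesis using assms continuous_on_cong[of S S f g] by simp
next
  case (Suc n)
  then obtain f' where f': "\<And>x. x \<in> S \<Longrightarrow> (f has_derivative (\<lambda>y. \<Sum>i\<in>Basis. (y \<bullet> i) * f' i x)) (at x within S)"
    "\<And>i. i \<in> Basis \<Longrightarrow> Ck_on n S (f' i)"
    using assms(1) by auto
  have "(g has_derivative (\<lambda>y. \<Sum>i\<in>Basis. (y \<bullet> i) * f' i x)) (at x within S)" if "x \<in> S" for x
    by (rule has_derivative_transform[OF that _ f'(1)[OF that]]) (simp add: assms(2))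
  with f'(2) Suc show ?thesis by (auto intro!: exI[of _ f'])
qed

lemma Ck_on_SucI:
  assumes "\<And>x. x \<in> S \<Longrightarrow> (f has_derivative (\<lambda>y. \<Sum>i\<in>Basis. (y \<bullet> i) * f' i x)) (at x within S)"
    "\<And>i. i \<in> Basis \<Longrightarrow> Ck_on n S (f' i)"
  shows "Ck_on (Suc n) S f"
  using assms by auto

lemma Ck_on_SucE:
  assumes "Ck_on (Suc n) S f"
  obtains f' where "\<And>x. x \<in> S \<Longrightarrow> (f has_derivative (\<lambda>y. \<Sum>i\<in>Basis. (y \<bullet> i) * f' i x)) (at x within S)"
    "\<And>i. i \<in> Basis \<Longrightarrow> Ck_on n S (f' i)"
  using assms by auto

text \<open>
  Unfolding the existential quantifier in this equation would defeat every later rewriting step.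
\<close>

declare Ck_on.simps(2) [simp del]

lemma Ck_on_SucD: "Ck_on (Suc k) S f \<Longrightarrow> Ck_on k S f"
proof (induction k arbitrary: f)
  case 0
  then show ?case
    by (elim Ck_on_SucE) (auto simp: continuous_on_eq_continuous_within intro: has_derivative_continuous)
next
  case (Suc k)
  from Suc.prems obtain f' where
    "\<And>x. x \<in> S \<Longrightarrow> (f has_derivative (\<lambda>y. \<Sum>i\<in>Basis. (y \<bullet> i) * f' i x)) (at x within S)"
    "\<And>i. i \<in> Basis \<Longrightarrow> Ck_on (Suc k) S (f' i)"
    by (elim Ck_on_SucE) auto
  then show ?case by (intro Ck_on_SucI[of S f f']) (auto intro: Suc.IH)
qed

lemma Ck_on_mono: "Ck_on k S f \<Longrightarrow> j \<le> k \<Longrightarrow> Ck_on j S f"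
  by (induction k) (auto simp: le_Suc_eq dest: Ck_on_SucD )

lemma Ck_on_imp_continuous_on: "Ck_on k S f \<Longrightarrow> continuous_on S f"
  using Ck_on_mono[of k S f 0] by simp

lemma Ck_on_zero: "Ck_on k S (\<lambda>_. 0)"
proof (induction k)
  case (Suc k)
  show ?case by (rule Ck_on_SucI[of _ _ "\<lambda>_ _. 0"]) (simp_all add: Suc)
qed simp

lemma Ck_on_lincomb:
  assumes "Ck_on k S f" "Ck_on k S g"
  shows "Ck_on k S (\<lambda>x. f x + c * g x)"
  using assms
proof (induction k arbitrary: f g)
  case 0
  then show ?case by (auto intro!: continuous_intros)
next
  case (Suc k)
  obtain f' where f': "\<And>x. x \<in> S \<Longrightarrow> (f has_derivative (\<lambda>y. \<Sum>i\<in>Basis. (y \<bullet> i) * f' i x)) (at x within S)"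
    "\<And>i. i \<in> Basis \<Longrightarrow> Ck_on k S (f' i)" using Suc.prems(1) by (elim Ck_on_SucE) auto
  obtain g' where g': "\<And>x. x \<in> S \<Longrightarrow> (g has_derivative (\<lambda>y. \<Sum>i\<in>Basis. (y \<bullet> i) * g' i x)) (at x within S)"
    "\<And>i. i \<in> Basis \<Longrightarrow> Ck_on k S (g' i)" using Suc.prems(2) by (elim Ck_on_SucE) auto
  show ?case
  proof (rule Ck_on_SucI)
    show "((\<lambda>x. f x + c * g x) has_derivative (\<lambda>y. \<Sum>i\<in>Basis. (y \<bullet> i) * (f' i x + c * g' i x))) (at x within S)"
      if "x \<in> S" for x
      by (rule derivative_eq_intros f'(1)[OF that] g'(1)[OF that] refl)+
        (simp add: fun_eq_iff algebra_simps sum.distrib sum_distrib_left)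
  qed (auto intro!: Suc.IH f' g')
qed

lemma Ck_on_mult:
  assumes "Ck_on k S f" "Ck_on k S g"
  shows "Ck_on k S (\<lambda>x. f x * g x)"
  using assms
proof (induction k arbitrary: f g)
  case 0
  then show ?case by (auto intro!: continuous_intros)
next
  case (Suc k)
  obtain f' where f': "\<And>x. x \<in> S \<Longrightarrow> (f has_derivative (\<lambda>y. \<Sum>i\<in>Basis. (y \<bullet> i) * f' i x)) (at x within S)"
    "\<And>i. i \<in> Basis \<Longrightarrow> Ck_on k S (f' i)" using Suc.prems(1) by (elim Ck_on_SucE) auto
  obtain g' where g': "\<And>x. x \<in> S \<Longrightarrow> (g has_derivative (\<lambda>y. \<Sum>i\<in>Basis. (y \<bullet> i) * g' i x)) (at x within S)"
    "\<And>i. i \<in> Basis \<Longrightarrow> Ck_on k S (g' i)" using Suc.prems(2) by (elim Ck_on_SucE) auto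
  show ?case
  proof (rule Ck_on_SucI)
    show "((\<lambda>x. f x * g x) has_derivative (\<lambda>y. \<Sum>i\<in>Basis. (y \<bullet> i) * (f x * g' i x + 1 * (f' i x * g x)))) (at x within S)"
      if "x \<in> S" for x
      by (rule derivative_eq_intros f'(1)[OF that] g'(1)[OF that] refl)+
        (simp add: fun_eq_iff algebra_simps sum.distrib sum_distrib_left)
    show "Ck_on k S (\<lambda>x. f x * g' i x + 1 * (f' i x * g x))" if "i \<in> Basis" for i
      by (intro Ck_on_lincomb Suc.IH f'(2) g'(2) that Ck_on_SucD[OF Suc.prems(1)] Ck_on_SucD[OF Suc.prems(2)])
  qed
qed

lemma Ck_on_fst:
  fixes f :: "'a::euclidean_space \<Rightarrow> real"
  assumes "Ck_on k S f"
  shows "Ck_on k (S \<times> (U :: 'b::euclidean_space set)) (\<lambda>z. f (fst z))"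
  using assms
proof (induction k arbitrary: f)
  case 0
  then show ?case by (auto intro!: continuous_on_compose2[of S f _ fst] continuous_intros)
next
  case (Suc k)
  obtain f' where f': "\<And>x. x \<in> S \<Longrightarrow> (f has_derivative (\<lambda>y. \<Sum>i\<in>Basis. (y \<bullet> i) * f' i x)) (at x within S)"
    "\<And>i. i \<in> Basis \<Longrightarrow> Ck_on k S (f' i)" using Suc.prems(1) by (elim Ck_on_SucE) auto
  show ?case
  proof (rule Ck_on_SucI)
    fix z assume z: "z \<in> S \<times> U"
    have "((\<lambda>z. f (fst z)) has_derivative (\<lambda>y. \<Sum>i\<in>Basis. (fst y \<bullet> i) * f' i (fst z))) (at z within S \<times> U)"
    proof (rule has_derivative_in_compose2[where g = f and t = S])
      show "(fst has_derivative fst) (at z within S \<times> U)" by (intro derivative_intros)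
    qed (use z f' in auto)
    moreover have "(\<lambda>y::'a \<times> 'b. \<Sum>i\<in>Basis. (fst y \<bullet> i) * f' i (fst z))
        = (\<lambda>y. \<Sum>i\<in>Basis. (y \<bullet> i) * (if snd i = 0 then f' (fst i) (fst z) else 0))"
      by (rule ext, simp add: Basis_prod_def sum.union_disjoint inner_prod_def sum.reindex inj_on_def
          disjoint_iff image_iff)
        (intro sum.neutral ballI, auto)
    ultimately show "((\<lambda>z. f (fst z)) has_derivative
        (\<lambda>y. \<Sum>i\<in>Basis. (y \<bullet> i) * (if snd i = 0 then f' (fst i) (fst z) else 0))) (at z within S \<times> U)"
      by (simp only:)
  next
    fix i :: "'a \<times> 'b" assume "i \<in> Basis"
    then show "Ck_on k (S \<times> U) (\<lambda>z. if snd i = 0 then f' (fst i) (fst z) else 0)"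
    proof (cases "snd i = 0")
      case True
      with \<open>i \<in> Basis\<close> have "fst i \<in> Basis" by (auto simp: Basis_prod_def)
      with True show ?thesis by (auto intro!: Suc.IH f'(2))
    qed (simp add: Ck_on_zero)
  qed
qed


text \<open>
  The parameters of the points of \<open>A\<close> on the line through \<open>z\<close> in the direction \<open>b\<close>. Derivatives are
  taken relative to this set, hence they are one-sided where the line meets the boundary.
\<close>

definition slice :: "'a::euclidean_space set \<Rightarrow> 'a \<Rightarrow> 'a \<Rightarrow> real set" where
  "slice A b z = {s. z + s *\<^sub>R b \<in> A}"

definition line_deriv :: "'a::euclidean_space set \<Rightarrow> 'a \<Rightarrow> ('a \<Rightarrow> real) \<Rightarrow> ('a \<Rightarrow> real) \<Rightarrow> bool" where
  "line_deriv A b F F' \<longleftrightarrow>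
     (\<forall>z\<in>A. ((\<lambda>s. F (z + s *\<^sub>R b)) has_real_derivative F' z) (at 0 within slice A b z))"

definition pd :: "'a::euclidean_space set \<Rightarrow> 'a \<Rightarrow> ('a \<Rightarrow> real) \<Rightarrow> 'a \<Rightarrow> real" where
  "pd A b F z = vector_derivative (\<lambda>s. F (z + s *\<^sub>R b)) (at 0 within slice A b z)"

lemma line_deriv_at:
  assumes "line_deriv A b F F'" "z + s *\<^sub>R b \<in> A"
  shows "((\<lambda>\<sigma>. F (z + \<sigma> *\<^sub>R b)) has_real_derivative F' (z + s *\<^sub>R b)) (at s within slice A b z)"
proof -
  have *: "((\<lambda>\<sigma>. F ((z + s *\<^sub>R b) + \<sigma> *\<^sub>R b)) has_real_derivative F' (z + s *\<^sub>R b)) (at 0 within slice A b (z + s *\<^sub>R b))"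
    using assms by (simp add: line_deriv_def)
  have im: "(\<lambda>\<sigma>. \<sigma> - s) ` slice A b z = slice A b (z + s *\<^sub>R b)"
  proof (rule set_eqI, rule iffI)
    fix \<sigma> assume "\<sigma> \<in> slice A b (z + s *\<^sub>R b)"
    then show "\<sigma> \<in> (\<lambda>\<sigma>. \<sigma> - s) ` slice A b z"
      by (intro image_eqI[of _ _ "\<sigma> + s"]) (simp_all add: slice_def algebra_simps)
  qed (auto simp: slice_def algebra_simps)
  have "((\<lambda>\<sigma>. \<sigma> - s) has_real_derivative 1) (at s within slice A b z)"
    by (auto intro!: derivative_eq_intros)
  then have "((\<lambda>\<sigma>. F ((z + s *\<^sub>R b) + \<sigma> *\<^sub>R b)) \<circ> (\<lambda>\<sigma>. \<sigma> - s) has_real_derivative F' (z + s *\<^sub>R b) * 1) (at s within slice A b z)"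
    by (intro DERIV_image_chain[where g = "\<lambda>\<sigma>. \<sigma> - s"]) (use * in \<open>auto simp: im intro!: derivative_eq_intros\<close>)
  then show ?thesis by (simp add: o_def algebra_simps)
qed

text \<open>
  Taylor's formula along one line. It is stated for an arbitrary sequence \<open>G\<close> of successive
  derivatives, so that it also applies to functions that are themselves difference quotients, on
  the smaller sets where these are defined.
\<close>

lemma line_taylor:
  assumes conv: "convex A"
    and ld: "\<And>i. i \<le> n \<Longrightarrow> line_deriv A b (G i) (G (Suc i))"
    and bd: "\<And>z. z \<in> A \<Longrightarrow> \<bar>G (Suc n) z\<bar> \<le> B"
    and z: "z \<in> A" "z + s *\<^sub>R b \<in> A"
  shows "\<bar>G 0 (z + s *\<^sub>R b) - (\<Sum>i\<le>n. G i z * s ^ i / fact i)\<bar> \<le> B * \<bar>s\<bar> ^ Suc n"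
proof -
  have "convex (slice A b z)"
  proof -
    have "slice A b z = (\<lambda>s. z + s *\<^sub>R b) -` A" by (auto simp: slice_def)
    moreover have "(\<lambda>s. z + s *\<^sub>R b) -` A = (\<lambda>s. s *\<^sub>R b) -` ((\<lambda>x. - z + x) ` A)"
      by (auto simp: image_iff algebra_simps)
    ultimately show ?thesis
      by (simp add: conv convex_linear_vimage linear_scaleR_left)
  qed
  from field_Taylor[OF this, of n "\<lambda>i s. G i (z + s *\<^sub>R b)" B 0 s]
  have "\<bar>G 0 (z + s *\<^sub>R b) - (\<Sum>i\<le>n. G i z * s ^ i / fact i)\<bar> \<le> B * \<bar>s\<bar> ^ Suc n / fact n"
    using z bd ld line_deriv_at[of A b] by (simp add: slice_def)
  also have "\<dots> \<le> B * \<bar>s\<bar> ^ Suc n / 1"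
    using bd[OF z(1)] by (intro divide_left_mono) (auto intro!: mult_nonneg_nonneg)
  finally show ?thesis by simp
qed

locale origin_box =
  fixes Q :: "'a::euclidean_space set" and q :: 'a
  assumes Q: "Q = cbox 0 q" and q_pos: "\<And>b. b \<in> Basis \<Longrightarrow> 0 < q \<bullet> b"
begin

lemma mem_Q: "z \<in> Q \<longleftrightarrow> (\<forall>b\<in>Basis. 0 \<le> z \<bullet> b \<and> z \<bullet> b \<le> q \<bullet> b)"
  by (simp add: Q mem_box)

lemma slice_Q:
  assumes "z \<in> Q" "b \<in> Basis"
  shows "slice Q b z = {- (z \<bullet> b) .. q \<bullet> b - z \<bullet> b}"
proof -
  have "(z + s *\<^sub>R b) \<bullet> c = z \<bullet> c + (if c = b then s else 0)" if "c \<in> Basis" for s c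
    using that assms(2) by (simp add: inner_add_left inner_Basis)
  then show ?thesis using assms by (auto simp: slice_def mem_Q)
qed

lemma zero_in_slice: "z \<in> Q \<Longrightarrow> 0 \<in> slice Q b z"
  by (simp add: slice_def)

lemma pd_unique:
  assumes "line_deriv Q b F F'" "b \<in> Basis" "z \<in> Q"
  shows "pd Q b F z = F' z"
proof -
  have "((\<lambda>s. F (z + s *\<^sub>R b)) has_real_derivative F' z) (at 0 within slice Q b z)"
    using assms by (simp add: line_deriv_def)
  moreover have "0 \<in> slice Q b z" using assms by (simp add: zero_in_slice)
  ultimately show ?thesis
    unfolding pd_def has_real_derivative_iff_has_vector_derivative slice_Q[OF assms(3,2)]
    using q_pos[OF assms(2)] by (intro vector_derivative_within_closed_interval) auto
qed

lemma Ck_on_line_deriv: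
  assumes "Ck_on (Suc k) Q F" "b \<in> Basis"
  shows "line_deriv Q b F (pd Q b F)" "Ck_on k Q (pd Q b F)"
proof -
  obtain F' where F': "\<And>x. x \<in> Q \<Longrightarrow> (F has_derivative (\<lambda>y. \<Sum>i\<in>Basis. (y \<bullet> i) * F' i x)) (at x within Q)"
    "\<And>i. i \<in> Basis \<Longrightarrow> Ck_on k Q (F' i)" using assms(1) by (elim Ck_on_SucE) auto
  have ld: "line_deriv Q b F (F' b)"
    unfolding line_deriv_def
  proof
    fix z assume z: "z \<in> Q"
    have "((\<lambda>s. F (z + s *\<^sub>R b)) has_derivative (\<lambda>s. \<Sum>i\<in>Basis. ((s *\<^sub>R b) \<bullet> i) * F' i (z + 0 *\<^sub>R b))) (at 0 within slice Q b z)"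
    proof (rule has_derivative_in_compose2[where g = F and t = Q])
      show "((\<lambda>s. z + s *\<^sub>R b) has_derivative (\<lambda>s. s *\<^sub>R b)) (at 0 within slice Q b z)"
        by (auto intro!: derivative_eq_intros)
    qed (use z F' in \<open>auto simp: slice_def\<close>)
    moreover have "(\<Sum>i\<in>Basis. ((s *\<^sub>R b) \<bullet> i) * F' i (z + 0 *\<^sub>R b)) = F' b z * s" for s
    proof -
      have "(\<Sum>i\<in>Basis. ((s *\<^sub>R b) \<bullet> i) * F' i (z + 0 *\<^sub>R b)) = (\<Sum>i\<in>Basis. if i = b then s * F' i z else 0)"
        by (rule sum.cong) (use assms(2) in \<open>auto simp: inner_Basis\<close>)
      then show ?thesis using assms(2) by (simp add: sum.delta)
    qed
    ultimately show "((\<lambda>s. F (z + s *\<^sub>R b)) has_real_derivative F' b z) (at 0 within slice Q b z)"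
      by (simp add: has_field_derivative_def)
  qed
  have eq: "pd Q b F z = F' b z" if "z \<in> Q" for z
    by (rule pd_unique[OF ld assms(2) that])
  show "Ck_on k Q (pd Q b F)"
    by (rule Ck_on_cong[OF F'(2)[OF assms(2)]]) (simp add: eq)
  show "line_deriv Q b F (pd Q b F)"
    using ld eq by (simp add: line_deriv_def)
qed

lemma Ck_on_pd_iterate:
  assumes "Ck_on (n + k) Q F" "b \<in> Basis"
  shows "Ck_on k Q ((pd Q b ^^ n) F)"
  using assms by (induction n arbitrary: k) (auto  intro!: Ck_on_line_deriv(2))

lemma pd_iterate_line_deriv:
  assumes "Ck_on (Suc n) Q F" "b \<in> Basis"
  shows "line_deriv Q b ((pd Q b ^^ n) F) ((pd Q b ^^ Suc n) F)"
  using Ck_on_line_deriv(1)[OF Ck_on_pd_iterate[of n 1 F b, simplified]] assms by simp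

end

section \<open>Difference quotients and families of a given order\<close>

text \<open>
  All mesh steps, including the one in time, are collected in one vector \<open>\<eta>\<close> whose component
  \<open>\<eta> \<bullet> b\<close> is the step in the direction \<open>b\<close>. Its norm is the mesh size \<open>|\<^bold>h|\<close>, and time is a direction
  like any other.
\<close>

definition cLam :: "'a::euclidean_space \<Rightarrow> 'a \<Rightarrow> ('a \<Rightarrow> real) \<Rightarrow> 'a \<Rightarrow> real" where
  "cLam \<eta> b F z = (F (z + (\<eta> \<bullet> b) *\<^sub>R b) - 2 * F z + F (z - (\<eta> \<bullet> b) *\<^sub>R b)) / (\<eta> \<bullet> b)\<^sup>2"

definition cLams :: "'a::euclidean_space \<Rightarrow> 'a list \<Rightarrow> ('a \<Rightarrow> real) \<Rightarrow> 'a \<Rightarrow> real" where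
  "cLams \<eta> ls F = foldr (cLam \<eta>) ls F"

lemma cLams_simps [simp]:
  "cLams \<eta> [] F = F" "cLams \<eta> (c # ls) F = cLam \<eta> c (cLams \<eta> ls F)"
  by (simp_all add: cLams_def)

definition fD :: "'a::euclidean_space \<Rightarrow> 'a \<Rightarrow> ('a \<Rightarrow> real) \<Rightarrow> 'a \<Rightarrow> real" where
  "fD \<eta> b F z = (F (z + (\<eta> \<bullet> b) *\<^sub>R b) - F z) / (\<eta> \<bullet> b)"

lemma cLam_commute: "cLam \<eta> b (cLam \<eta> c F) = cLam \<eta> c (cLam \<eta> b F)"
  by (rule ext) (simp add: cLam_def algebra_simps diff_divide_distrib add_divide_distrib)

lemma cLam_fD: "cLam \<eta> c (fD \<eta> b F) = fD \<eta> b (cLam \<eta> c F)"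
  by (rule ext) (simp add: cLam_def fD_def algebra_simps diff_divide_distrib add_divide_distrib)

lemma cLams_fD: "cLams \<eta> ls (fD \<eta> b F) = fD \<eta> b (cLams \<eta> ls F)"
  by (induction ls) (simp_all add: cLam_fD)

lemma cLams_cLam: "cLams \<eta> ls (cLam \<eta> b F) = cLam \<eta> b (cLams \<eta> ls F)"
  by (induction ls) (simp_all add: cLam_commute[of \<eta> b])

definition pos :: "'a::euclidean_space \<Rightarrow> bool" where
  "pos \<eta> \<longleftrightarrow> (\<forall>b\<in>Basis. 0 < \<eta> \<bullet> b)"

lemma posD: "pos \<eta> \<Longrightarrow> b \<in> Basis \<Longrightarrow> 0 < \<eta> \<bullet> b"
  by (simp add: pos_def)

lemma second_diff_bound:
  assumes "convex A" and ld: "\<And>i. i \<le> 1 \<Longrightarrow> line_deriv A b (G i) (G (Suc i))"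
    and "\<And>z. z \<in> A \<Longrightarrow> \<bar>G 2 z\<bar> \<le> C"
    and "z \<in> A" "z + (\<eta> \<bullet> b) *\<^sub>R b \<in> A" "z - (\<eta> \<bullet> b) *\<^sub>R b \<in> A" and t: "0 < \<eta> \<bullet> b"
  shows "\<bar>cLam \<eta> b (G 0) z\<bar> \<le> 2 * C"
proof -
  let ?t = "\<eta> \<bullet> b"
  have T: "\<bar>G 0 (z + s *\<^sub>R b) - (G 0 z + G 1 z * s)\<bar> \<le> C * \<bar>s\<bar>\<^sup>2" if "z + s *\<^sub>R b \<in> A" for s
    using line_taylor[OF assms(1), of 1 b G C z s] assms that by (simp add: numeral_2_eq_2)
  have "\<bar>cLam \<eta> b (G 0) z * ?t\<^sup>2\<bar> \<le> 2 * C * ?t\<^sup>2"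
    using T[of ?t] T[of "- ?t"] assms t by (simp add: cLam_def abs_le_iff)
  then show ?thesis using t by (simp add: abs_mult)
qed

lemma second_diff_expand:
  assumes "convex A" and ld: "\<And>i. i \<le> 3 \<Longrightarrow> line_deriv A b (G i) (G (Suc i))"
    and "\<And>z. z \<in> A \<Longrightarrow> \<bar>G 4 z\<bar> \<le> C"
    and "z \<in> A" "z + (\<eta> \<bullet> b) *\<^sub>R b \<in> A" "z - (\<eta> \<bullet> b) *\<^sub>R b \<in> A" and t: "0 < \<eta> \<bullet> b"
  shows "\<bar>cLam \<eta> b (G 0) z - G 2 z\<bar> \<le> 2 * C * (\<eta> \<bullet> b)\<^sup>2"
proof -
  let ?t = "\<eta> \<bullet> b"
  have T: "\<bar>G 0 (z + s *\<^sub>R b) - (G 0 z + G 1 z * s + G 2 z * s ^ 2 / 2 + G 3 z * s ^ 3 / 6)\<bar> \<le> C * \<bar>s\<bar> ^ 4"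
    if "z + s *\<^sub>R b \<in> A" for s
    using line_taylor[OF assms(1), of 3 b G C z s] assms that by (simp add: eval_nat_numeral)
  have "\<bar>(cLam \<eta> b (G 0) z - G 2 z) * ?t\<^sup>2\<bar> \<le> 2 * C * ?t\<^sup>2 * ?t\<^sup>2"
    using T[of ?t] T[of "- ?t"] assms t
    by (simp add: cLam_def abs_le_iff left_diff_distrib) (simp add: eval_nat_numeral)
  then show ?thesis using t by (simp add: abs_mult)
qed

text \<open>
  The error of the second difference starts with \<open>\<tau>\<^sup>2/12\<close> times the fourth derivative, and that
  derivative is again a second difference (of the second derivative) up to \<open>O(\<tau>\<^sup>2)\<close>.
\<close>

lemma second_diff_compact:
  assumes "convex A" and ld: "\<And>i. i \<le> 5 \<Longrightarrow> line_deriv A b (G i) (G (Suc i))"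
    and bd: "\<And>z. z \<in> A \<Longrightarrow> \<bar>G 6 z\<bar> \<le> C"
    and z: "z \<in> A" "z + (\<eta> \<bullet> b) *\<^sub>R b \<in> A" "z - (\<eta> \<bullet> b) *\<^sub>R b \<in> A" and t: "0 < \<eta> \<bullet> b"
  shows "\<bar>cLam \<eta> b (G 0) z - G 2 z - (\<eta> \<bullet> b)\<^sup>2 / 12 * cLam \<eta> b (G 2) z\<bar> \<le> 3 * C * (\<eta> \<bullet> b) ^ 4"
proof -
  let ?t = "\<eta> \<bullet> b"
  have T: "\<bar>G 0 (z + s *\<^sub>R b) - (G 0 z + G 1 z * s + G 2 z * s ^ 2 / 2 + G 3 z * s ^ 3 / 6
      + G 4 z * s ^ 4 / 24 + G 5 z * s ^ 5 / 120)\<bar> \<le> C * \<bar>s\<bar> ^ 6"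
    if "z + s *\<^sub>R b \<in> A" for s
    using line_taylor[OF assms(1), of 5 b G C z s] assms that by (simp add: eval_nat_numeral)
  have "\<bar>(cLam \<eta> b (G 0) z - G 2 z - ?t\<^sup>2 / 12 * G 4 z) * ?t\<^sup>2\<bar> \<le> 2 * C * ?t ^ 4 * ?t\<^sup>2"
    using T[of ?t] T[of "- ?t"] assms t
    by (simp add: cLam_def abs_le_iff left_diff_distrib) (simp add: eval_nat_numeral field_simps)
  then have 1: "\<bar>cLam \<eta> b (G 0) z - G 2 z - ?t\<^sup>2 / 12 * G 4 z\<bar> \<le> 2 * C * ?t ^ 4"
    using t by (simp add: abs_mult)
  have "\<bar>cLam \<eta> b (G 2) z - G 4 z\<bar> \<le> 2 * C * ?t\<^sup>2"
    using second_diff_expand[of A b "\<lambda>i. G (2 + i)" C z \<eta>] assms by (simp add: numeral_eq_Suc)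
  then have "\<bar>?t\<^sup>2 / 12 * (cLam \<eta> b (G 2) z - G 4 z)\<bar> \<le> ?t\<^sup>2 / 12 * (2 * C * ?t\<^sup>2)"
    unfolding abs_mult by (intro mult_mono) auto
  also have "\<dots> = (C * ?t ^ 4) / 6"
    by (simp add: power2_eq_square power4_eq_xxxx)
  also have "\<dots> \<le> C * ?t ^ 4"
    using order_trans[OF abs_ge_zero bd[OF z(1)]] by simp
  finally show ?thesis using 1 by (simp add: abs_le_iff algebra_simps)
qed

lemma forward_diff_expand:
  assumes "convex A" and ld: "\<And>i. i \<le> n \<Longrightarrow> line_deriv A b (G i) (G (Suc i))"
    and "\<And>z. z \<in> A \<Longrightarrow> \<bar>G (Suc n) z\<bar> \<le> C"
    and "z \<in> A" "z + (\<eta> \<bullet> b) *\<^sub>R b \<in> A" and t: "0 < \<eta> \<bullet> b"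
  shows "\<bar>fD \<eta> b (G 0) z - (\<Sum>i<n. G (Suc i) z * (\<eta> \<bullet> b) ^ i / fact (Suc i))\<bar> \<le> C * (\<eta> \<bullet> b) ^ n"
proof -
  let ?t = "\<eta> \<bullet> b"
  let ?S = "\<Sum>i<n. G (Suc i) z * ?t ^ i / fact (Suc i)"
  have T: "\<bar>G 0 (z + ?t *\<^sub>R b) - (\<Sum>i\<le>n. G i z * ?t ^ i / fact i)\<bar> \<le> C * ?t ^ Suc n"
    using line_taylor[OF assms(1), of n b G C z ?t] assms by simp
  have "(\<Sum>i\<le>n. G i z * ?t ^ i / fact i) = G 0 z + (\<Sum>i<n. G (Suc i) z * ?t ^ i / fact (Suc i)) * ?t"
    unfolding sum_distrib_right lessThan_Suc_atMost[symmetric] sum.lessThan_Suc_shift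
    by (simp add: mult_ac)
  with T have "\<bar>G 0 (z + ?t *\<^sub>R b) - (G 0 z + ?S * ?t)\<bar> \<le> C * ?t ^ Suc n"
    by (simp only:)
  moreover have "fD \<eta> b (G 0) z * ?t = G 0 (z + ?t *\<^sub>R b) - G 0 z"
    using t by (simp add: fD_def)
  then have "(fD \<eta> b (G 0) z - ?S) * ?t = G 0 (z + ?t *\<^sub>R b) - (G 0 z + ?S * ?t)"
    unfolding left_diff_distrib by linarith
  ultimately have "\<bar>(fD \<eta> b (G 0) z - ?S) * ?t\<bar> \<le> (C * ?t ^ n) * ?t"
    by (simp only: power_Suc mult_ac)
  then show ?thesis using t by (simp add: abs_mult)
qed


context origin_box
begin

text \<open>
  The points of the box from which one step in each direction of \<open>B\<close>, forward or backward, stays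
  in the box. A difference quotient in the directions \<open>B\<close> refers to points of the box only when it
  is taken on this set.
\<close>

definition D :: "'a \<Rightarrow> 'a set \<Rightarrow> 'a set" where
  "D \<eta> B = {z \<in> Q. \<forall>b\<in>B. z + (\<eta> \<bullet> b) *\<^sub>R b \<in> Q \<and> z - (\<eta> \<bullet> b) *\<^sub>R b \<in> Q}"

lemma D_empty [simp]: "D \<eta> {} = Q"
  by (simp add: D_def)

lemma mem_D:
  assumes "B \<subseteq> Basis" "pos \<eta>"
  shows "z \<in> D \<eta> B \<longleftrightarrow> z \<in> Q \<and> (\<forall>b\<in>B. \<eta> \<bullet> b \<le> z \<bullet> b \<and> z \<bullet> b \<le> q \<bullet> b - \<eta> \<bullet> b)"
proof -
  have eq: "z + s *\<^sub>R b \<in> Q \<and> z - s *\<^sub>R b \<in> Q \<longleftrightarrow> s \<le> z \<bullet> b \<and> z \<bullet> b \<le> q \<bullet> b - s"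
    if "z \<in> Q" "b \<in> B" "0 < s" for b s
  proof -
    have b: "b \<in> Basis" using that assms by auto
    have "s \<in> slice Q b z \<and> - s \<in> slice Q b z \<longleftrightarrow> s \<le> z \<bullet> b \<and> z \<bullet> b \<le> q \<bullet> b - s"
      unfolding slice_Q[OF that(1) b] using that q_pos[OF b] mem_Q[of z] b by auto
    then show ?thesis by (simp add: slice_def)
  qed
  then show ?thesis
    unfolding D_def mem_Collect_eq
    by (intro conj_cong refl ball_cong eq) (use assms in \<open>auto simp: pos_def\<close>)
qed

lemma convex_D:
  assumes "B \<subseteq> Basis" "pos \<eta>"
  shows "convex (D \<eta> B)"
proof -
  have "D \<eta> B = Q \<inter> (\<Inter>b\<in>B. {z. b \<bullet> z \<ge> \<eta> \<bullet> b} \<inter> {z. b \<bullet> z \<le> q \<bullet> b - \<eta> \<bullet> b})"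
    using mem_D[OF assms] by (auto simp: inner_commute)
  moreover have "convex \<dots>"
    unfolding Q by (intro convex_Int convex_INT convex_box convex_halfspace_ge convex_halfspace_le)
  ultimately show ?thesis by simp
qed

lemma D_shift:
  assumes "c \<in> Basis" "c \<notin> B" "B \<subseteq> Basis" "pos \<eta>" "z \<in> D \<eta> B" "z + s *\<^sub>R c \<in> Q"
  shows "z + s *\<^sub>R c \<in> D \<eta> B"
proof -
  have "(z + s *\<^sub>R c) \<bullet> b = z \<bullet> b" if "b \<in> B" for b
  proof -
    have "b \<in> Basis" "c \<noteq> b" using that assms by auto
    then show ?thesis using assms(1) by (simp add: inner_add_left inner_not_same_Basis)
  qed
  then show ?thesis using assms by (simp add: mem_D)
qed

lemma D_insert:
  assumes "c \<in> Basis" "c \<notin> B" "B \<subseteq> Basis" "pos \<eta>" "z \<in> D \<eta> (insert c B)"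
  shows "z \<in> D \<eta> B" "z + (\<eta> \<bullet> c) *\<^sub>R c \<in> D \<eta> B" "z - (\<eta> \<bullet> c) *\<^sub>R c \<in> D \<eta> B"
proof -
  show z: "z \<in> D \<eta> B" using assms(5) by (simp add: D_def)
  show "z + (\<eta> \<bullet> c) *\<^sub>R c \<in> D \<eta> B"
    by (rule D_shift[OF assms(1-4) z]) (use assms(5) in \<open>simp add: D_def\<close>)
  have "z + (- (\<eta> \<bullet> c)) *\<^sub>R c \<in> D \<eta> B"
    by (rule D_shift[OF assms(1-4) z]) (use assms(5) in \<open>simp add: D_def\<close>)
  then show "z - (\<eta> \<bullet> c) *\<^sub>R c \<in> D \<eta> B" by simp
qed

text \<open>
  Differences are finite combinations of shifts, and shifts commute with differentiation.
\<close>

lemma line_deriv_cLam: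
  assumes ld: "line_deriv (D \<eta> B) b F F'" and c: "c \<in> Basis" "c \<notin> B" "B \<subseteq> Basis" "pos \<eta>"
  shows "line_deriv (D \<eta> (insert c B)) b (cLam \<eta> c F) (cLam \<eta> c F')"
  unfolding line_deriv_def
proof
  fix z assume z: "z \<in> D \<eta> (insert c B)"
  let ?A = "slice (D \<eta> (insert c B)) b z"
  have sub: "((\<lambda>s. F ((z + v) + s *\<^sub>R b)) has_real_derivative F' (z + v)) (at 0 within ?A)"
    if "\<And>y. y \<in> D \<eta> (insert c B) \<Longrightarrow> y + v \<in> D \<eta> B" for v
  proof (rule DERIV_subset)
    show "((\<lambda>s. F ((z + v) + s *\<^sub>R b)) has_real_derivative F' (z + v)) (at 0 within slice (D \<eta> B) b (z + v))"
      using ld that[OF z] by (simp add: line_deriv_def)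
    have "z + v + s *\<^sub>R b = (z + s *\<^sub>R b) + v" for s by simp
    then show "?A \<subseteq> slice (D \<eta> B) b (z + v)"
      unfolding slice_def using that by (simp only: subset_iff mem_Collect_eq) blast
  qed
  let ?v = "(\<eta> \<bullet> c) *\<^sub>R c"
  note D_insert[OF c]
  then have "((\<lambda>s. (F ((z + ?v) + s *\<^sub>R b) - 2 * F ((z + 0) + s *\<^sub>R b) + F ((z + (- ?v)) + s *\<^sub>R b)) / (\<eta> \<bullet> c)\<^sup>2)
    has_real_derivative (F' (z + ?v) - 2 * F' (z + 0) + F' (z + (- ?v))) / (\<eta> \<bullet> c)\<^sup>2) (at 0 within ?A)"
    by (intro DERIV_cdivide DERIV_add DERIV_diff DERIV_cmult sub) simp_all
  moreover have "z + s *\<^sub>R b - ?v = z - ?v + s *\<^sub>R b" "z + s *\<^sub>R b + ?v = z + ?v + s *\<^sub>R b" for s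
    by simp_all
  ultimately show "((\<lambda>s. cLam \<eta> c F (z + s *\<^sub>R b)) has_real_derivative cLam \<eta> c F' z) (at 0 within ?A)"
    unfolding cLam_def by (simp only: add_0_right add_uminus_conv_diff)
qed

lemma line_deriv_cLams:
  assumes "line_deriv Q b F F'" "distinct ls" "set ls \<subseteq> Basis" "pos \<eta>"
  shows "line_deriv (D \<eta> (set ls)) b (cLams \<eta> ls F) (cLams \<eta> ls F')"
  using assms by (induction ls) (auto intro!: line_deriv_cLam)

lemma seq_line_deriv:
  assumes "Ck_on (Suc i) Q F" "b \<in> Basis" "distinct ls" "set ls \<subseteq> Basis" "pos \<eta>"
  shows "line_deriv (D \<eta> (set ls)) b (cLams \<eta> ls ((pd Q b ^^ i) F)) (cLams \<eta> ls ((pd Q b ^^ Suc i) F))"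
  by (rule line_deriv_cLams[OF pd_iterate_line_deriv[OF assms(1,2)] assms(3-5)])

lemma Ck_on_bounded:
  assumes "Ck_on k Q F"
  shows "\<exists>C. \<forall>z\<in>Q. \<bar>F z\<bar> \<le> C"
proof -
  have "compact (F ` Q)"
    using Ck_on_imp_continuous_on[OF assms] by (intro compact_continuous_image) (simp_all add: Q)
  from compact_imp_bounded[OF this] show ?thesis by (auto simp: bounded_iff)
qed

text \<open>
  A second difference in the direction \<open>c\<close> is controlled by the second derivative in that direction,
  which commutes with the remaining differences; so the differences are exchanged for derivatives
  one after the other, at the price of two derivatives each.
\<close>

lemma cLams_bounded:
  assumes "distinct ls" "set ls \<subseteq> Basis" "Ck_on (2 * length ls) Q F"
  shows "\<exists>C. \<forall>\<eta> z. pos \<eta> \<longrightarrow> z \<in> D \<eta> (set ls) \<longrightarrow> \<bar>cLams \<eta> ls F z\<bar> \<le> C"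
  using assms
proof (induction ls arbitrary: F)
  case Nil
  then obtain C where "\<forall>z\<in>Q. \<bar>F z\<bar> \<le> C" using Ck_on_bounded[of 0 F] by auto
  then show ?case by auto
next
  case (Cons c ls)
  have ck: "Ck_on (2 + 2 * length ls) Q F" using Cons.prems(3) by simp
  have c: "c \<in> Basis" using Cons.prems by simp
  from Ck_on_pd_iterate[OF ck c] have "Ck_on (2 * length ls) Q ((pd Q c ^^ 2) F)" .
  from Cons.IH[OF _ _ this] Cons.prems obtain C
    where C: "\<And>\<eta> z. pos \<eta> \<Longrightarrow> z \<in> D \<eta> (set ls) \<Longrightarrow> \<bar>cLams \<eta> ls ((pd Q c ^^ 2) F) z\<bar> \<le> C"
    by auto
  have "\<bar>cLams \<eta> (c # ls) F z\<bar> \<le> 2 * C" if "pos \<eta>" "z \<in> D \<eta> (set (c # ls))" for \<eta> z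
  proof -
    have ls: "distinct ls" "set ls \<subseteq> Basis" "c \<notin> set ls" using Cons.prems by auto
    have "\<bar>cLam \<eta> c (cLams \<eta> ls ((pd Q c ^^ 0) F)) z\<bar> \<le> 2 * C"
    proof (rule second_diff_bound[of "D \<eta> (set ls)" c "\<lambda>i. cLams \<eta> ls ((pd Q c ^^ i) F)" C z \<eta>])
      show "line_deriv (D \<eta> (set ls)) c (cLams \<eta> ls ((pd Q c ^^ i) F)) (cLams \<eta> ls ((pd Q c ^^ Suc i) F))"
        if "i \<le> 1" for i
        by (rule seq_line_deriv[OF Ck_on_mono[OF ck]]) (use that c ls \<open>pos \<eta>\<close> in auto)
    qed (use that ls c C convex_D posD D_insert[of c "set ls" \<eta> z] in auto)
    then show ?thesis by simp
  qed
  then show ?case by blast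
qed

text \<open>
  The meaning of \<open>E = \<O>(|\<^bold>h|\<^sup>j)\<close>: one constant for all step vectors \<open>\<eta>\<close> and points \<open>z\<close> in the
  relation \<open>P\<close>.
\<close>

definition bnd :: "('a \<Rightarrow> 'a \<Rightarrow> bool) \<Rightarrow> nat \<Rightarrow> ('a \<Rightarrow> 'a \<Rightarrow> real) \<Rightarrow> bool" where
  "bnd P j E \<longleftrightarrow> (\<exists>C. \<forall>\<eta> z. P \<eta> z \<longrightarrow> \<bar>E \<eta> z\<bar> \<le> C * norm \<eta> ^ j)"

definition admissible :: "'a set \<Rightarrow> 'a \<Rightarrow> 'a \<Rightarrow> bool" where
  "admissible B \<eta> z \<longleftrightarrow> pos \<eta> \<and> \<eta> \<in> Q \<and> z \<in> D \<eta> B"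

lemma bndI: "(\<And>\<eta> z. P \<eta> z \<Longrightarrow> \<bar>E \<eta> z\<bar> \<le> C * norm \<eta> ^ j) \<Longrightarrow> bnd P j E"
  by (auto simp: bnd_def)

lemma bndE:
  assumes "bnd P j E"
  obtains C where "0 \<le> C" "\<And>\<eta> z. P \<eta> z \<Longrightarrow> \<bar>E \<eta> z\<bar> \<le> C * norm \<eta> ^ j"
proof -
  obtain C where "\<And>\<eta> z. P \<eta> z \<Longrightarrow> \<bar>E \<eta> z\<bar> \<le> C * norm \<eta> ^ j" using assms by (auto simp: bnd_def)
  then have "\<bar>E \<eta> z\<bar> \<le> max C 0 * norm \<eta> ^ j" if "P \<eta> z" for \<eta> z
    using that by (meson max.cobounded1 mult_right_mono norm_ge_zero order_trans zero_le_power)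
  then show ?thesis using that[of "max C 0"] by simp
qed

lemma bnd_cong: "bnd P j E \<Longrightarrow> (\<And>\<eta> z. P \<eta> z \<Longrightarrow> E' \<eta> z = E \<eta> z) \<Longrightarrow> bnd P j E'"
  by (auto simp: bnd_def)

lemma bnd_subdom: "bnd P j E \<Longrightarrow> (\<And>\<eta> z. P' \<eta> z \<Longrightarrow> P \<eta> z) \<Longrightarrow> bnd P' j E"
  unfolding bnd_def by metis

lemma bnd_add:
  assumes "bnd P j E" "bnd P j E'" shows "bnd P j (\<lambda>\<eta> z. E \<eta> z + E' \<eta> z)"
proof -
  obtain C where C: "\<And>\<eta> z. P \<eta> z \<Longrightarrow> \<bar>E \<eta> z\<bar> \<le> C * norm \<eta> ^ j" using assms(1) by (rule bndE) auto
  obtain C' where C': "\<And>\<eta> z. P \<eta> z \<Longrightarrow> \<bar>E' \<eta> z\<bar> \<le> C' * norm \<eta> ^ j" using assms(2) by (rule bndE) auto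
  show ?thesis
    by (rule bndI[of _ _ "C + C'"])
      (use C C' in \<open>auto simp: distrib_right intro: order_trans[OF abs_triangle_ineq add_mono]\<close>)
qed

lemma bnd_mult:
  assumes "bnd P i E" "bnd P j E'" shows "bnd P (i + j) (\<lambda>\<eta> z. E \<eta> z * E' \<eta> z)"
proof -
  obtain C where C: "\<And>\<eta> z. P \<eta> z \<Longrightarrow> \<bar>E \<eta> z\<bar> \<le> C * norm \<eta> ^ i" "0 \<le> C" using assms(1) by (rule bndE) auto
  obtain C' where C': "\<And>\<eta> z. P \<eta> z \<Longrightarrow> \<bar>E' \<eta> z\<bar> \<le> C' * norm \<eta> ^ j" using assms(2) by (rule bndE) auto
  have "\<bar>E \<eta> z * E' \<eta> z\<bar> \<le> (C * C') * norm \<eta> ^ (i + j)" if "P \<eta> z" for \<eta> z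
  proof -
    have "\<bar>E \<eta> z\<bar> * \<bar>E' \<eta> z\<bar> \<le> (C * norm \<eta> ^ i) * (C' * norm \<eta> ^ j)"
      using C C' that by (intro mult_mono) auto
    then show ?thesis by (simp add: abs_mult power_add mult_ac)
  qed
  then show ?thesis by (rule bndI)
qed

lemma bnd_const: "bnd P 0 (\<lambda>_ _. c)"
  by (rule bndI[of _ _ "\<bar>c\<bar>"]) simp

lemma bnd_zero: "bnd P j (\<lambda>_ _. 0)"
  by (rule bndI[of _ _ 0]) simp

lemma bnd_cmult: "bnd P j E \<Longrightarrow> bnd P j (\<lambda>\<eta> z. c * E \<eta> z)"
  using bnd_mult[OF bnd_const, of P j E c] by simp

lemma bnd_diff: "bnd P j E \<Longrightarrow> bnd P j E' \<Longrightarrow> bnd P j (\<lambda>\<eta> z. E \<eta> z - E' \<eta> z)"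
  using bnd_add[of P j E "\<lambda>\<eta> z. (-1) * E' \<eta> z"] bnd_cmult[of P j E' "-1"] by simp

lemma bnd_sum: "(\<And>i. i \<in> I \<Longrightarrow> bnd P j (E i)) \<Longrightarrow> bnd P j (\<lambda>\<eta> z. \<Sum>i\<in>I. E i \<eta> z)"
  by (induction I rule: infinite_finite_induct) (simp_all add: bnd_zero bnd_add)

lemma bnd_step_mult:
  assumes "bnd P j E" "b \<in> Basis"
  shows "bnd P (k + j) (\<lambda>\<eta> z. (\<eta> \<bullet> b) ^ k * E \<eta> z)"
proof (rule bnd_mult[OF _ assms(1)])
  show "bnd P k (\<lambda>\<eta> z. (\<eta> \<bullet> b) ^ k)"
    by (rule bndI[of _ _ 1]) (use Basis_le_norm[OF assms(2)] in \<open>simp add: power_abs power_mono\<close>)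
qed

lemma bnd_lower:
  assumes "bnd P i E" "j \<le> i" "\<And>\<eta> z. P \<eta> z \<Longrightarrow> \<eta> \<in> Q"
  shows "bnd P j E"
proof -
  obtain C where C: "\<And>\<eta> z. P \<eta> z \<Longrightarrow> \<bar>E \<eta> z\<bar> \<le> C * norm \<eta> ^ i" "0 \<le> C" using assms(1) by (rule bndE) auto
  obtain K where K: "\<And>\<eta>. \<eta> \<in> Q \<Longrightarrow> norm \<eta> \<le> K"
    using bounded_cbox[of 0 q] by (auto simp: Q bounded_iff)
  have "\<bar>E \<eta> z\<bar> \<le> (C * K ^ (i - j)) * norm \<eta> ^ j" if "P \<eta> z" for \<eta> z
  proof -
    have "norm \<eta> ^ i = norm \<eta> ^ (i - j) * norm \<eta> ^ j" using assms(2) by (simp flip: power_add)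
    also have "\<dots> \<le> K ^ (i - j) * norm \<eta> ^ j"
      using K[OF assms(3)[OF that]] by (intro mult_right_mono power_mono) auto
    finally have "C * norm \<eta> ^ i \<le> C * (K ^ (i - j) * norm \<eta> ^ j)" using C(2) by (rule mult_left_mono)
    with C(1)[OF that] show ?thesis by (simp add: mult_ac)
  qed
  then show ?thesis by (rule bndI)
qed

lemma bnd_cLams:
  assumes "distinct ls" "set ls \<subseteq> Basis" "Ck_on (2 * length ls) Q F"
  shows "bnd (admissible (set ls)) 0 (\<lambda>\<eta> z. cLams \<eta> ls F z)"
  using cLams_bounded[OF assms] by (auto simp: bnd_def admissible_def)

text \<open>
  The differences \<open>ls\<close> in other directions are applied before the second derivative is compared with
  its difference quotient, so no mixed derivatives are interchanged.
\<close>

lemma bnd_second_diff: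
  assumes "distinct (b # ls)" "set (b # ls) \<subseteq> Basis" "Ck_on (4 + 2 * length ls) Q F"
  shows "bnd (admissible (set (b # ls))) 2
    (\<lambda>\<eta> z. cLam \<eta> b (cLams \<eta> ls F) z - cLams \<eta> ls ((pd Q b ^^ 2) F) z)"
proof -
  have ls: "distinct ls" "set ls \<subseteq> Basis" "b \<notin> set ls" "b \<in> Basis" using assms by auto
  obtain C where C: "\<And>\<eta> z. pos \<eta> \<Longrightarrow> z \<in> D \<eta> (set ls) \<Longrightarrow> \<bar>cLams \<eta> ls ((pd Q b ^^ 4) F) z\<bar> \<le> C"
    using cLams_bounded[OF ls(1,2) Ck_on_pd_iterate[OF assms(3) ls(4)]] by auto
  have "\<bar>cLam \<eta> b (cLams \<eta> ls F) z - cLams \<eta> ls ((pd Q b ^^ 2) F) z\<bar> \<le> 2 * C * norm \<eta> ^ 2"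
    if "admissible (set (b # ls)) \<eta> z" for \<eta> z
  proof -
    have \<eta>: "pos \<eta>" "z \<in> D \<eta> (insert b (set ls))" using that by (auto simp: admissible_def)
    have z: "z \<in> D \<eta> (set ls)" by (rule D_insert[OF ls(4,3,2) \<eta>])
    have "\<bar>cLam \<eta> b (cLams \<eta> ls ((pd Q b ^^ 0) F)) z - cLams \<eta> ls ((pd Q b ^^ 2) F) z\<bar> \<le> 2 * C * (\<eta> \<bullet> b)\<^sup>2"
    proof (rule second_diff_expand[of "D \<eta> (set ls)" b "\<lambda>i. cLams \<eta> ls ((pd Q b ^^ i) F)" C z \<eta>])
      show "line_deriv (D \<eta> (set ls)) b (cLams \<eta> ls ((pd Q b ^^ i) F)) (cLams \<eta> ls ((pd Q b ^^ Suc i) F))"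
        if "i \<le> 3" for i
        by (rule seq_line_deriv[OF Ck_on_mono[OF assms(3)]]) (use that ls \<eta> in auto)
    qed (use \<eta> ls C convex_D posD D_insert[OF ls(4,3,2) \<eta>] in auto)
    also have "\<dots> \<le> 2 * C * norm \<eta> ^ 2"
      using C[OF \<eta>(1) z] Basis_le_norm[OF ls(4), of \<eta>] posD[OF \<eta>(1) ls(4)]
      by (intro mult_left_mono power_mono) auto
    finally show ?thesis by simp
  qed
  then show ?thesis by (rule bndI)
qed

lemma bnd_second_diff_compact:
  assumes b: "b \<in> Basis" and F: "Ck_on 6 Q F"
  shows "bnd (admissible {b}) 4
    (\<lambda>\<eta> z. cLam \<eta> b F z - (pd Q b ^^ 2) F z - (\<eta> \<bullet> b)\<^sup>2 / 12 * cLam \<eta> b ((pd Q b ^^ 2) F) z)"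
proof -
  obtain C where C: "\<And>z. z \<in> Q \<Longrightarrow> \<bar>(pd Q b ^^ 6) F z\<bar> \<le> C"
    using Ck_on_bounded[OF Ck_on_pd_iterate[of 6 0 F b]] F b by auto
  have "\<bar>cLam \<eta> b F z - (pd Q b ^^ 2) F z - (\<eta> \<bullet> b)\<^sup>2 / 12 * cLam \<eta> b ((pd Q b ^^ 2) F) z\<bar> \<le> 3 * C * norm \<eta> ^ 4"
    if "admissible {b} \<eta> z" for \<eta> z
  proof -
    have \<eta>: "pos \<eta>" "z \<in> D \<eta> {b}" using that by (auto simp: admissible_def)
    then have z: "z \<in> Q" by (simp add: D_def)
    have "\<bar>cLam \<eta> b ((pd Q b ^^ 0) F) z - (pd Q b ^^ 2) F z - (\<eta> \<bullet> b)\<^sup>2 / 12 * cLam \<eta> b ((pd Q b ^^ 2) F) z\<bar>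
        \<le> 3 * C * (\<eta> \<bullet> b) ^ 4"
    proof (rule second_diff_compact[of Q b "\<lambda>i. (pd Q b ^^ i) F" C z \<eta>])
      show "line_deriv Q b ((pd Q b ^^ i) F) ((pd Q b ^^ Suc i) F)" if "i \<le> 5" for i
        by (rule pd_iterate_line_deriv[OF Ck_on_mono[OF F] b]) (use that in auto)
    qed (use \<eta> C z b posD convex_D[of "{}" \<eta>] in \<open>auto simp: D_def\<close>)
    also have "\<dots> \<le> 3 * C * norm \<eta> ^ 4"
      using C[OF z] Basis_le_norm[OF b, of \<eta>] posD[OF \<eta>(1) b]
      by (intro mult_left_mono power_mono) auto
    finally show ?thesis by simp
  qed
  then show ?thesis by (rule bndI)
qed

lemma bnd_forward_diff:
  assumes "distinct (b # ls)" "set (b # ls) \<subseteq> Basis" "Ck_on (Suc n + 2 * length ls) Q F"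
  shows "bnd (\<lambda>\<eta> z. admissible (set ls) \<eta> z \<and> z + (\<eta> \<bullet> b) *\<^sub>R b \<in> Q) n
    (\<lambda>\<eta> z. fD \<eta> b (cLams \<eta> ls F) z
      - (\<Sum>i<n. cLams \<eta> ls ((pd Q b ^^ Suc i) F) z * (\<eta> \<bullet> b) ^ i / fact (Suc i)))"
proof -
  have ls: "distinct ls" "set ls \<subseteq> Basis" "b \<notin> set ls" "b \<in> Basis" using assms by auto
  obtain C where C: "\<And>\<eta> z. pos \<eta> \<Longrightarrow> z \<in> D \<eta> (set ls) \<Longrightarrow> \<bar>cLams \<eta> ls ((pd Q b ^^ Suc n) F) z\<bar> \<le> C"
    using cLams_bounded[OF ls(1,2) Ck_on_pd_iterate[OF assms(3) ls(4)]] by auto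
  have "\<bar>fD \<eta> b (cLams \<eta> ls F) z - (\<Sum>i<n. cLams \<eta> ls ((pd Q b ^^ Suc i) F) z * (\<eta> \<bullet> b) ^ i / fact (Suc i))\<bar>
      \<le> C * norm \<eta> ^ n"
    if "admissible (set ls) \<eta> z \<and> z + (\<eta> \<bullet> b) *\<^sub>R b \<in> Q" for \<eta> z
  proof -
    have \<eta>: "pos \<eta>" and z: "z \<in> D \<eta> (set ls)" using that by (auto simp: admissible_def)
    have z': "z + (\<eta> \<bullet> b) *\<^sub>R b \<in> D \<eta> (set ls)"
      by (rule D_shift[OF ls(4,3,2) \<eta> z]) (use that in simp)
    have "\<bar>fD \<eta> b (cLams \<eta> ls ((pd Q b ^^ 0) F)) z
        - (\<Sum>i<n. cLams \<eta> ls ((pd Q b ^^ Suc i) F) z * (\<eta> \<bullet> b) ^ i / fact (Suc i))\<bar> \<le> C * (\<eta> \<bullet> b) ^ n"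
    proof (rule forward_diff_expand[of "D \<eta> (set ls)" n b "\<lambda>i. cLams \<eta> ls ((pd Q b ^^ i) F)" C z \<eta>])
      show "line_deriv (D \<eta> (set ls)) b (cLams \<eta> ls ((pd Q b ^^ i) F)) (cLams \<eta> ls ((pd Q b ^^ Suc i) F))"
        if "i \<le> n" for i
        by (rule seq_line_deriv[OF Ck_on_mono[OF assms(3)]]) (use that ls \<eta> in auto)
    qed (use \<eta> ls C convex_D posD z z' in auto)
    also have "\<dots> \<le> C * norm \<eta> ^ n"
      using C[OF \<eta> z] Basis_le_norm[OF ls(4), of \<eta>] posD[OF \<eta> ls(4)]
      by (intro mult_left_mono power_mono) auto
    finally show ?thesis by simp
  qed
  then show ?thesis by (rule bndI)
qed

end

context origin_box
begin

text \<open>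
  The mean value theorem in the direction \<open>c\<close> and then in the direction \<open>b\<close>.
\<close>

lemma mixed_second_difference:
  assumes F: "Ck_on 2 Q F" and b: "b \<in> Basis" and c: "c \<in> Basis" and s: "0 < s"
    and mem: "\<And>\<sigma> \<sigma>'. 0 \<le> \<sigma> \<Longrightarrow> \<sigma> \<le> s \<Longrightarrow> 0 \<le> \<sigma>' \<Longrightarrow> \<sigma>' \<le> s \<Longrightarrow> w + \<sigma> *\<^sub>R b + \<sigma>' *\<^sub>R c \<in> Q"
  shows "\<exists>\<sigma>\<in>{0..s}. \<exists>\<sigma>'\<in>{0..s}.
    F (w + s *\<^sub>R b + s *\<^sub>R c) - F (w + s *\<^sub>R b) - F (w + s *\<^sub>R c) + F w
    = s * (s * pd Q b (pd Q c F) (w + \<sigma> *\<^sub>R b + \<sigma>' *\<^sub>R c))"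
proof -
  have F1: "Ck_on (Suc 1) Q F" using F by (simp add: numeral_2_eq_2)
  note c1 = Ck_on_line_deriv[OF F1 c]
  note b1 = Ck_on_line_deriv(1)[of 0 "pd Q c F", OF _ b] c1(2)
  have "\<exists>\<sigma>'\<in>{0<..<s}. (F (w + s *\<^sub>R b + s *\<^sub>R c) - F (w + s *\<^sub>R c)) - (F (w + s *\<^sub>R b + 0 *\<^sub>R c) - F (w + 0 *\<^sub>R c))
    = (\<lambda>d. (pd Q c F (w + s *\<^sub>R b + \<sigma>' *\<^sub>R c) - pd Q c F (w + \<sigma>' *\<^sub>R c)) * d) (s - 0)"
  proof (rule mvt_simple[OF s])
    fix x assume x: "0 \<le> x" "x \<le> s"
    have "((\<lambda>\<sigma>'. F (w + s *\<^sub>R b + \<sigma>' *\<^sub>R c)) has_real_derivative pd Q c F (w + s *\<^sub>R b + x *\<^sub>R c)) (at x within {0..s})"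
      by (rule DERIV_subset[OF line_deriv_at[OF c1(1)]]) (use mem[of s] s x in \<open>auto simp: slice_def\<close>)
    moreover have "((\<lambda>\<sigma>'. F (w + \<sigma>' *\<^sub>R c)) has_real_derivative pd Q c F (w + x *\<^sub>R c)) (at x within {0..s})"
      by (rule DERIV_subset[OF line_deriv_at[OF c1(1)]]) (use mem[of 0] s x in \<open>auto simp: slice_def\<close>)
    ultimately have "((\<lambda>\<sigma>'. F (w + s *\<^sub>R b + \<sigma>' *\<^sub>R c) - F (w + \<sigma>' *\<^sub>R c)) has_real_derivative
       (pd Q c F (w + s *\<^sub>R b + x *\<^sub>R c) - pd Q c F (w + x *\<^sub>R c))) (at x within {0..s})"
      by (rule DERIV_diff)
    then show "((\<lambda>\<sigma>'. F (w + s *\<^sub>R b + \<sigma>' *\<^sub>R c) - F (w + \<sigma>' *\<^sub>R c)) has_derivative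
       (\<lambda>d. (pd Q c F (w + s *\<^sub>R b + x *\<^sub>R c) - pd Q c F (w + x *\<^sub>R c)) * d)) (at x within {0..s})"
      by (simp add: has_field_derivative_def)
  qed
  then obtain y where y: "0 < y" "y < s"
    "F (w + s *\<^sub>R b + s *\<^sub>R c) - F (w + s *\<^sub>R c) - (F (w + s *\<^sub>R b) - F w)
      = (pd Q c F (w + s *\<^sub>R b + y *\<^sub>R c) - pd Q c F (w + y *\<^sub>R c)) * s"
    by auto
  have "\<exists>\<sigma>\<in>{0<..<s}. pd Q c F (w + y *\<^sub>R c + s *\<^sub>R b) - pd Q c F (w + y *\<^sub>R c + 0 *\<^sub>R b)
    = (\<lambda>d. pd Q b (pd Q c F) (w + y *\<^sub>R c + \<sigma> *\<^sub>R b) * d) (s - 0)"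
  proof (rule mvt_simple[OF s])
    fix x assume x: "0 \<le> x" "x \<le> s"
    have mem': "w + y *\<^sub>R c + \<sigma> *\<^sub>R b \<in> Q" if "0 \<le> \<sigma>" "\<sigma> \<le> s" for \<sigma>
      using mem[OF that, of y] y by (simp add: add_ac)
    have "((\<lambda>\<sigma>. pd Q c F (w + y *\<^sub>R c + \<sigma> *\<^sub>R b)) has_real_derivative pd Q b (pd Q c F) (w + y *\<^sub>R c + x *\<^sub>R b)) (at x within {0..s})"
      by (rule DERIV_subset[OF line_deriv_at[OF b1(1)]]) (use b1(2) mem' x in \<open>auto simp: slice_def\<close>)
    then show "((\<lambda>\<sigma>. pd Q c F (w + y *\<^sub>R c + \<sigma> *\<^sub>R b)) has_derivative
       (\<lambda>d. pd Q b (pd Q c F) (w + y *\<^sub>R c + x *\<^sub>R b) * d)) (at x within {0..s})"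
      by (simp add: has_field_derivative_def)
  qed
  then obtain x where x: "0 < x" "x < s"
    "pd Q c F (w + s *\<^sub>R b + y *\<^sub>R c) - pd Q c F (w + y *\<^sub>R c) = pd Q b (pd Q c F) (w + x *\<^sub>R b + y *\<^sub>R c) * s"
    by (auto simp: add_ac)
  have "F (w + s *\<^sub>R b + s *\<^sub>R c) - F (w + s *\<^sub>R b) - F (w + s *\<^sub>R c) + F w
      = (pd Q c F (w + s *\<^sub>R b + y *\<^sub>R c) - pd Q c F (w + y *\<^sub>R c)) * s"
    using y(3) by linarith
  also have "\<dots> = s * (s * pd Q b (pd Q c F) (w + x *\<^sub>R b + y *\<^sub>R c))"
    unfolding x(3) by (simp only: mult_ac)
  finally have "F (w + s *\<^sub>R b + s *\<^sub>R c) - F (w + s *\<^sub>R b) - F (w + s *\<^sub>R c) + F w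
      = s * (s * pd Q b (pd Q c F) (w + x *\<^sub>R b + y *\<^sub>R c))" .
  then show ?thesis
    by (rule bexI[of _ x, OF bexI[of _ y]]) (use x y in auto)
qed

text \<open>
  Both mixed derivatives are limits of the same mixed difference. At a boundary point the small
  square that carries the difference is chosen on the inner side.
\<close>

lemma pd_commute:
  assumes F: "Ck_on 2 Q F" and b: "b \<in> Basis" and c: "c \<in> Basis" and z: "z \<in> Q"
  shows "pd Q b (pd Q c F) z = pd Q c (pd Q b F) z"
proof (cases "b = c")
  case False
  have F1: "Ck_on (Suc (Suc 0)) Q F" using F by (simp add: numeral_2_eq_2)
  have cont: "continuous_on Q (pd Q b (pd Q c F))" "continuous_on Q (pd Q c (pd Q b F))"
    using Ck_on_line_deriv(2)[OF Ck_on_line_deriv(2)[OF F1 c] b] Ck_on_line_deriv(2)[OF Ck_on_line_deriv(2)[OF F1 b] c]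
    by simp_all
  have "\<bar>pd Q b (pd Q c F) z - pd Q c (pd Q b F) z\<bar> \<le> 0 + e" if "0 < e" for e
  proof -
    have e2: "0 < e / 2" using that by simp
    obtain d1 where d1: "0 < d1" "\<And>p. p \<in> Q \<Longrightarrow> dist p z < d1 \<Longrightarrow> dist (pd Q b (pd Q c F) p) (pd Q b (pd Q c F) z) < e / 2"
      using cont(1) z e2 unfolding continuous_on_iff by metis
    obtain d2 where d2: "0 < d2" "\<And>p. p \<in> Q \<Longrightarrow> dist p z < d2 \<Longrightarrow> dist (pd Q c (pd Q b F) p) (pd Q c (pd Q b F) z) < e / 2"
      using cont(2) z e2 unfolding continuous_on_iff by metis
    \<comment> \<open>the square lies in the box and within distance 4 s of z\<close>
    define s where "s = min (min d1 d2 / 5) (min (q \<bullet> b) (q \<bullet> c) / 2)"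
    have s: "0 < s" "2 * s \<le> q \<bullet> b" "2 * s \<le> q \<bullet> c" "4 * s < d1" "4 * s < d2"
      using d1(1) d2(1) q_pos[OF b] q_pos[OF c] by (auto simp: s_def)
    \<comment> \<open>the corner w lies below z in each direction in which there is no room above\<close>
    define \<beta> where "\<beta> = (if z \<bullet> b + s \<le> q \<bullet> b then 0 else s)"
    define \<gamma> where "\<gamma> = (if z \<bullet> c + s \<le> q \<bullet> c then 0 else s)"
    define w where "w = z - \<beta> *\<^sub>R b - \<gamma> *\<^sub>R c"
    have orth: "b \<bullet> c = 0" "c \<bullet> b = 0" using b c False by (simp_all add: inner_not_same_Basis)
    have mem: "w + \<sigma> *\<^sub>R b + \<sigma>' *\<^sub>R c \<in> Q" if "0 \<le> \<sigma>" "\<sigma> \<le> s" "0 \<le> \<sigma>'" "\<sigma>' \<le> s" for \<sigma> \<sigma>'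
      unfolding mem_Q
    proof
      fix i :: 'a assume i: "i \<in> Basis"
      have zi: "0 \<le> z \<bullet> i" "z \<bullet> i \<le> q \<bullet> i" using z i by (auto simp: mem_Q)
      have zbc: "0 \<le> z \<bullet> b" "z \<bullet> b \<le> q \<bullet> b" "0 \<le> z \<bullet> c" "z \<bullet> c \<le> q \<bullet> c" using z b c by (auto simp: mem_Q)
      consider "i = b" | "i = c" "i \<noteq> b" | "i \<noteq> b" "i \<noteq> c" by auto
      then show "0 \<le> (w + \<sigma> *\<^sub>R b + \<sigma>' *\<^sub>R c) \<bullet> i \<and> (w + \<sigma> *\<^sub>R b + \<sigma>' *\<^sub>R c) \<bullet> i \<le> q \<bullet> i"
      proof cases
        case 1
        then show ?thesis using zbc that s b orth
          by (auto simp: w_def \<beta>_def inner_simps)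
      next
        case 2
        then show ?thesis using zbc that s c orth
          by (auto simp: w_def \<gamma>_def inner_simps)
      next
        case 3
        then show ?thesis using zi i b c
          by (simp add: w_def inner_simps inner_not_same_Basis)
      qed
    qed
    have near: "dist (w + \<sigma> *\<^sub>R b + \<sigma>' *\<^sub>R c) z \<le> 4 * s" if "0 \<le> \<sigma>" "\<sigma> \<le> s" "0 \<le> \<sigma>'" "\<sigma>' \<le> s" for \<sigma> \<sigma>'
    proof -
      have "dist (w + \<sigma> *\<^sub>R b + \<sigma>' *\<^sub>R c) z = norm ((\<sigma> - \<beta>) *\<^sub>R b + (\<sigma>' - \<gamma>) *\<^sub>R c)"
        by (simp add: dist_norm w_def algebra_simps)
      also have "\<dots> \<le> \<bar>\<sigma> - \<beta>\<bar> * 1 + \<bar>\<sigma>' - \<gamma>\<bar> * 1"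
        using b c by (intro order_trans[OF norm_triangle_ineq]) simp
      also have "\<dots> \<le> 4 * s"
        using that s(1) by (auto simp: \<beta>_def \<gamma>_def)
      finally show ?thesis .
    qed
    have mem2: "w + \<sigma> *\<^sub>R c + \<sigma>' *\<^sub>R b \<in> Q" if "0 \<le> \<sigma>" "\<sigma> \<le> s" "0 \<le> \<sigma>'" "\<sigma>' \<le> s" for \<sigma> \<sigma>'
      using mem[OF that(3,4,1,2)] by (simp add: add_ac)
    obtain x y where xy: "x \<in> {0..s}" "y \<in> {0..s}"
      "F (w + s *\<^sub>R b + s *\<^sub>R c) - F (w + s *\<^sub>R b) - F (w + s *\<^sub>R c) + F w
        = s * (s * pd Q b (pd Q c F) (w + x *\<^sub>R b + y *\<^sub>R c))"
      using mixed_second_difference[OF F b c s(1) mem] by auto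
    obtain x' y' where xy': "x' \<in> {0..s}" "y' \<in> {0..s}"
      "F (w + s *\<^sub>R c + s *\<^sub>R b) - F (w + s *\<^sub>R c) - F (w + s *\<^sub>R b) + F w
        = s * (s * pd Q c (pd Q b F) (w + x' *\<^sub>R c + y' *\<^sub>R b))"
      using mixed_second_difference[OF F c b s(1) mem2] by auto
    have cm: "w + s *\<^sub>R c + s *\<^sub>R b = w + s *\<^sub>R b + s *\<^sub>R c" by (simp add: add_ac)
    then have "s * (s * pd Q b (pd Q c F) (w + x *\<^sub>R b + y *\<^sub>R c)) = s * (s * pd Q c (pd Q b F) (w + x' *\<^sub>R c + y' *\<^sub>R b))"
      using xy(3) xy'(3)[unfolded cm] by linarith
    then have eq: "pd Q b (pd Q c F) (w + x *\<^sub>R b + y *\<^sub>R c) = pd Q c (pd Q b F) (w + y' *\<^sub>R b + x' *\<^sub>R c)"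
      using s(1) by (simp add: add_ac)
    have "dist (pd Q b (pd Q c F) (w + x *\<^sub>R b + y *\<^sub>R c)) (pd Q b (pd Q c F) z) < e / 2"
      by (rule d1(2)) (use xy mem near[of x y] s in auto)
    moreover have "dist (pd Q c (pd Q b F) (w + y' *\<^sub>R b + x' *\<^sub>R c)) (pd Q c (pd Q b F) z) < e / 2"
      by (rule d2(2)) (use xy' mem near[of y' x'] s in auto)
    ultimately show ?thesis unfolding eq dist_real_def by linarith
  qed
  then have "\<bar>pd Q b (pd Q c F) z - pd Q c (pd Q b F) z\<bar> \<le> 0" by (rule field_le_epsilon)
  then show ?thesis by simp
qed simp

lemma pd_cong:
  assumes "\<And>z. z \<in> Q \<Longrightarrow> F z = G z" "z \<in> Q"
  shows "pd Q b F z = pd Q b G z"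
proof -
  have *: "(F (z + s *\<^sub>R b)) = (G (z + s *\<^sub>R b))" if "s \<in> slice Q b z" for s
    using that assms by (simp add: slice_def)
  show ?thesis
    unfolding pd_def vector_derivative_def
  proof (rule arg_cong[where f = Eps], rule ext, rule iffI)
    fix D
    show "((\<lambda>s. G (z + s *\<^sub>R b)) has_vector_derivative D) (at 0 within slice Q b z)"
      if "((\<lambda>s. F (z + s *\<^sub>R b)) has_vector_derivative D) (at 0 within slice Q b z)"
      by (rule has_vector_derivative_transform[OF zero_in_slice[OF assms(2)] _ that]) (simp add: *)
    show "((\<lambda>s. F (z + s *\<^sub>R b)) has_vector_derivative D) (at 0 within slice Q b z)"
      if "((\<lambda>s. G (z + s *\<^sub>R b)) has_vector_derivative D) (at 0 within slice Q b z)"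
      by (rule has_vector_derivative_transform[OF zero_in_slice[OF assms(2)] _ that]) (simp add: *)
  qed
qed

lemma pd2_pd_commute:
  assumes F: "Ck_on 3 Q F" and b: "b \<in> Basis" and c: "c \<in> Basis" and z: "z \<in> Q"
  shows "pd Q c ((pd Q b ^^ 2) F) z = (pd Q b ^^ 2) (pd Q c F) z"
proof -
  have F3: "Ck_on (Suc 2) Q F" using F by (simp add: eval_nat_numeral)
  have "pd Q c (pd Q b (pd Q b F)) z = pd Q b (pd Q c (pd Q b F)) z"
    by (rule pd_commute[OF Ck_on_line_deriv(2)[OF F3 b] c b z])
  also have "\<dots> = pd Q b (pd Q b (pd Q c F)) z"
    by (rule pd_cong[OF pd_commute[OF Ck_on_SucD[OF F3] c b] z])
  finally show ?thesis by (simp add: numeral_2_eq_2)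
qed

end

section \<open>Truncation errors on the space-time cylinder\<close>

definition bx :: "'n::finite \<Rightarrow> (real^'n) \<times> real" where "bx i = (axis i 1, 0)"
definition bt :: "(real^'n::finite) \<times> real" where "bt = (0, 1)"

lemma bx_Basis [simp]: "bx i \<in> Basis"
  by (simp add: bx_def Basis_prod_def)

lemma bt_Basis [simp]: "bt \<in> Basis"
  by (simp add: bt_def Basis_prod_def)

lemma bx_neq_bt [simp]: "bx i \<noteq> bt" "bt \<noteq> bx i"
  by (simp_all add: bx_def bt_def)

lemma inj_bx: "inj bx"
  by (auto simp: inj_on_def bx_def axis_eq_axis)

lemma bx_eq [simp]: "bx i = bx j \<longleftrightarrow> i = j"
  using inj_bx by (auto simp: inj_on_def)

lemma Basis_cyl: "(Basis :: ((real^'n::finite) \<times> real) set) = insert bt (range bx)"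
  by (auto simp: Basis_prod_def bx_def bt_def Basis_vec_def)

definition LS :: "(real^'n::finite) \<times> real \<Rightarrow> 'n set \<Rightarrow> ((real^'n) \<times> real \<Rightarrow> real) \<Rightarrow> (real^'n) \<times> real \<Rightarrow> real" where
  "LS \<eta> S F = Finite_Set.fold (\<lambda>i. cLam \<eta> (bx i)) F S"

lemma LS_empty [simp]: "LS \<eta> {} F = F"
  by (simp add: LS_def)

lemma LS_insert:
  assumes "i \<notin> S"
  shows "LS \<eta> (insert i S) F = cLam \<eta> (bx i) (LS \<eta> S F)"
proof -
  interpret comp_fun_commute "\<lambda>i. cLam \<eta> (bx i)"
    by unfold_locales (simp add: fun_eq_iff cLam_commute)
  show ?thesis using assms by (simp add: LS_def)
qed

lemma LS_list: "distinct ls \<Longrightarrow> LS \<eta> (set ls) F = cLams \<eta> (map bx ls) F"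
  by (induction ls) (simp_all add: LS_insert)

lemma LS_single [simp]: "LS \<eta> {i} F = cLam \<eta> (bx i) F"
  by (simp add: LS_insert)

text \<open>
  All operators \<open>B\<^sub>h\<close> and \<open>A\<^sub>h\<close> are sums over sets of directions whose coefficients depend on the
  number of directions only. \<open>Bc\<close> and \<open>Ac\<close> are their versions for functions of a continuous variable.
\<close>

definition Bc :: "(nat \<Rightarrow> real) \<Rightarrow> (real^'n::finite) \<times> real \<Rightarrow> ((real^'n) \<times> real \<Rightarrow> real) \<Rightarrow> (real^'n) \<times> real \<Rightarrow> real" where
  "Bc bc \<eta> F z = (\<Sum>S\<in>Pow UNIV. bc (card S) * (\<Prod>i\<in>S. (\<eta> \<bullet> bx i)\<^sup>2) * LS \<eta> S F z)"

definition Ac :: "(nat \<Rightarrow> real) \<Rightarrow> real^'n \<Rightarrow> (real^'n::finite) \<times> real \<Rightarrow> ((real^'n) \<times> real \<Rightarrow> real) \<Rightarrow> (real^'n) \<times> real \<Rightarrow> real" where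
  "Ac ac a \<eta> F z = - (\<Sum>l\<in>UNIV. (a $ l)\<^sup>2 *
     (\<Sum>S\<in>Pow (UNIV - {l}). ac (card S) * (\<Prod>i\<in>S. (\<eta> \<bullet> bx i)\<^sup>2) * LS \<eta> (insert l S) F z))"

lemma sum_Pow_split:
  fixes g :: "'a set \<Rightarrow> real"
  assumes "finite A"
  shows "(\<Sum>S\<in>Pow A. g S) = g {} + (\<Sum>i\<in>A. g {i}) + (\<Sum>S\<in>{S \<in> Pow A. 2 \<le> card S}. g S)"
proof -
  have fin: "finite (Pow A)" and finS: "\<And>S. S \<in> Pow A \<Longrightarrow> finite S"
    using assms finite_subset by auto
  have "Pow A = insert {} ((\<lambda>i. {i}) ` A) \<union> {S \<in> Pow A. 2 \<le> card S}"
  proof (intro set_eqI iffI)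
    fix S assume S: "S \<in> Pow A"
    consider "card S = 0" | "card S = 1" | "2 \<le> card S" by linarith
    then show "S \<in> insert {} ((\<lambda>i. {i}) ` A) \<union> {S \<in> Pow A. 2 \<le> card S}"
      using S finS[OF S] by cases (auto simp: card_1_singleton_iff)
  qed auto
  moreover have "insert {} ((\<lambda>i. {i}) ` A) \<inter> {S \<in> Pow A. 2 \<le> card S} = {}" by auto
  ultimately have "(\<Sum>S\<in>Pow A. g S) = (\<Sum>S\<in>insert {} ((\<lambda>i. {i}) ` A). g S) + (\<Sum>S\<in>{S \<in> Pow A. 2 \<le> card S}. g S)"
    using assms fin by (metis (no_types, lifting) sum.union_disjoint finite_Un)
  also have "(\<Sum>S\<in>insert {} ((\<lambda>i. {i}) ` A). g S) = g {} + (\<Sum>i\<in>A. g {i})"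
    using assms by (subst sum.insert) (auto simp: sum.reindex)
  finally show ?thesis .
qed

locale cylinder = origin_box Q "(X, T)" for Q :: "((real^'n::finite) \<times> real) set" and X T
begin

lemma bnd_step_prod: "bnd P (2 * card (S :: 'n set)) (\<lambda>\<eta> z. \<Prod>i\<in>S. (\<eta> \<bullet> bx i)\<^sup>2)"
proof (induction S rule: infinite_finite_induct)
  case (insert i S)
  have "bnd P (2 + 2 * card S) (\<lambda>\<eta> z. (\<eta> \<bullet> bx i) ^ 2 * (\<Prod>i\<in>S. (\<eta> \<bullet> bx i)\<^sup>2))"
    by (rule bnd_step_mult[OF insert.IH bx_Basis])
  then show ?case using insert.hyps by simp
qed (use bnd_const[of P 1] in simp_all)

lemma bnd_LS:
  assumes "Ck_on (2 * card S) Q F" "\<And>\<eta> z. P \<eta> z \<Longrightarrow> admissible (range bx) \<eta> z"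
  shows "bnd P 0 (\<lambda>\<eta> z. LS \<eta> S F z)"
proof -
  obtain ls where ls: "distinct ls" "set ls = S" using finite_distinct_list[of S] by auto
  then have len: "length ls = card S" using distinct_card by metis
  have "bnd (admissible (set (map bx ls))) 0 (\<lambda>\<eta> z. cLams \<eta> (map bx ls) F z)"
    by (rule bnd_cLams) (use ls len assms(1) in \<open>auto simp: distinct_map inj_on_subset[OF inj_bx]\<close>)
  then have "bnd (admissible (bx ` S)) 0 (\<lambda>\<eta> z. LS \<eta> S F z)"
    using ls LS_list[OF ls(1)] by simp
  then show ?thesis
    by (rule bnd_subdom) (use assms(2) in \<open>auto simp: admissible_def D_def\<close>)
qed

lemma bnd_LS_cLam:
  assumes "Ck_on (2 + 2 * card S) Q F" "\<And>\<eta> z. P \<eta> z \<Longrightarrow> admissible Basis \<eta> z"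
  shows "bnd P 0 (\<lambda>\<eta> z. LS \<eta> S (cLam \<eta> bt F) z)"
proof -
  obtain ls where ls: "distinct ls" "set ls = S" using finite_distinct_list[of S] by auto
  then have len: "length ls = card S" using distinct_card by metis
  have "bnd (admissible (set (bt # map bx ls))) 0 (\<lambda>\<eta> z. cLams \<eta> (bt # map bx ls) F z)"
    by (rule bnd_cLams) (use ls len assms(1) in \<open>auto simp: distinct_map inj_on_subset[OF inj_bx]\<close>)
  then have "bnd (admissible (insert bt (bx ` S))) 0 (\<lambda>\<eta> z. LS \<eta> S (cLam \<eta> bt F) z)"
    using ls LS_list[OF ls(1)] by (simp add: cLams_cLam)
  then show ?thesis
    by (rule bnd_subdom) (use assms(2) in \<open>auto simp: admissible_def D_def\<close>)
qed

lemma bnd_LS_fD: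
  assumes "Ck_on (1 + 2 * card S) Q F"
    "\<And>\<eta> z. P \<eta> z \<Longrightarrow> admissible (range bx) \<eta> z \<and> z + (\<eta> \<bullet> bt) *\<^sub>R bt \<in> Q"
  shows "bnd P 0 (\<lambda>\<eta> z. LS \<eta> S (fD \<eta> bt F) z)"
proof -
  obtain ls where ls: "distinct ls" "set ls = S" using finite_distinct_list[of S] by auto
  then have len: "length ls = card S" using distinct_card by metis
  have "bnd (\<lambda>\<eta> z. admissible (set (map bx ls)) \<eta> z \<and> z + (\<eta> \<bullet> bt) *\<^sub>R bt \<in> Q) 0
     (\<lambda>\<eta> z. fD \<eta> bt (cLams \<eta> (map bx ls) F) z - (\<Sum>i<0. cLams \<eta> (map bx ls) ((pd Q bt ^^ Suc i) F) z * (\<eta> \<bullet> bt) ^ i / fact (Suc i)))"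
    by (rule bnd_forward_diff) (use ls len assms(1) in \<open>auto simp: distinct_map inj_on_subset[OF inj_bx]\<close>)
  then have "bnd (\<lambda>\<eta> z. admissible (bx ` S) \<eta> z \<and> z + (\<eta> \<bullet> bt) *\<^sub>R bt \<in> Q) 0 (\<lambda>\<eta> z. LS \<eta> S (fD \<eta> bt F) z)"
    using ls LS_list[OF ls(1)] by (simp add: cLams_fD)
  then show ?thesis
    by (rule bnd_subdom) (use assms(2) in \<open>auto simp: admissible_def D_def\<close>)
qed

text \<open>
  Each direction in \<open>S\<close> contributes a factor \<open>h\<^sub>i\<^sup>2\<close>, so the terms with many directions are small.
\<close>

lemma bnd_high_terms:
  assumes "\<And>S. bnd P 0 (\<lambda>\<eta> z. E S \<eta> z)" "\<And>\<eta> z. P \<eta> z \<Longrightarrow> \<eta> \<in> Q" and "j \<le> 2 * m"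
  shows "bnd P j (\<lambda>\<eta> z. \<Sum>S\<in>{S \<in> Pow A. m \<le> card (S::'n set)}. c (card S) * (\<Prod>i\<in>S. (\<eta> \<bullet> bx i)\<^sup>2) * E S \<eta> z)"
proof (rule bnd_sum)
  fix S :: "'n set" assume S: "S \<in> {S \<in> Pow A. m \<le> card S}"
  have "bnd P (2 * card S + 0) (\<lambda>\<eta> z. (c (card S) * (\<Prod>i\<in>S. (\<eta> \<bullet> bx i)\<^sup>2)) * E S \<eta> z)"
    by (intro bnd_mult bnd_cmult bnd_step_prod assms)
  then show "bnd P j (\<lambda>\<eta> z. c (card S) * (\<Prod>i\<in>S. (\<eta> \<bullet> bx i)\<^sup>2) * E S \<eta> z)"
    by (rule bnd_lower[OF _ _ assms(2)]) (use S assms(3) in auto)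
qed

text \<open>
  The empty set and the single directions have coefficients \<open>1\<close> and \<open>1/12\<close> and form \<open>s\<^sub>N\<close>; the terms
  with two or more directions are of the fourth order.
\<close>

lemma Bc_expand:
  assumes "\<And>S. bnd P 0 (\<lambda>\<eta> z. LS \<eta> S (w \<eta>) z)" "\<And>\<eta> z. P \<eta> z \<Longrightarrow> \<eta> \<in> Q" and bc: "bc 0 = 1" "bc 1 = 1/12"
  shows "bnd P 4 (\<lambda>\<eta> z. Bc bc \<eta> (w \<eta>) z - (w \<eta> z + (1/12) * (\<Sum>i\<in>UNIV. (\<eta> \<bullet> bx i)\<^sup>2 * cLam \<eta> (bx i) (w \<eta>) z)))"
proof (rule bnd_cong)
  show "bnd P 4 (\<lambda>\<eta> z. \<Sum>S\<in>{S \<in> Pow UNIV. 2 \<le> card S}. bc (card S) * (\<Prod>i\<in>S. (\<eta> \<bullet> bx i)\<^sup>2) * LS \<eta> S (w \<eta>) z)"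
    by (rule bnd_high_terms) (use assms in auto)
  show "Bc bc \<eta> (w \<eta>) z - (w \<eta> z + (1/12) * (\<Sum>i\<in>UNIV. (\<eta> \<bullet> bx i)\<^sup>2 * cLam \<eta> (bx i) (w \<eta>) z))
    = (\<Sum>S\<in>{S \<in> Pow UNIV. 2 \<le> card S}. bc (card S) * (\<Prod>i\<in>S. (\<eta> \<bullet> bx i)\<^sup>2) * LS \<eta> S (w \<eta>) z)" for \<eta> z
  proof -
    have bc1: "bc (Suc 0) = 1/12" using bc by simp
    show ?thesis
      unfolding Bc_def by (subst sum_Pow_split) (simp_all add: bc(1) bc1 sum_distrib_left)
  qed
qed

lemma Ac_expand:
  assumes "\<And>S. bnd P 0 (\<lambda>\<eta> z. LS \<eta> S (w \<eta>) z)" "\<And>\<eta> z. P \<eta> z \<Longrightarrow> \<eta> \<in> Q" and ac: "ac 0 = 1" "ac 1 = 1/12"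
  shows "bnd P 4 (\<lambda>\<eta> z. Ac ac a \<eta> (w \<eta>) z + (\<Sum>l\<in>UNIV. (a $ l)\<^sup>2 *
    (cLam \<eta> (bx l) (w \<eta>) z + (1/12) * (\<Sum>i\<in>UNIV - {l}. (\<eta> \<bullet> bx i)\<^sup>2 * cLam \<eta> (bx l) (cLam \<eta> (bx i) (w \<eta>)) z))))"
proof (rule bnd_cong)
  show "bnd P 4 (\<lambda>\<eta> z. \<Sum>l\<in>UNIV. (-(a $ l)\<^sup>2) * (\<Sum>S\<in>{S \<in> Pow (UNIV - {l}). 2 \<le> card S}.
      ac (card S) * (\<Prod>i\<in>S. (\<eta> \<bullet> bx i)\<^sup>2) * LS \<eta> (insert l S) (w \<eta>) z))"
    by (intro bnd_sum bnd_cmult bnd_high_terms) (use assms in auto)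
  fix \<eta> z
  have "(\<Sum>S\<in>Pow (UNIV - {l}). ac (card S) * (\<Prod>i\<in>S. (\<eta> \<bullet> bx i)\<^sup>2) * LS \<eta> (insert l S) (w \<eta>) z)
    = cLam \<eta> (bx l) (w \<eta>) z + (1/12) * (\<Sum>i\<in>UNIV - {l}. (\<eta> \<bullet> bx i)\<^sup>2 * cLam \<eta> (bx l) (cLam \<eta> (bx i) (w \<eta>)) z)
      + (\<Sum>S\<in>{S \<in> Pow (UNIV - {l}). 2 \<le> card S}. ac (card S) * (\<Prod>i\<in>S. (\<eta> \<bullet> bx i)\<^sup>2) * LS \<eta> (insert l S) (w \<eta>) z)" for l
  proof -
    have ac1: "ac (Suc 0) = 1/12" using ac by simp
    show ?thesis
      by (subst sum_Pow_split) (simp_all add: ac(1) ac1 sum_distrib_left LS_insert)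
  qed
  then show "Ac ac a \<eta> (w \<eta>) z + (\<Sum>l\<in>UNIV. (a $ l)\<^sup>2 *
    (cLam \<eta> (bx l) (w \<eta>) z + (1/12) * (\<Sum>i\<in>UNIV - {l}. (\<eta> \<bullet> bx i)\<^sup>2 * cLam \<eta> (bx l) (cLam \<eta> (bx i) (w \<eta>)) z)))
    = (\<Sum>l\<in>UNIV. (-(a $ l)\<^sup>2) * (\<Sum>S\<in>{S \<in> Pow (UNIV - {l}). 2 \<le> card S}.
      ac (card S) * (\<Prod>i\<in>S. (\<eta> \<bullet> bx i)\<^sup>2) * LS \<eta> (insert l S) (w \<eta>) z))"
    unfolding Ac_def by (simp add: distrib_left sum.distrib sum_negf)
qed

lemma Ac_expand_low:
  assumes "\<And>S. bnd P 0 (\<lambda>\<eta> z. LS \<eta> S (w \<eta>) z)" "\<And>\<eta> z. P \<eta> z \<Longrightarrow> \<eta> \<in> Q" and ac: "ac 0 = 1"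
  shows "bnd P 2 (\<lambda>\<eta> z. Ac ac a \<eta> (w \<eta>) z + (\<Sum>l\<in>UNIV. (a $ l)\<^sup>2 * cLam \<eta> (bx l) (w \<eta>) z))"
proof (rule bnd_cong)
  show "bnd P 2 (\<lambda>\<eta> z. \<Sum>l\<in>UNIV. (-(a $ l)\<^sup>2) * (\<Sum>S\<in>{S \<in> Pow (UNIV - {l}). 1 \<le> card S}.
      ac (card S) * (\<Prod>i\<in>S. (\<eta> \<bullet> bx i)\<^sup>2) * LS \<eta> (insert l S) (w \<eta>) z))"
    by (intro bnd_sum bnd_cmult bnd_high_terms) (use assms in auto)
  fix \<eta> z
  have "Pow (UNIV - {l}) = insert {} {S \<in> Pow (UNIV - {l}). 1 \<le> card S}" for l :: 'n
    by (auto simp: Suc_le_eq card_gt_0_iff)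
  then have "(\<Sum>S\<in>Pow (UNIV - {l}). ac (card S) * (\<Prod>i\<in>S. (\<eta> \<bullet> bx i)\<^sup>2) * LS \<eta> (insert l S) (w \<eta>) z)
    = cLam \<eta> (bx l) (w \<eta>) z
      + (\<Sum>S\<in>{S \<in> Pow (UNIV - {l}). 1 \<le> card S}. ac (card S) * (\<Prod>i\<in>S. (\<eta> \<bullet> bx i)\<^sup>2) * LS \<eta> (insert l S) (w \<eta>) z)" for l
    by (subst \<open>Pow (UNIV - {l}) = _\<close>, subst sum.insert) (use ac in auto)
  then show "Ac ac a \<eta> (w \<eta>) z + (\<Sum>l\<in>UNIV. (a $ l)\<^sup>2 * cLam \<eta> (bx l) (w \<eta>) z)
    = (\<Sum>l\<in>UNIV. (-(a $ l)\<^sup>2) * (\<Sum>S\<in>{S \<in> Pow (UNIV - {l}). 1 \<le> card S}.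
      ac (card S) * (\<Prod>i\<in>S. (\<eta> \<bullet> bx i)\<^sup>2) * LS \<eta> (insert l S) (w \<eta>) z))"
    unfolding Ac_def by (simp add: distrib_left sum.distrib sum_negf)
qed

end

lemma cLam_lincomb_sum:
  "cLam \<eta> b (\<lambda>z. F z - (\<Sum>l\<in>I. c l * G l z)) z = cLam \<eta> b F z - (\<Sum>l\<in>I. c l * cLam \<eta> b (G l) z)"
proof -
  have "(\<Sum>l\<in>I. c l * cLam \<eta> b (G l) z) = ((\<Sum>l\<in>I. c l * G l (z + (\<eta> \<bullet> b) *\<^sub>R b))
     - 2 * (\<Sum>l\<in>I. c l * G l z) + (\<Sum>l\<in>I. c l * G l (z - (\<eta> \<bullet> b) *\<^sub>R b))) / (\<eta> \<bullet> b)\<^sup>2"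
    unfolding cLam_def sum_distrib_left sum_subtractf[symmetric] sum.distrib[symmetric] sum_divide_distrib
    by (rule sum.cong) (simp_all add: algebra_simps)
  then show ?thesis unfolding cLam_def by (simp add: diff_divide_distrib add_divide_distrib algebra_simps)
qed

context cylinder
begin

text \<open>
  The residual of the difference equation for the exact solution, where \<open>W\<close> stands for \<open>\<rho> u\<close>.
  As \<open>\<rho>\<close> does not depend on time, \<open>\<rho> \<Lambda>\<^sub>t u = \<Lambda>\<^sub>t W\<close>.
\<close>

definition residual where
  "residual bc ac a W U f \<eta> z = Bc bc \<eta> (cLam \<eta> bt W) z + (1/12) * (\<eta> \<bullet> bt)\<^sup>2 * Ac ac a \<eta> (cLam \<eta> bt U) z
      + Ac ac a \<eta> U z
      - (f z + (1/12) * (\<Sum>i\<in>UNIV. (\<eta> \<bullet> bx i)\<^sup>2 * cLam \<eta> (bx i) f z) + (1/12) * (\<eta> \<bullet> bt)\<^sup>2 * cLam \<eta> bt f z)"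

text \<open>
  The same for the equation on the first time level. The derivatives of \<open>f\<close> at \<open>t = 0\<close> are written
  through \<open>W\<close> and \<open>U\<close> by the differential equation, with the derivatives in time taken first.
\<close>

definition initial_residual where
  "initial_residual bc ac a W U f \<eta> z = Bc bc \<eta> (fD \<eta> bt W) z + (1/12) * (\<eta> \<bullet> bt)\<^sup>2 * Ac ac a \<eta> (fD \<eta> bt U) z
      + (1/2) * (\<eta> \<bullet> bt) * Ac ac a \<eta> U z
      - ((pd Q bt ^^ 1) W z + (1/12) * (\<Sum>i\<in>UNIV. (\<eta> \<bullet> bx i)\<^sup>2 * cLam \<eta> (bx i) ((pd Q bt ^^ 1) W) z)
         + (1/12) * (\<eta> \<bullet> bt)\<^sup>2 * (\<Sum>l\<in>UNIV. (a $ l)\<^sup>2 * cLam \<eta> (bx l) ((pd Q bt ^^ 1) U) z))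
      - (1/2) * (\<eta> \<bullet> bt) * (f z
          + (1/3) * (\<eta> \<bullet> bt) * ((pd Q bt ^^ 3) W z - (\<Sum>l\<in>UNIV. (a $ l)\<^sup>2 * (pd Q (bx l) ^^ 2) ((pd Q bt ^^ 1) U) z))
          + (1/12) * (\<eta> \<bullet> bt)\<^sup>2 * ((pd Q bt ^^ 4) W z - (\<Sum>l\<in>UNIV. (a $ l)\<^sup>2 * (pd Q (bx l) ^^ 2) ((pd Q bt ^^ 2) U) z))
          + (1/12) * (\<Sum>i\<in>UNIV. (\<eta> \<bullet> bx i)\<^sup>2 * cLam \<eta> (bx i) f z))"

lemma admissible_mono: "admissible B \<eta> z \<Longrightarrow> B' \<subseteq> B \<Longrightarrow> admissible B' \<eta> z"
  by (auto simp: admissible_def D_def)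

lemma bnd_second_diff_0:
  assumes "b \<in> Basis" "Ck_on 4 Q F" "\<And>\<eta> z. P \<eta> z \<Longrightarrow> admissible {b} \<eta> z"
  shows "bnd P 2 (\<lambda>\<eta> z. cLam \<eta> b F z - (pd Q b ^^ 2) F z)"
  using bnd_second_diff[of b "[]" F] assms by (auto intro: bnd_subdom)

lemma bnd_second_diff_1:
  assumes "b \<in> Basis" "c \<in> Basis" "b \<noteq> c" "Ck_on 6 Q F" "\<And>\<eta> z. P \<eta> z \<Longrightarrow> admissible {b, c} \<eta> z"
  shows "bnd P 2 (\<lambda>\<eta> z. cLam \<eta> b (cLam \<eta> c F) z - cLam \<eta> c ((pd Q b ^^ 2) F) z)"
  using bnd_second_diff[of b "[c]" F] assms by (auto intro: bnd_subdom)

lemma bnd_second_diff_compact':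
  assumes "b \<in> Basis" "Ck_on 6 Q F" "\<And>\<eta> z. P \<eta> z \<Longrightarrow> admissible {b} \<eta> z"
  shows "bnd P 4 (\<lambda>\<eta> z. cLam \<eta> b F z - (pd Q b ^^ 2) F z - (\<eta> \<bullet> b)\<^sup>2 / 12 * cLam \<eta> b ((pd Q b ^^ 2) F) z)"
  using bnd_second_diff_compact[of b F] assms by (auto intro: bnd_subdom)

lemma bnd_step_mult':
  assumes "bnd P j E" "b \<in> Basis" "\<And>\<eta> z. P \<eta> z \<Longrightarrow> \<eta> \<in> Q" "i \<le> k + j"
  shows "bnd P i (\<lambda>\<eta> z. (\<eta> \<bullet> b) ^ k * E \<eta> z)"
  by (rule bnd_lower[OF bnd_step_mult[OF assms(1,2)] assms(4,3)])

lemma admissible_Q: "admissible B \<eta> z \<Longrightarrow> \<eta> \<in> Q"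
  by (simp add: admissible_def)

end

text \<open>
  The orders of smoothness have two sources. A product of second differences in all directions and in time consumes \<open>2 n + 2\<close> derivatives; the Taylor formulas
  for the leading terms need a fixed number.
\<close>

locale truncation = cylinder +
  fixes a :: "real^'a" and bc ac :: "nat \<Rightarrow> real" and W U f :: "(real^'a) \<times> real \<Rightarrow> real"
  assumes bc: "bc 0 = 1" "bc 1 = 1/12" and ac: "ac 0 = 1" "ac 1 = 1/12"
    and W: "Ck_on (2 * CARD('a) + 8) Q W" and U: "Ck_on (2 * CARD('a) + 8) Q U"
    and f: "\<And>z. z \<in> Q \<Longrightarrow> f z = (pd Q bt ^^ 2) W z - (\<Sum>l\<in>UNIV. (a $ l)\<^sup>2 * (pd Q (bx l) ^^ 2) U z)"
begin

abbreviation "Utt l \<equiv> (pd Q (bx l) ^^ 2) U"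
abbreviation "Wt k \<equiv> (pd Q bt ^^ k) W"
abbreviation "Ut k \<equiv> (pd Q bt ^^ k) U"

lemma card_le: "card (S :: 'a set) \<le> CARD('a)"
  by (rule card_mono) auto

lemma W_le: "k \<le> 2 * CARD('a) + 8 \<Longrightarrow> Ck_on k Q W"
  by (rule Ck_on_mono[OF W])

lemma U_le: "k \<le> 2 * CARD('a) + 8 \<Longrightarrow> Ck_on k Q U"
  by (rule Ck_on_mono[OF U])

lemma W_card: "Ck_on (2 + 2 * card (S :: 'a set)) Q W" "Ck_on (1 + 2 * card S) Q W"
  by (rule W_le, use card_le[of S] in simp)+

lemma U_card: "Ck_on (2 + 2 * card (S :: 'a set)) Q U" "Ck_on (1 + 2 * card S) Q U" "Ck_on (2 * card S) Q U"
  by (rule U_le, use card_le[of S] in simp)+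

lemma cLam_f:
  assumes "z \<in> D \<eta> {b}"
  shows "cLam \<eta> b f z = cLam \<eta> b (Wt 2) z - (\<Sum>l\<in>UNIV. (a $ l)\<^sup>2 * cLam \<eta> b (Utt l) z)"
proof -
  have "cLam \<eta> b f z = cLam \<eta> b (\<lambda>z. Wt 2 z - (\<Sum>l\<in>UNIV. (a $ l)\<^sup>2 * Utt l z)) z"
    using assms f by (simp add: cLam_def D_def)
  then show ?thesis by (simp only: cLam_lincomb_sum)
qed

text \<open>
  The heart of the fourth order in space: \<open>\<Lambda>\<^sub>l u = \<partial>\<^sub>l\<^sup>2 u + (h\<^sub>l\<^sup>2/12) \<Lambda>\<^sub>l \<partial>\<^sub>l\<^sup>2 u + \<dots>\<close> supplies the direction \<open>i = l\<close>
  that the sum over \<open>i \<noteq> l\<close> in \<open>A\<^sub>h\<close> leaves out, so that \<open>A\<^sub>h u\<close> agrees with \<open>- s\<^sub>N (a\<^sub>1\<^sup>2 \<partial>\<^sub>1\<^sup>2 + \<dots> + a\<^sub>n\<^sup>2 \<partial>\<^sub>n\<^sup>2) u\<close>.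
\<close>

lemma bnd_Ac_U:
  assumes P: "\<And>\<eta> z. P \<eta> z \<Longrightarrow> admissible (range bx) \<eta> z"
  shows "bnd P 4 (\<lambda>\<eta> z. Ac ac a \<eta> U z + (\<Sum>l\<in>UNIV. (a $ l)\<^sup>2 * Utt l z)
    + (1/12) * (\<Sum>l\<in>UNIV. (a $ l)\<^sup>2 * (\<Sum>i\<in>UNIV. (\<eta> \<bullet> bx i)\<^sup>2 * cLam \<eta> (bx i) (Utt l) z)))"
proof -
  have PQ: "\<And>\<eta> z. P \<eta> z \<Longrightarrow> \<eta> \<in> Q" using P admissible_Q by blast
  have Pb: "\<And>\<eta> z. P \<eta> z \<Longrightarrow> admissible {bx l} \<eta> z" "\<And>\<eta> z. P \<eta> z \<Longrightarrow> admissible {bx l, bx i} \<eta> z" for l i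
    by (rule admissible_mono[OF P], simp, blast)+
  have E1: "bnd P 4 (\<lambda>\<eta> z. Ac ac a \<eta> U z + (\<Sum>l\<in>UNIV. (a $ l)\<^sup>2 *
    (cLam \<eta> (bx l) U z + (1/12) * (\<Sum>i\<in>UNIV - {l}. (\<eta> \<bullet> bx i)\<^sup>2 * cLam \<eta> (bx l) (cLam \<eta> (bx i) U) z))))"
    by (rule Ac_expand[where w = "\<lambda>_. U", OF bnd_LS[OF U_card(3) P] PQ ac])
  have E2: "bnd P 4 (\<lambda>\<eta> z. \<Sum>l\<in>UNIV. (a $ l)\<^sup>2 * (cLam \<eta> (bx l) U z - Utt l z - (\<eta> \<bullet> bx l)\<^sup>2 / 12 * cLam \<eta> (bx l) (Utt l) z))"
    by (intro bnd_sum bnd_cmult bnd_second_diff_compact' bx_Basis U_le Pb) auto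
  have E3: "bnd P 4 (\<lambda>\<eta> z. \<Sum>l\<in>UNIV. (a $ l)\<^sup>2 * (\<Sum>i\<in>UNIV - {l}. (\<eta> \<bullet> bx i)\<^sup>2 *
      (cLam \<eta> (bx l) (cLam \<eta> (bx i) U) z - cLam \<eta> (bx i) (Utt l) z)))"
    by (intro bnd_sum bnd_cmult bnd_step_mult'[where j = 2] bnd_second_diff_1 bx_Basis U_le Pb PQ) auto
  have split: "(\<Sum>i\<in>UNIV. (\<eta> \<bullet> bx i)\<^sup>2 * cLam \<eta> (bx i) (Utt l) z)
    = (\<eta> \<bullet> bx l)\<^sup>2 * cLam \<eta> (bx l) (Utt l) z + (\<Sum>i\<in>UNIV - {l}. (\<eta> \<bullet> bx i)\<^sup>2 * cLam \<eta> (bx i) (Utt l) z)" for l \<eta> z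
    by (rule sum.remove) auto
  show ?thesis
    by (rule bnd_cong[OF bnd_diff[OF bnd_diff[OF E1 E2] bnd_cmult[OF E3, of "1/12"]]])
      (simp add: split sum.distrib sum_subtractf distrib_left right_diff_distrib sum_distrib_left)
qed

text \<open>
  Up to the fourth order, \<open>B\<^sub>h \<Lambda>\<^sub>t W\<close> is \<open>(s\<^sub>N + (\<tau>\<^sup>2/12) \<Lambda>\<^sub>t) \<partial>\<^sub>t\<^sup>2 W\<close> and the two terms with \<open>A\<^sub>h\<close> together are
  \<open>-(s\<^sub>N + (\<tau>\<^sup>2/12) \<Lambda>\<^sub>t) \<Sum>\<^sub>l a\<^sub>l\<^sup>2 \<partial>\<^sub>l\<^sup>2 u\<close>. By the differential equation the sum is the operator
  \<open>s\<^sub>N + (\<tau>\<^sup>2/12) \<Lambda>\<^sub>t\<close> applied to \<open>f\<close>, which is the right-hand side of the scheme. The proof never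
  expands the last operator, so all leading terms cancel exactly.
\<close>

theorem truncation_error: "bnd (admissible Basis) 4 (residual bc ac a W U f)"
proof -
  let ?P = "admissible Basis"
  have PQ: "\<And>\<eta> z. ?P \<eta> z \<Longrightarrow> \<eta> \<in> Q" using admissible_Q by blast
  have Px: "\<And>\<eta> z. ?P \<eta> z \<Longrightarrow> admissible (range bx) \<eta> z" by (rule admissible_mono) auto
  have Pb: "\<And>\<eta> z. ?P \<eta> z \<Longrightarrow> admissible {b} \<eta> z" if "b \<in> Basis" for b
    by (rule admissible_mono) (use that in auto)
  have Pbc: "\<And>\<eta> z. ?P \<eta> z \<Longrightarrow> admissible {b, c} \<eta> z" if "b \<in> Basis" "c \<in> Basis" for b c
    by (rule admissible_mono) (use that in auto)
  define A1 where "A1 = (\<lambda>\<eta> z. \<Sum>i\<in>UNIV. (\<eta> \<bullet> bx i)\<^sup>2 * cLam \<eta> (bx i) (cLam \<eta> bt W) z)"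
  define A2 where "A2 = (\<lambda>\<eta> z. \<Sum>i\<in>UNIV. (\<eta> \<bullet> bx i)\<^sup>2 * cLam \<eta> (bx i) (Wt 2) z)"
  define C1 where "C1 = (\<lambda>\<eta> z. \<Sum>l\<in>UNIV. (a $ l)\<^sup>2 * cLam \<eta> (bx l) (cLam \<eta> bt U) z)"
  define C2 where "C2 = (\<lambda>\<eta> z. \<Sum>l\<in>UNIV. (a $ l)\<^sup>2 * cLam \<eta> bt (Utt l) z)"
  define D3 where "D3 = (\<lambda>z. \<Sum>l\<in>UNIV. (a $ l)\<^sup>2 * Utt l z)"
  define D6 where "D6 = (\<lambda>\<eta> z. \<Sum>l\<in>UNIV. (a $ l)\<^sup>2 * (\<Sum>i\<in>UNIV. (\<eta> \<bullet> bx i)\<^sup>2 * cLam \<eta> (bx i) (Utt l) z))"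
  have E1: "bnd ?P 4 (\<lambda>\<eta> z. Bc bc \<eta> (cLam \<eta> bt W) z - (cLam \<eta> bt W z + (1/12) * A1 \<eta> z))"
    unfolding A1_def
    by (rule Bc_expand[OF bnd_LS_cLam[OF W_card(1)] PQ bc])
  have E2: "bnd ?P 4 (\<lambda>\<eta> z. cLam \<eta> bt W z - Wt 2 z - (\<eta> \<bullet> bt)\<^sup>2 / 12 * cLam \<eta> bt (Wt 2) z)"
    by (intro bnd_second_diff_compact' W_le Pb) auto
  have E3: "bnd ?P 4 (\<lambda>\<eta> z. A1 \<eta> z - A2 \<eta> z)"
  proof (rule bnd_cong)
    show "bnd ?P 4 (\<lambda>\<eta> z. \<Sum>i\<in>UNIV. (\<eta> \<bullet> bx i)\<^sup>2 * (cLam \<eta> bt (cLam \<eta> (bx i) W) z - cLam \<eta> (bx i) (Wt 2) z))"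
      by (intro bnd_sum bnd_step_mult'[where j = 2] bnd_second_diff_1 W_le Pbc PQ) auto
  qed (simp add: A1_def A2_def cLam_commute[of _ bt] right_diff_distrib sum_subtractf)
  have E4: "bnd ?P 4 (\<lambda>\<eta> z. (\<eta> \<bullet> bt)\<^sup>2 * (Ac ac a \<eta> (cLam \<eta> bt U) z + C1 \<eta> z))"
  proof (rule bnd_step_mult'[where j = 2])
    have "bnd ?P 0 (\<lambda>\<eta> z. LS \<eta> S (cLam \<eta> bt U) z)" for S
      by (rule bnd_LS_cLam[OF U_card(1)])
    then show "bnd ?P 2 (\<lambda>\<eta> z. Ac ac a \<eta> (cLam \<eta> bt U) z + C1 \<eta> z)"
      unfolding C1_def by (rule Ac_expand_low) (use PQ ac in auto)
  qed (use PQ in auto)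
  have E5: "bnd ?P 4 (\<lambda>\<eta> z. (\<eta> \<bullet> bt)\<^sup>2 * (C1 \<eta> z - C2 \<eta> z))"
  proof (rule bnd_step_mult'[where j = 2])
    show "bnd ?P 2 (\<lambda>\<eta> z. C1 \<eta> z - C2 \<eta> z)"
    proof (rule bnd_cong)
      show "bnd ?P 2 (\<lambda>\<eta> z. \<Sum>l\<in>UNIV. (a $ l)\<^sup>2 * (cLam \<eta> (bx l) (cLam \<eta> bt U) z - cLam \<eta> bt (Utt l) z))"
        by (intro bnd_sum bnd_cmult bnd_second_diff_1 U_le Pbc) auto
    qed (simp add: C1_def C2_def right_diff_distrib sum_subtractf)
  qed (use PQ in auto)
  have E6: "bnd ?P 4 (\<lambda>\<eta> z. Ac ac a \<eta> U z + D3 z + (1/12) * D6 \<eta> z)"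
    unfolding D3_def D6_def by (rule bnd_Ac_U[OF Px])
  have "bnd ?P 4 (\<lambda>\<eta> z.
      (Bc bc \<eta> (cLam \<eta> bt W) z - (cLam \<eta> bt W z + (1/12) * A1 \<eta> z))
      + (cLam \<eta> bt W z - Wt 2 z - (\<eta> \<bullet> bt)\<^sup>2 / 12 * cLam \<eta> bt (Wt 2) z)
      + (1/12) * (A1 \<eta> z - A2 \<eta> z)
      + (1/12) * ((\<eta> \<bullet> bt)\<^sup>2 * (Ac ac a \<eta> (cLam \<eta> bt U) z + C1 \<eta> z))
      + (-1/12) * ((\<eta> \<bullet> bt)\<^sup>2 * (C1 \<eta> z - C2 \<eta> z))
      + (Ac ac a \<eta> U z + D3 z + (1/12) * D6 \<eta> z))" (is "bnd _ _ ?E")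
    by (intro bnd_add bnd_cmult E1 E2 E3 E4 E5 E6)
  then show ?thesis
  proof (rule bnd_cong)
    fix \<eta> z assume P: "?P \<eta> z"
    have zD: "z \<in> D \<eta> {b}" if "b \<in> Basis" for b using Pb[OF that P] by (simp add: admissible_def)
    have "z \<in> Q" using zD[OF bt_Basis] by (simp add: D_def)
    then have fz: "f z = Wt 2 z - D3 z" by (simp add: f D3_def)
    have ft: "cLam \<eta> bt f z = cLam \<eta> bt (Wt 2) z - C2 \<eta> z"
      by (simp add: cLam_f[OF zD] C2_def)
    have fx: "(\<Sum>i\<in>UNIV. (\<eta> \<bullet> bx i)\<^sup>2 * cLam \<eta> (bx i) f z) = A2 \<eta> z - D6 \<eta> z"
      unfolding cLam_f[OF zD[OF bx_Basis]] right_diff_distrib sum_subtractf A2_def D6_def sum_distrib_left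
      by (subst (2) sum.swap) (simp add: mult_ac)
    show "residual bc ac a W U f \<eta> z = ?E \<eta> z"
      unfolding residual_def fz ft fx by (simp add: algebra_simps add_divide_distrib diff_divide_distrib)
  qed
qed

text \<open>
  The forward difference is expanded to the fourth order in \<open>\<tau>\<close>. The weights \<open>1/3\<close> and \<open>1/12\<close> of the
  derivatives of \<open>f\<close> are those for which the coefficients \<open>1/6\<close> and \<open>1/24\<close> of the Taylor formula are
  matched: for the terms with \<open>u\<close> one has \<open>-1/12 - 1/12 + 1/6 = 0\<close> at \<open>\<tau>\<^sup>2\<close>, where the second \<open>1/12\<close> is the
  one in \<open>u\<^sub>1\<^sub>N\<close>, and \<open>-1/24 + 1/24 = 0\<close> at \<open>\<tau>\<^sup>3\<close>.
\<close>

theorem initial_truncation_error: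
  "bnd (\<lambda>\<eta> z. admissible (range bx) \<eta> z \<and> z + (\<eta> \<bullet> bt) *\<^sub>R bt \<in> Q) 4 (initial_residual bc ac a W U f)"
  (is "bnd ?P 4 _")
proof -
  have PQ: "\<And>\<eta> z. ?P \<eta> z \<Longrightarrow> \<eta> \<in> Q" using admissible_Q by blast
  have Px: "\<And>\<eta> z. ?P \<eta> z \<Longrightarrow> admissible (range bx) \<eta> z" by blast
  have Pb: "\<And>\<eta> z. ?P \<eta> z \<Longrightarrow> admissible {bx i} \<eta> z" for i
    by (rule admissible_mono[OF Px]) auto
  have U12: "Ck_on 6 Q (Ut 1)" "Ck_on 6 Q (Ut 2)"
    by (rule Ck_on_pd_iterate[OF U_le bt_Basis], simp)+
  define A1 where "A1 = (\<lambda>\<eta> z. \<Sum>i\<in>UNIV. (\<eta> \<bullet> bx i)\<^sup>2 * cLam \<eta> (bx i) (fD \<eta> bt W) z)"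
  define A2 where "A2 = (\<lambda>\<eta> z. \<Sum>i\<in>UNIV. (\<eta> \<bullet> bx i)\<^sup>2 * cLam \<eta> (bx i) (Wt 1) z)"
  define A3 where "A3 = (\<lambda>\<eta> z. \<Sum>i\<in>UNIV. (\<eta> \<bullet> bx i)\<^sup>2 * cLam \<eta> (bx i) (Wt 2) z)"
  define C1 where "C1 = (\<lambda>\<eta> z. \<Sum>l\<in>UNIV. (a $ l)\<^sup>2 * cLam \<eta> (bx l) (fD \<eta> bt U) z)"
  define C2 where "C2 = (\<lambda>\<eta> z. \<Sum>l\<in>UNIV. (a $ l)\<^sup>2 * cLam \<eta> (bx l) (Ut 1) z)"
  define C3 where "C3 = (\<lambda>\<eta> z. \<Sum>l\<in>UNIV. (a $ l)\<^sup>2 * cLam \<eta> (bx l) (Ut 2) z)"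
  define C4 where "C4 = (\<lambda>z. \<Sum>l\<in>UNIV. (a $ l)\<^sup>2 * (pd Q (bx l) ^^ 2) (Ut 1) z)"
  define C5 where "C5 = (\<lambda>z. \<Sum>l\<in>UNIV. (a $ l)\<^sup>2 * (pd Q (bx l) ^^ 2) (Ut 2) z)"
  define D3 where "D3 = (\<lambda>z. \<Sum>l\<in>UNIV. (a $ l)\<^sup>2 * Utt l z)"
  define D6 where "D6 = (\<lambda>\<eta> z. \<Sum>l\<in>UNIV. (a $ l)\<^sup>2 * (\<Sum>i\<in>UNIV. (\<eta> \<bullet> bx i)\<^sup>2 * cLam \<eta> (bx i) (Utt l) z))"
  have mixed: "bnd ?P 2 (\<lambda>\<eta> z. cLam \<eta> (bx i) (fD \<eta> bt F) z - (cLam \<eta> (bx i) ((pd Q bt ^^ 1) F) z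
      + (\<eta> \<bullet> bt) / 2 * cLam \<eta> (bx i) ((pd Q bt ^^ 2) F) z))" if "Ck_on 5 Q F" for i F
  proof (rule bnd_subdom[where P = "\<lambda>\<eta> z. admissible (set [bx i]) \<eta> z \<and> z + (\<eta> \<bullet> bt) *\<^sub>R bt \<in> Q"], rule bnd_cong)
    show "bnd (\<lambda>\<eta> z. admissible (set [bx i]) \<eta> z \<and> z + (\<eta> \<bullet> bt) *\<^sub>R bt \<in> Q) 2
      (\<lambda>\<eta> z. fD \<eta> bt (cLams \<eta> [bx i] F) z
        - (\<Sum>j<2. cLams \<eta> [bx i] ((pd Q bt ^^ Suc j) F) z * (\<eta> \<bullet> bt) ^ j / fact (Suc j)))"
      by (rule bnd_forward_diff) (use that in auto)
  qed (use Pb in \<open>auto simp: cLam_fD numeral_2_eq_2\<close>)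
  have E1: "bnd ?P 4 (\<lambda>\<eta> z. Bc bc \<eta> (fD \<eta> bt W) z - (fD \<eta> bt W z + (1/12) * A1 \<eta> z))"
    unfolding A1_def
    by (rule Bc_expand[OF bnd_LS_fD[OF W_card(2)] PQ bc])
  have E2: "bnd ?P 4 (\<lambda>\<eta> z. fD \<eta> bt W z - (Wt 1 z + (\<eta> \<bullet> bt) / 2 * Wt 2 z + (\<eta> \<bullet> bt)^2 / 6 * Wt 3 z + (\<eta> \<bullet> bt)^3 / 24 * Wt 4 z))"
  proof (rule bnd_subdom[where P = "\<lambda>\<eta> z. admissible (set []) \<eta> z \<and> z + (\<eta> \<bullet> bt) *\<^sub>R bt \<in> Q"], rule bnd_cong)
    show "bnd (\<lambda>\<eta> z. admissible (set []) \<eta> z \<and> z + (\<eta> \<bullet> bt) *\<^sub>R bt \<in> Q) 4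
      (\<lambda>\<eta> z. fD \<eta> bt (cLams \<eta> [] W) z
        - (\<Sum>j<4. cLams \<eta> [] ((pd Q bt ^^ Suc j) W) z * (\<eta> \<bullet> bt) ^ j / fact (Suc j)))"
      by (rule bnd_forward_diff) (use W_le in auto)
  qed (auto simp: eval_nat_numeral mult_ac intro: admissible_mono)
  have E3: "bnd ?P 4 (\<lambda>\<eta> z. A1 \<eta> z - (A2 \<eta> z + (\<eta> \<bullet> bt) / 2 * A3 \<eta> z))"
  proof (rule bnd_cong)
    show "bnd ?P 4 (\<lambda>\<eta> z. \<Sum>i\<in>UNIV. (\<eta> \<bullet> bx i)\<^sup>2 * (cLam \<eta> (bx i) (fD \<eta> bt W) z - (cLam \<eta> (bx i) (Wt 1) z
      + (\<eta> \<bullet> bt) / 2 * cLam \<eta> (bx i) (Wt 2) z)))"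
      by (intro bnd_sum bnd_step_mult'[where j = 2] mixed W_le PQ) auto
  qed (simp only: A1_def A2_def A3_def right_diff_distrib distrib_left sum_subtractf sum.distrib sum_distrib_left mult.left_commute)
  have E4: "bnd ?P 4 (\<lambda>\<eta> z. (\<eta> \<bullet> bt)\<^sup>2 * (Ac ac a \<eta> (fD \<eta> bt U) z + C1 \<eta> z))"
  proof (rule bnd_step_mult'[where j = 2])
    have "bnd ?P 0 (\<lambda>\<eta> z. LS \<eta> S (fD \<eta> bt U) z)" for S
      by (rule bnd_LS_fD[OF U_card(2)])
    then show "bnd ?P 2 (\<lambda>\<eta> z. Ac ac a \<eta> (fD \<eta> bt U) z + C1 \<eta> z)"
      unfolding C1_def by (rule Ac_expand_low) (use PQ ac in auto)
  qed (use PQ in auto)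
  have E5: "bnd ?P 4 (\<lambda>\<eta> z. (\<eta> \<bullet> bt)\<^sup>2 * (C1 \<eta> z - (C2 \<eta> z + (\<eta> \<bullet> bt) / 2 * C3 \<eta> z)))"
  proof (rule bnd_step_mult'[where j = 2])
    show "bnd ?P 2 (\<lambda>\<eta> z. C1 \<eta> z - (C2 \<eta> z + (\<eta> \<bullet> bt) / 2 * C3 \<eta> z))"
    proof (rule bnd_cong)
      show "bnd ?P 2 (\<lambda>\<eta> z. \<Sum>i\<in>UNIV. (a $ i)\<^sup>2 * (cLam \<eta> (bx i) (fD \<eta> bt U) z - (cLam \<eta> (bx i) (Ut 1) z
        + (\<eta> \<bullet> bt) / 2 * cLam \<eta> (bx i) (Ut 2) z)))"
        by (intro bnd_sum bnd_cmult mixed U_le) auto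
    qed (simp only: C1_def C2_def C3_def right_diff_distrib distrib_left sum_subtractf sum.distrib sum_distrib_left mult.left_commute)
  qed (use PQ in auto)
  have C24: "bnd ?P 2 (\<lambda>\<eta> z. C2 \<eta> z - C4 z)"
  proof (rule bnd_cong)
    show "bnd ?P 2 (\<lambda>\<eta> z. \<Sum>l\<in>UNIV. (a $ l)\<^sup>2 * (cLam \<eta> (bx l) (Ut 1) z - (pd Q (bx l) ^^ 2) (Ut 1) z))"
      by (intro bnd_sum bnd_cmult bnd_second_diff_0 bx_Basis Pb Ck_on_mono[OF U12(1)]) auto
  qed (simp only: C2_def C4_def right_diff_distrib sum_subtractf)
  have C35: "bnd ?P 2 (\<lambda>\<eta> z. C3 \<eta> z - C5 z)"
  proof (rule bnd_cong)
    show "bnd ?P 2 (\<lambda>\<eta> z. \<Sum>l\<in>UNIV. (a $ l)\<^sup>2 * (cLam \<eta> (bx l) (Ut 2) z - (pd Q (bx l) ^^ 2) (Ut 2) z))"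
      by (intro bnd_sum bnd_cmult bnd_second_diff_0 bx_Basis Pb Ck_on_mono[OF U12(2)]) auto
  qed (simp only: C3_def C5_def right_diff_distrib sum_subtractf)
  have E6: "bnd ?P 4 (\<lambda>\<eta> z. (\<eta> \<bullet> bt)^2 * (C2 \<eta> z - C4 z))"
    by (rule bnd_step_mult'[OF C24]) (use PQ in auto)
  have E7: "bnd ?P 4 (\<lambda>\<eta> z. (\<eta> \<bullet> bt)^3 * (C3 \<eta> z - C5 z))"
    by (rule bnd_step_mult'[OF C35]) (use PQ in auto)
  have E8: "bnd ?P 4 (\<lambda>\<eta> z. (\<eta> \<bullet> bt)^1 * (Ac ac a \<eta> U z + D3 z + (1/12) * D6 \<eta> z))"
    unfolding D3_def D6_def by (rule bnd_step_mult'[OF bnd_Ac_U[OF Px]]) (use PQ in auto)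
  have "bnd ?P 4 (\<lambda>\<eta> z.
      (Bc bc \<eta> (fD \<eta> bt W) z - (fD \<eta> bt W z + (1/12) * A1 \<eta> z))
      + (fD \<eta> bt W z - (Wt 1 z + (\<eta> \<bullet> bt) / 2 * Wt 2 z + (\<eta> \<bullet> bt)^2 / 6 * Wt 3 z + (\<eta> \<bullet> bt)^3 / 24 * Wt 4 z))
      + (1/12) * (A1 \<eta> z - (A2 \<eta> z + (\<eta> \<bullet> bt) / 2 * A3 \<eta> z))
      + (1/12) * ((\<eta> \<bullet> bt)\<^sup>2 * (Ac ac a \<eta> (fD \<eta> bt U) z + C1 \<eta> z))
      + (-1/12) * ((\<eta> \<bullet> bt)\<^sup>2 * (C1 \<eta> z - (C2 \<eta> z + (\<eta> \<bullet> bt) / 2 * C3 \<eta> z)))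
      + (-1/6) * ((\<eta> \<bullet> bt)^2 * (C2 \<eta> z - C4 z))
      + (-1/24) * ((\<eta> \<bullet> bt)^3 * (C3 \<eta> z - C5 z))
      + (1/2) * ((\<eta> \<bullet> bt)^1 * (Ac ac a \<eta> U z + D3 z + (1/12) * D6 \<eta> z)))" (is "bnd _ _ ?E")
    by (intro bnd_add bnd_cmult E1 E2 E3 E4 E5 E6 E7 E8)
  then show ?thesis
  proof (rule bnd_cong)
    fix \<eta> z assume P: "?P \<eta> z"
    have zD: "z \<in> D \<eta> {bx i}" for i using Pb[OF P] by (simp add: admissible_def)
    then have "z \<in> Q" by (simp add: D_def)
    then have fz: "f z = Wt 2 z - D3 z" by (simp add: f D3_def)
    have fx: "(\<Sum>i\<in>UNIV. (\<eta> \<bullet> bx i)\<^sup>2 * cLam \<eta> (bx i) f z) = A3 \<eta> z - D6 \<eta> z"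
      unfolding cLam_f[OF zD] right_diff_distrib sum_subtractf A3_def D6_def sum_distrib_left
      by (subst (2) sum.swap) (simp add: mult_ac)
    have alg: "B + (1/12) * t\<^sup>2 * AU + (1/2) * t * AV - (w1 + (1/12) * x2 + (1/12) * t\<^sup>2 * c2)
        - (1/2) * t * ((w2 - d3) + (1/3) * t * (w3 - c4) + (1/12) * t\<^sup>2 * (w4 - c5) + (1/12) * (x3 - d6))
      = (B - (w + (1/12) * x1)) + (w - (w1 + t / 2 * w2 + t^2 / 6 * w3 + t^3 / 24 * w4))
        + (1/12) * (x1 - (x2 + t / 2 * x3)) + (1/12) * (t\<^sup>2 * (AU + c1))
        + (-1/12) * (t\<^sup>2 * (c1 - (c2 + t / 2 * c3))) + (-1/6) * (t^2 * (c2 - c4)) + (-1/24) * (t^3 * (c3 - c5))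
        + (1/2) * (t^1 * (AV + d3 + (1/12) * d6))"
      for B t AU AV w1 x2 c2 w2 d3 w3 c4 w4 c5 x3 d6 w x1 c1 c3 :: real
      by algebra
    show "initial_residual bc ac a W U f \<eta> z = ?E \<eta> z"
      unfolding initial_residual_def fz fx A2_def C2_def C4_def C5_def by (rule alg)
  qed
qed

end

section \<open>The solution of the initial-boundary value problem\<close>

text \<open>
  The order \<open>2 n + 8\<close> of smoothness is what the truncation errors consume.
\<close>

locale solution =
  fixes X :: "real^'n::finite" and T :: real and a :: "real^'n" and \<rho> :: "real^'n \<Rightarrow> real"
    and f g :: "real^'n \<Rightarrow> real \<Rightarrow> real" and u\<^sub>0 u\<^sub>1 :: "real^'n \<Rightarrow> real" and u :: "real^'n \<Rightarrow> real \<Rightarrow> real"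
  assumes X: "\<And>i. 0 < X $ i" and T: "0 < T"
    and ibvp: "solves_ibvp X T a \<rho> f g u\<^sub>0 u\<^sub>1 u" and data: "data_continuous X T f g u\<^sub>0 u\<^sub>1"
    and \<rho>_smooth: "Ck_on (2 * CARD('n) + 8) (cbox 0 X) \<rho>"
    and u_smooth: "Ck_on (2 * CARD('n) + 8) (cbox 0 X \<times> {0..T}) (\<lambda>(x, t). u x t)"
begin

definition Q :: "((real^'n) \<times> real) set" where "Q = cbox 0 X \<times> {0..T}"
definition U :: "(real^'n) \<times> real \<Rightarrow> real" where "U z = u (fst z) (snd z)"
definition W :: "(real^'n) \<times> real \<Rightarrow> real" where "W z = \<rho> (fst z) * U z"

sublocale cylinder Q X T
proof
  show "Q = cbox 0 (X, T)"
    unfolding Q_def zero_prod_def cbox_Pair_eq by (simp only: cbox_interval)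
  show "0 < (X, T) \<bullet> b" if "b \<in> Basis" for b
    using that X T by (auto simp: Basis_cyl bx_def bt_def inner_axis)
qed

lemma U_smooth: "Ck_on (2 * CARD('n) + 8) Q U"
  using u_smooth by (simp add: Q_def U_def[abs_def] case_prod_beta')

lemma W_smooth: "Ck_on (2 * CARD('n) + 8) Q W"
  unfolding W_def[abs_def] by (rule Ck_on_mult[OF _ U_smooth]) (simp add: Q_def Ck_on_fst[OF \<rho>_smooth])

lemma U_le: "k \<le> 2 * CARD('n) + 8 \<Longrightarrow> Ck_on k Q U"
  by (rule Ck_on_mono[OF U_smooth])

lemma W_le: "k \<le> 2 * CARD('n) + 8 \<Longrightarrow> Ck_on k Q W"
  by (rule Ck_on_mono[OF W_smooth])

lemma dtime_line:
  assumes ld: "line_deriv Q bt F F'" and x: "x \<in> cbox 0 X" and t: "t \<in> {0..T}"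
    and \<phi>: "\<And>s. s \<in> {0..T} \<Longrightarrow> \<phi> s = F (x, s)"
  shows "dtime T \<phi> t = F' (x, t)"
proof -
  have z: "(x, 0) + s *\<^sub>R bt = (x, s)" for s by (simp add: bt_def)
  have "slice Q bt (x, 0) = {0..T}" using x by (auto simp: slice_def z Q_def)
  then have "((\<lambda>s. F (x, s)) has_real_derivative F' (x, t)) (at t within {0..T})"
    using line_deriv_at[OF ld, of "(x, 0)" t] x t by (simp add: z Q_def)
  then have "(\<phi> has_vector_derivative F' (x, t)) (at t within {0..T})"
    unfolding has_real_derivative_iff_has_vector_derivative
    by (rule has_vector_derivative_transform[OF t, rotated]) (simp add: \<phi>)
  then show ?thesis
    unfolding dtime_def using T t by (intro vector_derivative_within_closed_interval) auto
qed

lemma dtime2_line: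
  assumes "line_deriv Q bt F F'" "line_deriv Q bt F' F''" "x \<in> cbox 0 X" "t \<in> {0..T}"
    and "\<And>s. s \<in> {0..T} \<Longrightarrow> \<phi> s = F (x, s)"
  shows "(dtime T ^^ 2) \<phi> t = F'' (x, t)"
proof -
  have "dtime T \<phi> s = F' (x, s)" if "s \<in> {0..T}" for s
    by (rule dtime_line[OF assms(1,3) that assms(5)])
  from dtime_line[OF assms(2-4) this] show ?thesis by (simp add: numeral_2_eq_2)
qed

lemma dspace2_line:
  assumes ld: "line_deriv Q (bx i) F F'" "line_deriv Q (bx i) F' F''" and x: "x \<in> box 0 X" and t: "t \<in> {0..T}"
  shows "dspace2 i (\<lambda>y. F (y, t)) x = F'' (x, t)"
proof -
  let ?I = "{- (x $ i) <..< X $ i - x $ i}"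
  have xX: "0 < x $ j \<and> x $ j < X $ j" for j using x by (simp add: mem_box_cart)
  have z: "(x, t) + s *\<^sub>R bx i = (x + s *\<^sub>R axis i 1, t)" for s by (simp add: bx_def)
  have "(x, t) \<in> Q" using x t box_subset_cbox by (auto simp: Q_def)
  from slice_Q[OF this bx_Basis, of i]
  have sl: "slice Q (bx i) (x, t) = {- (x $ i) .. X $ i - x $ i}"
    by (simp add: bx_def inner_axis)
  have D: "((\<lambda>s. H (x + s *\<^sub>R axis i 1, t)) has_real_derivative H' (x + s *\<^sub>R axis i 1, t)) (at s)"
    if "line_deriv Q (bx i) H H'" "s \<in> ?I" for H H' s
  proof -
    have "s \<in> slice Q (bx i) (x, t)" using that(2) by (simp add: sl)
    then have "(x, t) + s *\<^sub>R bx i \<in> Q" by (simp only: slice_def mem_Collect_eq)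
    from line_deriv_at[OF that(1) this] have "((\<lambda>s. H (x + s *\<^sub>R axis i 1, t)) has_real_derivative
        H' (x + s *\<^sub>R axis i 1, t)) (at s within {- (x $ i) .. X $ i - x $ i})"
      by (simp only: z sl)
    moreover have "at s within {- (x $ i) .. X $ i - x $ i} = at s"
      by (rule at_within_interior) (use that(2) in simp)
    ultimately show ?thesis by simp
  qed
  have "((deriv (\<lambda>s. F (x + s *\<^sub>R axis i 1, t))) has_real_derivative F'' (x + 0 *\<^sub>R axis i 1, t)) (at 0)"
  proof (rule has_field_derivative_transform_within_open)
    show "((\<lambda>s. F' (x + s *\<^sub>R axis i 1, t)) has_real_derivative F'' (x + 0 *\<^sub>R axis i 1, t)) (at 0)"
      by (rule D[OF ld(2)]) (use xX[of i] in simp)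
    show "F' (x + s *\<^sub>R axis i 1, t) = deriv (\<lambda>s. F (x + s *\<^sub>R axis i 1, t)) s" if "s \<in> ?I" for s
      using DERIV_imp_deriv[OF D[OF ld(1) that]] by simp
  qed (use xX[of i] in auto)
  from DERIV_imp_deriv[OF this] show ?thesis by (simp add: dspace2_def numeral_2_eq_2)
qed

lemma W_time: "k \<le> 8 \<Longrightarrow> z \<in> Q \<Longrightarrow> (pd Q bt ^^ k) W z = \<rho> (fst z) * (pd Q bt ^^ k) U z"
proof (induction k arbitrary: z)
  case 0
  then show ?case by (simp add: W_def)
next
  case (Suc k)
  have "pd Q bt ((pd Q bt ^^ k) W) z = pd Q bt (\<lambda>z. \<rho> (fst z) * (pd Q bt ^^ k) U z) z"
    by (rule pd_cong) (use Suc in auto)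
  also have "\<dots> = \<rho> (fst z) * (pd Q bt ^^ Suc k) U z"
  proof (rule pd_unique)
    have "line_deriv Q bt ((pd Q bt ^^ k) U) ((pd Q bt ^^ Suc k) U)"
      by (rule pd_iterate_line_deriv[OF U_le bt_Basis]) (use Suc in simp)
    then show "line_deriv Q bt (\<lambda>z. \<rho> (fst z) * (pd Q bt ^^ k) U z) (\<lambda>z. \<rho> (fst z) * (pd Q bt ^^ Suc k) U z)"
      unfolding line_deriv_def fst_add fst_scaleR by (simp only: bt_def fst_conv scaleR_zero_right add_0_right) (auto intro!: DERIV_cmult)
  qed (use Suc in auto)
  finally show ?case by simp
qed

text \<open>The differential equation extends from the open cylinder to its closure by continuity.\<close>

lemma f_eq:
  assumes "z \<in> Q"
  shows "f (fst z) (snd z) = (pd Q bt ^^ 2) W z - (\<Sum>l\<in>UNIV. (a $ l)\<^sup>2 * (pd Q (bx l) ^^ 2) U z)"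
proof -
  let ?H = "\<lambda>z. f (fst z) (snd z) - ((pd Q bt ^^ 2) W z - (\<Sum>l\<in>UNIV. (a $ l)\<^sup>2 * (pd Q (bx l) ^^ 2) U z))"
  let ?S = "box 0 X \<times> {0<..<T}"
  have cl: "closure ?S = Q"
    using X T by (simp add: Q_def closure_Times closure_box interval_ne_empty_cart)
  have "?H z = 0"
  proof (rule continuous_constant_on_closure[of ?S ?H])
    have c: "continuous_on Q ((pd Q b ^^ 2) F)" if "Ck_on 2 Q F" "b \<in> Basis" for F b
      using Ck_on_imp_continuous_on[OF Ck_on_pd_iterate[of 2 0 F b]] that by simp
    have "continuous_on Q (\<lambda>z. f (fst z) (snd z))"
      using data by (simp add: data_continuous_def Q_def case_prod_beta')
    then show "continuous_on (closure ?S) ?H"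
      unfolding cl by (intro continuous_intros c U_le W_le) auto
    show "?H z = 0" if z: "z \<in> ?S" for z
    proof -
      obtain x t where zz: "z = (x, t)" "x \<in> box 0 X" "t \<in> {0<..<T}" using z by auto
      then have xt: "x \<in> cbox 0 X" "t \<in> {0..T}" "z \<in> Q" using box_subset_cbox by (auto simp: Q_def)
      have u: "(\<lambda>y. u y t) = (\<lambda>y. U (y, t))" by (simp add: U_def)
      have ld: "line_deriv Q b U (pd Q b U)" "line_deriv Q b (pd Q b U) ((pd Q b ^^ 2) U)" if "b \<in> Basis" for b
      proof -
        have "Ck_on (Suc (Suc 0)) Q U" by (rule U_le) simp
        note ck = Ck_on_line_deriv[OF this that]
        show "line_deriv Q b U (pd Q b U)" by (rule ck)
        show "line_deriv Q b (pd Q b U) ((pd Q b ^^ 2) U)"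
          using Ck_on_line_deriv(1)[OF ck(2) that] by (simp add: numeral_2_eq_2)
      qed
      have "(dtime T ^^ 2) (u x) t = (pd Q bt ^^ 2) U (x, t)"
        by (rule dtime2_line[OF ld xt(1,2)]) (simp_all add: U_def)
      moreover have "dspace2 i (\<lambda>y. u y t) x = (pd Q (bx i) ^^ 2) U (x, t)" for i
        unfolding u by (rule dspace2_line[OF ld zz(2) xt(2)]) simp_all
      ultimately show ?thesis
      proof -
        assume t2: "(dtime T ^^ 2) (u x) t = (pd Q bt ^^ 2) U (x, t)"
          and x2: "\<And>i. dspace2 i (\<lambda>y. u y t) x = (pd Q (bx i) ^^ 2) U (x, t)"
        have "\<rho> x * (dtime T ^^ 2) (u x) t - (\<Sum>i\<in>UNIV. (a $ i)\<^sup>2 * dspace2 i (\<lambda>y. u y t) x) = f x t"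
          using ibvp zz(2,3) unfolding solves_ibvp_def by blast
        then have "f x t = \<rho> x * (pd Q bt ^^ 2) U (x, t) - (\<Sum>i\<in>UNIV. (a $ i)\<^sup>2 * (pd Q (bx i) ^^ 2) U (x, t))"
          by (simp only: t2 x2)
        then show ?thesis using W_time[of 2 z] xt(3) by (simp add: zz(1))
      qed
    qed
  qed (use assms cl in auto)
  then show ?thesis by simp
qed

lemma u0_eq: "x \<in> cbox 0 X \<Longrightarrow> u x 0 = u\<^sub>0 x"
proof -
  assume x: "x \<in> cbox 0 X"
  have ne: "box 0 X \<noteq> {}" using X by (simp add: interval_ne_empty_cart)
  have "u x 0 - u\<^sub>0 x = 0"
  proof (rule continuous_constant_on_closure[of "box 0 X" "\<lambda>x. u x 0 - u\<^sub>0 x"])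
    have "continuous_on (cbox 0 X) (\<lambda>x. U (x, 0))"
      by (rule continuous_on_compose2[OF Ck_on_imp_continuous_on[OF U_smooth]])
        (use T in \<open>auto intro!: continuous_intros simp: Q_def\<close>)
    then show "continuous_on (closure (box 0 X)) (\<lambda>x. u x 0 - u\<^sub>0 x)"
      using data ne by (auto simp: closure_box U_def data_continuous_def intro!: continuous_intros)
  qed (use ibvp x ne in \<open>auto simp: solves_ibvp_def closure_box\<close>)
  then show ?thesis by simp
qed

lemma u1_eq: "x \<in> cbox 0 X \<Longrightarrow> u\<^sub>1 x = pd Q bt U (x, 0)"
proof -
  assume x: "x \<in> cbox 0 X"
  have ne: "box 0 X \<noteq> {}" using X by (simp add: interval_ne_empty_cart)
  have ld: "line_deriv Q bt U (pd Q bt U)" "Ck_on 0 Q (pd Q bt U)"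
    using Ck_on_line_deriv[OF U_le[of "Suc 0"] bt_Basis] by simp_all
  have "pd Q bt U (x, 0) - u\<^sub>1 x = 0"
  proof (rule continuous_constant_on_closure[of "box 0 X" "\<lambda>x. pd Q bt U (x, 0) - u\<^sub>1 x"])
    have "continuous_on (cbox 0 X) (\<lambda>x. pd Q bt U (x, 0))"
      by (rule continuous_on_compose2[OF Ck_on_imp_continuous_on[OF ld(2)]])
        (use T in \<open>auto intro!: continuous_intros simp: Q_def\<close>)
    then show "continuous_on (closure (box 0 X)) (\<lambda>x. pd Q bt U (x, 0) - u\<^sub>1 x)"
      using data ne by (auto simp: closure_box data_continuous_def intro!: continuous_intros)
    show "pd Q bt U (x, 0) - u\<^sub>1 x = 0" if "x \<in> box 0 X" for x
    proof -
      have "dtime T (u x) 0 = pd Q bt U (x, 0)"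
        by (rule dtime_line[OF ld(1)]) (use that T box_subset_cbox in \<open>auto simp: U_def\<close>)
      then show ?thesis using ibvp that by (simp add: solves_ibvp_def)
    qed
  qed (use x ne in \<open>auto simp: closure_box\<close>)
  then show ?thesis by simp
qed

text \<open>
  The final time \<open>t = T\<close>, where the boundary condition is not part of the problem but the scheme
  samples \<open>g\<close>, is reached by continuity.
\<close>

lemma g_eq:
  assumes x: "x \<in> frontier (box 0 X)" and t: "0 < t" "t \<le> T"
  shows "u x t = g x t"
proof -
  have ne: "box 0 X \<noteq> {}" using X by (simp add: interval_ne_empty_cart)
  have xc: "x \<in> cbox 0 X" using x ne by (simp add: frontier_def closure_box)
  have "u x t - g x t = 0"
  proof (rule continuous_constant_on_closure[of "{0<..<T}" "\<lambda>t. u x t - g x t"])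
    have "continuous_on {0..T} (\<lambda>t. U (x, t))"
      by (rule continuous_on_compose2[OF Ck_on_imp_continuous_on[OF U_smooth]])
        (use xc in \<open>auto intro!: continuous_intros simp: Q_def\<close>)
    moreover have "continuous_on {0..T} (\<lambda>t. case (x, t) of (x, t) \<Rightarrow> g x t)"
      by (rule continuous_on_compose2[of "frontier (box 0 X) \<times> {0..T}" "\<lambda>(x, t). g x t"])
        (use data x in \<open>auto intro!: continuous_intros simp: data_continuous_def\<close>)
    ultimately show "continuous_on (closure {0<..<T}) (\<lambda>t. u x t - g x t)"
      using T by (auto simp: U_def intro!: continuous_intros)
  qed (use ibvp x t T in \<open>auto simp: solves_ibvp_def\<close>)
  then show ?thesis by simp
qed

text \<open>
  Here the derivatives in time and in space are interchanged.
\<close>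

lemma f_time:
  assumes x: "x \<in> cbox 0 X"
  shows "dtime T (f x) 0 = (pd Q bt ^^ 3) W (x, 0) - (\<Sum>l\<in>UNIV. (a $ l)\<^sup>2 * (pd Q (bx l) ^^ 2) ((pd Q bt ^^ 1) U) (x, 0))"
    and "(dtime T ^^ 2) (f x) 0 = (pd Q bt ^^ 4) W (x, 0) - (\<Sum>l\<in>UNIV. (a $ l)\<^sup>2 * (pd Q (bx l) ^^ 2) ((pd Q bt ^^ 2) U) (x, 0))"
proof -
  define G where "G k j = (\<lambda>z. (pd Q bt ^^ k) W z - (\<Sum>l\<in>UNIV. (a $ l)\<^sup>2 * (pd Q (bx l) ^^ 2) ((pd Q bt ^^ j) U) z))" for k j
  have ld: "line_deriv Q bt (G k j) (G (Suc k) (Suc j))"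
    if "k \<le> 3" "j \<le> 1" for k j
  proof -
    have W: "line_deriv Q bt ((pd Q bt ^^ k) W) ((pd Q bt ^^ Suc k) W)"
      by (rule pd_iterate_line_deriv[OF W_le bt_Basis]) (use that in simp)
    have Uj: "Ck_on 3 Q ((pd Q bt ^^ j) U)"
      by (rule Ck_on_pd_iterate[OF U_le bt_Basis]) (use that in simp)
    have "line_deriv Q bt ((pd Q (bx l) ^^ 2) ((pd Q bt ^^ j) U)) (pd Q bt ((pd Q (bx l) ^^ 2) ((pd Q bt ^^ j) U)))" for l
      by (rule Ck_on_line_deriv(1)[OF Ck_on_pd_iterate[OF Ck_on_mono[OF Uj] bx_Basis] bt_Basis]) simp
    then have U2: "line_deriv Q bt ((pd Q (bx l) ^^ 2) ((pd Q bt ^^ j) U)) ((pd Q (bx l) ^^ 2) ((pd Q bt ^^ Suc j) U))" for l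
      using pd2_pd_commute[OF Uj bx_Basis bt_Basis] by (simp add: line_deriv_def)
    show ?thesis
      unfolding line_deriv_def
    proof
      fix z assume z: "z \<in> Q"
      show "((\<lambda>s. G k j (z + s *\<^sub>R bt)) has_real_derivative G (Suc k) (Suc j) z) (at 0 within slice Q bt z)"
        unfolding G_def
      proof (intro DERIV_diff DERIV_sum DERIV_cmult)
        show "((\<lambda>s. (pd Q bt ^^ k) W (z + s *\<^sub>R bt)) has_real_derivative (pd Q bt ^^ Suc k) W z) (at 0 within slice Q bt z)"
          using W z unfolding line_deriv_def by (rule bspec)
        show "((\<lambda>s. (pd Q (bx l) ^^ 2) ((pd Q bt ^^ j) U) (z + s *\<^sub>R bt)) has_real_derivative
            (pd Q (bx l) ^^ 2) ((pd Q bt ^^ Suc j) U) z) (at 0 within slice Q bt z)" for l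
          using U2[of l] z unfolding line_deriv_def by (rule bspec)
      qed
    qed
  qed
  have eq: "f x s = G 2 0 (x, s)" if "s \<in> {0..T}" for s
    using f_eq[of "(x, s)"] x that by (simp add: Q_def G_def)
  have ld': "line_deriv Q bt (G 2 0) (G 3 1)" "line_deriv Q bt (G 3 1) (G 4 2)"
    using ld[of 2 0] ld[of 3 1] by (simp_all add: eval_nat_numeral)
  show "dtime T (f x) 0 = (pd Q bt ^^ 3) W (x, 0) - (\<Sum>l\<in>UNIV. (a $ l)\<^sup>2 * (pd Q (bx l) ^^ 2) ((pd Q bt ^^ 1) U) (x, 0))"
    using dtime_line[OF ld'(1) x _ eq, of 0] T by (simp add: G_def)
  show "(dtime T ^^ 2) (f x) 0 = (pd Q bt ^^ 4) W (x, 0) - (\<Sum>l\<in>UNIV. (a $ l)\<^sup>2 * (pd Q (bx l) ^^ 2) ((pd Q bt ^^ 2) U) (x, 0))"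
    using dtime2_line[OF ld' x _ eq, of 0] T by (simp add: G_def)
qed

end

section \<open>Difference operators on mesh functions\<close>

definition pLam :: "real^'n::finite \<Rightarrow> nat^'n \<Rightarrow> 'n \<Rightarrow> 'n mesh_fun \<Rightarrow> 'n mesh_fun" where
  "pLam h N i w = zext (inner_nodes N) (Lam h i (zext (inner_nodes N) w))"

lemma finite_inner_nodes: "finite (inner_nodes (N :: nat^'n::finite))"
  and card_inner_nodes: "card (inner_nodes N) \<le> (\<Prod>i\<in>UNIV. N $ i)"
proof -
  let ?F = "\<Pi>\<^sub>E i\<in>(UNIV :: 'n set). {1..int (N $ i) - 1}"
  have sub: "inner_nodes N \<subseteq> vec_lambda ` ?F"
  proof
    fix k assume "k \<in> inner_nodes N"
    then have "($) k \<in> ?F" by (auto simp: inner_nodes_def)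
    then show "k \<in> vec_lambda ` ?F" by (intro image_eqI[of _ _ "($) k"]) (simp_all add: vec_eq_iff)
  qed
  have fin: "finite ?F" by (rule finite_PiE) auto
  show "finite (inner_nodes N)" using sub fin by (meson finite_imageI finite_subset)
  have "card (inner_nodes N) \<le> card (vec_lambda ` ?F)" by (rule card_mono) (use sub fin in auto)
  also have "\<dots> \<le> card ?F" by (rule card_image_le[OF fin])
  also have "\<dots> = (\<Prod>i\<in>UNIV. card {1..int (N $ i) - 1})" by (rule card_PiE) simp
  also have "\<dots> \<le> (\<Prod>i\<in>UNIV. N $ i)" by (rule prod_mono) auto
  finally show "card (inner_nodes N) \<le> (\<Prod>i\<in>UNIV. N $ i)" .
qed

lemma axis_nth [simp]: "axis i (1::int) $ j = (if j = i then 1 else 0)"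
  by (simp add: axis_def)

lemma Lam_lin: "Lam h i (\<lambda>k. v k + c * w k) = (\<lambda>k. Lam h i v k + c * Lam h i w k)"
  by (rule Lam_add)

lemma Lam_prod_lin: "Lam_prod h S (\<lambda>k. v k + c * w k) = (\<lambda>k. Lam_prod h S v k + c * Lam_prod h S w k)"
proof (induction S rule: infinite_finite_induct)
  case (infinite A)
  then show ?case by (simp add: Lam_prod_def)
next
  case empty
  then show ?case by (simp add: Lam_prod_empty)
next
  case (insert i S)
  show ?case
    unfolding Lam_prod_insert[OF insert.hyps(2)] insert.IH by (rule Lam_lin)
qed

lemma Lam_prod_Lam: "Lam_prod h S (Lam h l w) = Lam h l (Lam_prod h S w)"
proof (induction S rule: infinite_finite_induct)
  case (infinite A)
  then show ?case by (simp add: Lam_prod_def)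
next
  case empty
  then show ?case by (simp add: Lam_prod_empty)
next
  case (insert i S)
  show ?case
    unfolding Lam_prod_insert[OF insert.hyps(2)] insert.IH by (rule Lam_commute)
qed

text \<open>Composite differences at inner nodes refer to mesh nodes only.\<close>

lemma Lam_prod_cong:
  assumes "\<And>k. k \<in> nodes N \<Longrightarrow> v k = w k" "k \<in> nodes N" "\<And>i. i \<in> S \<Longrightarrow> 1 \<le> k $ i \<and> k $ i \<le> int (N $ i) - 1"
  shows "Lam_prod h S v k = Lam_prod h S w k"
  using finite[of S] assms(2,3)
proof (induction S arbitrary: k rule: finite_induct)
  case empty
  then show ?case using assms(1) by (simp add: Lam_prod_empty)
next
  case (insert i S)
  have k: "\<And>j. 0 \<le> k $ j \<and> k $ j \<le> int (N $ j)" using insert.prems(1) by (simp add: nodes_def)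
  have "Lam_prod h S v k' = Lam_prod h S w k'" if k': "k' \<in> {k, k + axis i 1, k - axis i 1}" for k'
  proof (rule insert.IH)
    show "k' \<in> nodes N"
      unfolding nodes_def mem_Collect_eq
    proof
      fix j show "0 \<le> k' $ j \<and> k' $ j \<le> int (N $ j)"
        using that k[of j] insert.prems(2)[of i] by auto
    qed
    show "1 \<le> k' $ j \<and> k' $ j \<le> int (N $ j) - 1" if "j \<in> S" for j
    proof -
      have "j \<noteq> i" using that insert.hyps by auto
      then show ?thesis using k' insert.prems(2)[of j] that by auto
    qed
  qed
  then show ?case using insert.hyps by (simp add: Lam_prod_insert Lam_def)
qed

lemma inner_subset_nodes: "k \<in> inner_nodes N \<Longrightarrow> k \<in> nodes N"
  unfolding inner_nodes_def nodes_def mem_Collect_eq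
proof
  fix i assume "\<forall>i. 1 \<le> k $ i \<and> k $ i \<le> int (N $ i) - 1"
  from spec[OF this, of i] show "0 \<le> k $ i \<and> k $ i \<le> int (N $ i)" by auto
qed

lemma Lam_prod_cong_inner:
  assumes "\<And>k. k \<in> nodes N \<Longrightarrow> v k = w k" "k \<in> inner_nodes N"
  shows "Lam_prod h S v k = Lam_prod h S w k"
  by (rule Lam_prod_cong[OF assms(1) inner_subset_nodes[OF assms(2)]]) (use assms(2) in \<open>simp_all add: inner_nodes_def\<close>)

text \<open>
  A function of \<open>H\<^sub>h\<close> vanishes on the faces orthogonal to the direction \<open>i\<close>, and differences in other
  directions do not leave these faces.
\<close>

lemma Lam_prod_vanish:
  assumes "\<And>k. k \<notin> inner_nodes N \<Longrightarrow> w k = 0" "i \<notin> S" "\<not> (1 \<le> k $ i \<and> k $ i \<le> int (N $ i) - 1)"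
  shows "Lam_prod h S w k = 0"
  using finite[of S] assms(2,3)
proof (induction S arbitrary: k rule: finite_induct)
  case empty
  then have "k \<notin> inner_nodes N" by (auto simp: inner_nodes_def)
  then show ?case by (simp add: Lam_prod_empty assms(1))
next
  case (insert j S)
  have "Lam_prod h S w k' = 0" if "k' \<in> {k, k + axis j 1, k - axis j 1}" for k'
    by (rule insert.IH) (use that insert.prems in auto)
  then show ?case using insert.hyps by (simp add: Lam_prod_insert Lam_def)
qed

lemma zext_supp: "k \<notin> S \<Longrightarrow> zext S w k = 0"
  by (simp add: zext_def)

lemma zext_zext [simp]: "zext S (zext S w) = zext S w"
  by (auto simp: zext_def)

text \<open>
  For distinct directions, composing differences on extended mesh functions and then restricting
  to inner nodes is the same as composing the operators in \<open>H\<^sub>h\<close>, which restrict after each step.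
  This makes the difference expressions of the schemes elements of a commutative algebra.
\<close>

lemma zext_Lam_prod_insert:
  assumes supp: "\<And>k. k \<notin> inner_nodes N \<Longrightarrow> w k = 0" and "i \<notin> S"
  shows "zext (inner_nodes N) (Lam_prod h (insert i S) w) = pLam h N i (zext (inner_nodes N) (Lam_prod h S w))"
proof
  fix k
  show "zext (inner_nodes N) (Lam_prod h (insert i S) w) k = pLam h N i (zext (inner_nodes N) (Lam_prod h S w)) k"
  proof (cases "k \<in> inner_nodes N")
    case True
    have "zext (inner_nodes N) (Lam_prod h S w) k' = Lam_prod h S w k'"
      if "k' \<in> {k, k + axis i 1, k - axis i 1}" for k'
    proof (cases "k' \<in> inner_nodes N")
      case False
      then obtain j where j: "\<not> (1 \<le> k' $ j \<and> k' $ j \<le> int (N $ j) - 1)" by (auto simp: inner_nodes_def)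
      have "1 \<le> k $ j \<and> k $ j \<le> int (N $ j) - 1" using True by (simp add: inner_nodes_def)
      then have "j = i" using j that by (auto split: if_splits)
      with Lam_prod_vanish[OF supp \<open>i \<notin> S\<close>, where k = k' and h = h] j False show ?thesis by (simp add: zext_def)
    qed (simp add: zext_def)
    then have "Lam h i (zext (inner_nodes N) (Lam_prod h S w)) k = Lam h i (Lam_prod h S w) k"
      by (simp add: Lam_def)
    then show ?thesis using True assms(2) by (simp add: pLam_def Lam_prod_insert) (simp add: zext_def)
  qed (simp add: pLam_def zext_def)
qed

text \<open>
  Summation by parts: the adjoint of a shift is the opposite shift.
\<close>

lemma sum_shift:
  fixes v w :: "(int^'n::finite) \<Rightarrow> real"
  assumes "finite S" "\<And>k. k \<notin> S \<Longrightarrow> v k = 0" "\<And>k. k \<notin> S \<Longrightarrow> w k = 0"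
  shows "(\<Sum>k\<in>S. v (k + e) * w k) = (\<Sum>k\<in>S. v k * w (k - e))"
proof -
  have "(\<Sum>k\<in>S. v (k + e) * w k) = (\<Sum>k\<in>{k\<in>S. k + e \<in> S}. v (k + e) * w k)"
    by (rule sum.mono_neutral_right) (use assms in auto)
  also have "\<dots> = (\<Sum>k\<in>{k\<in>S. k - e \<in> S}. v k * w (k - e))"
    by (rule sum.reindex_bij_witness[of _ "\<lambda>k. k - e" "\<lambda>k. k + e"]) auto
  also have "\<dots> = (\<Sum>k\<in>S. v k * w (k - e))"
    by (rule sum.mono_neutral_left) (use assms in auto)
  finally show ?thesis .
qed

lemma sum_shift_le:
  fixes w :: "(int^'n::finite) \<Rightarrow> real"
  assumes "finite S" "\<And>k. k \<notin> S \<Longrightarrow> w k = 0"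
  shows "(\<Sum>k\<in>S. (w (k + e))\<^sup>2) \<le> (\<Sum>k\<in>S. (w k)\<^sup>2)"
proof -
  have "(\<Sum>k\<in>S. (w (k + e))\<^sup>2) = (\<Sum>k\<in>{k\<in>S. k + e \<in> S}. (w (k + e))\<^sup>2)"
    by (rule sum.mono_neutral_right) (use assms in auto)
  also have "\<dots> = (\<Sum>k\<in>{k\<in>S. k - e \<in> S}. (w k)\<^sup>2)"
    by (rule sum.reindex_bij_witness[of _ "\<lambda>k. k - e" "\<lambda>k. k + e"]) auto
  also have "\<dots> \<le> (\<Sum>k\<in>S. (w k)\<^sup>2)"
    by (rule sum_mono2) (use assms in auto)
  finally show ?thesis .
qed

lemma ip_pLam:
  "ip (inner_nodes N) (pLam h N i v) w = ((\<Sum>k\<in>inner_nodes N. zext (inner_nodes N) v (k + axis i 1) * zext (inner_nodes N) w k)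
    - 2 * (\<Sum>k\<in>inner_nodes N. zext (inner_nodes N) v k * zext (inner_nodes N) w k)
    + (\<Sum>k\<in>inner_nodes N. zext (inner_nodes N) v (k - axis i 1) * zext (inner_nodes N) w k)) / (h $ i)\<^sup>2"
proof -
  let ?S = "inner_nodes N"
  have "ip ?S (pLam h N i v) w = (\<Sum>k\<in>?S. (zext ?S v (k + axis i 1) * zext ?S w k - 2 * (zext ?S v k * zext ?S w k)
      + zext ?S v (k - axis i 1) * zext ?S w k) / (h $ i)\<^sup>2)"
    unfolding ip_def
  proof (rule sum.cong[OF refl])
    fix k assume "k \<in> ?S"
    then have "pLam h N i v k = Lam h i (zext ?S v) k" "w k = zext ?S w k"
      by (simp_all add: pLam_def zext_def)
    then show "pLam h N i v k * w k = (zext ?S v (k + axis i 1) * zext ?S w k - 2 * (zext ?S v k * zext ?S w k)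
      + zext ?S v (k - axis i 1) * zext ?S w k) / (h $ i)\<^sup>2"
      by (simp add: Lam_def algebra_simps)
  qed
  then show ?thesis
    by (simp add: sum_divide_distrib[symmetric] sum.distrib sum_subtractf sum_distrib_left)
qed

text \<open>Expanding a product of factors \<open>I + c\<^sub>i G\<^sub>i\<close> over the subsets of the index set.\<close>

lemma subset_expansion:
  fixes G :: "'i \<Rightarrow> ('k \<Rightarrow> real) \<Rightarrow> 'k \<Rightarrow> real" and c :: "'i \<Rightarrow> real"
  assumes lin: "\<And>i v a w. G i (\<lambda>k. v k + a * w k) = (\<lambda>k. G i v k + a * G i w k)"
    and P0: "P {} = F {}"
    and P: "\<And>i T. i \<notin> T \<Longrightarrow> finite T \<Longrightarrow> P (insert i T) = (\<lambda>k. P T k + c i * G i (P T) k)"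
    and F: "\<And>i T. i \<notin> T \<Longrightarrow> finite T \<Longrightarrow> F (insert i T) = G i (F T)"
    and "finite T"
  shows "P T = (\<lambda>k. \<Sum>V\<in>Pow T. (\<Prod>i\<in>V. c i) * F V k)"
  using \<open>finite T\<close>
proof (induction T rule: finite_induct)
  case empty
  show ?case by (simp add: P0)
next
  case (insert i T)
  let ?c = "\<lambda>V. \<Prod>i\<in>V. c i"
  have G0: "G i (\<lambda>k. 0) = (\<lambda>k. 0)"
    using lin[of i "\<lambda>_. 0" "-1" "\<lambda>_. 0"] by (simp add: fun_eq_iff)
  have pl: "G i (\<lambda>k. \<Sum>V\<in>A. ?c V * F V k) = (\<lambda>k. \<Sum>V\<in>A. ?c V * G i (F V) k)" if "finite A" for A
    using that
  proof (induction A rule: finite_induct)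
    case empty
    show ?case by (simp add: G0)
  next
    case (insert V A)
    have "G i (\<lambda>k. (\<Sum>V\<in>A. ?c V * F V k) + ?c V * F V k)
      = (\<lambda>k. (\<Sum>V\<in>A. ?c V * G i (F V) k) + ?c V * G i (F V) k)"
      unfolding lin insert.IH ..
    with insert.hyps show ?case by (simp add: add.commute)
  qed
  have "P (insert i T) = (\<lambda>k. (\<Sum>V\<in>Pow T. ?c V * F V k) + c i * (\<Sum>V\<in>Pow T. ?c V * G i (F V) k))"
    unfolding P[OF insert.hyps(2,1)] insert.IH pl[OF finite_Pow_iff[THEN iffD2, OF insert.hyps(1)]] ..
  also have "\<dots> = (\<lambda>k. \<Sum>V\<in>Pow (insert i T). ?c V * F V k)"
  proof
    fix k
    have inj: "inj_on (insert i) (Pow T)" using insert.hyps(2) by (auto simp: inj_on_def)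
    have "c i * (\<Sum>V\<in>Pow T. ?c V * G i (F V) k) = (\<Sum>V\<in>Pow T. ?c (insert i V) * F (insert i V) k)"
      unfolding sum_distrib_left
    proof (rule sum.cong[OF refl])
      fix V assume "V \<in> Pow T"
      then have "i \<notin> V" "finite V" using insert.hyps finite_subset by auto
      then show "c i * (?c V * G i (F V) k) = ?c (insert i V) * F (insert i V) k"
        by (simp add: F)
    qed
    also have "\<dots> = (\<Sum>V\<in>insert i ` Pow T. ?c V * F V k)" by (simp add: sum.reindex[OF inj])
    also have "(\<Sum>V\<in>Pow T. ?c V * F V k) + \<dots> = (\<Sum>V\<in>Pow (insert i T). ?c V * F V k)"
      unfolding Pow_insert by (rule sum.union_disjoint[symmetric]) (use insert.hyps in auto)
    finally show "(\<Sum>V\<in>Pow T. ?c V * F V k) + c i * (\<Sum>V\<in>Pow T. ?c V * G i (F V) k)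
      = (\<Sum>V\<in>Pow (insert i T). ?c V * F V k)" by simp
  qed
  finally show ?case .
qed

locale mesh_ops =
  fixes h :: "real^'n::finite" and N :: "nat^'n"
  assumes h: "\<And>i. 0 < h $ i"
begin

abbreviation "S \<equiv> inner_nodes N"
abbreviation "Ext \<equiv> zext S"

sublocale commuting_ops S "pLam h N"
proof
  show "finite S" by (rule finite_inner_nodes)
  show "pLam h N i (\<lambda>k. v k + c * w k) = (\<lambda>k. pLam h N i v k + c * pLam h N i w k)" for i v c w
  proof -
    have "Ext (\<lambda>k. v k + c * w k) = (\<lambda>k. Ext v k + c * Ext w k)" by (auto simp: zext_def)
    then show ?thesis unfolding pLam_def by (simp add: Lam_lin) (auto simp: zext_def)
  qed
  show "pLam h N i w k = 0" if "k \<notin> S" for i w k using that by (simp add: pLam_def zext_def)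
  show "ip S (pLam h N i v) w = ip S v (pLam h N i w)" for i v w
    unfolding ip_commute[of S v] ip_pLam
    using sum_shift[of S "Ext v" "Ext w" "axis i 1", OF finite_inner_nodes zext_supp zext_supp]
      sum_shift[of S "Ext w" "Ext v" "axis i 1", OF finite_inner_nodes zext_supp zext_supp]
    by (simp add: mult.commute)
  show "pLam h N i (pLam h N j w) = pLam h N j (pLam h N i w)" for i j w
  proof (cases "i = j")
    case False
    have *: "pLam h N i (pLam h N j w) = Ext (Lam_prod h {i, j} (Ext w))" if "i \<noteq> j" for i j
    proof -
      have "Ext (Lam_prod h {i, j} (Ext w)) = pLam h N i (Ext (Lam_prod h {j} (Ext w)))"
        by (rule zext_Lam_prod_insert) (use that zext_supp in auto)
      then show ?thesis by (simp add: Lam_prod_insert Lam_prod_empty pLam_def)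
    qed
    have "{i, j} = {j, i}" by auto
    then show ?thesis using *[OF False] *[of j i] False by simp
  qed simp
qed

definition LP :: "'n set \<Rightarrow> 'n mesh_fun \<Rightarrow> 'n mesh_fun" where
  "LP T w = Ext (Lam_prod h T (Ext w))"

lemma LP_empty: "LP {} = Ext"
  by (auto simp: LP_def Lam_prod_empty)

lemma LP_insert: "i \<notin> T \<Longrightarrow> LP (insert i T) w = pLam h N i (LP T w)"
  unfolding LP_def by (rule zext_Lam_prod_insert) (simp_all add: zext_supp)

lemma LP_alg: "LP T \<in> alg"
  using finite[of T]
proof (induction T rule: finite_induct)
  case empty
  show ?case unfolding LP_empty by (rule alg_one)
next
  case (insert i T)
  have "(\<lambda>w. pLam h N i (LP T w)) \<in> alg" by (rule alg_comp[OF alg_gen insert.IH])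
  also have "(\<lambda>w. pLam h N i (LP T w)) = LP (insert i T)"
    by (rule ext) (rule LP_insert[OF insert.hyps(2), symmetric])
  finally show ?case .
qed

text \<open>
  The positive operators \<open>-\<Lambda>\<^sub>i\<close> and \<open>s\<^sub>i\<^sub>N\<close> in \<open>H\<^sub>h\<close>.
\<close>

definition L :: "'n \<Rightarrow> 'n mesh_fun \<Rightarrow> 'n mesh_fun" where
  "L i w = (\<lambda>k. - pLam h N i w k)"

definition s :: "'n \<Rightarrow> 'n mesh_fun \<Rightarrow> 'n mesh_fun" where
  "s i w = (\<lambda>k. Ext w k - ((h $ i)\<^sup>2 / 12) * L i w k)"

lemma L_alg: "L i \<in> alg"
  using alg_diff[OF alg_zero alg_gen] by (simp add: L_def[abs_def])

lemma s_alg: "s i \<in> alg"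
  unfolding s_def[abs_def] by (rule alg_diff[OF alg_one alg_scale[OF L_alg]])

text \<open>
  Up to the factor \<open>h\<^sub>i\<^sup>2\<close> the quadratic form is \<open>2 \<Sum> v\<^sub>k\<^sup>2 - 2 \<Sum> v\<^sub>k v\<^bsub>k+e\<^esub>\<close> with \<open>v\<close> extended by zero, and the
  last sum is at most \<open>\<Sum> v\<^sub>k\<^sup>2\<close> in absolute value.
\<close>

lemma L_bounds: "0 \<le> ip S (L i w) w" "ip S (L i w) w \<le> 4 / (h $ i)\<^sup>2 * ip S w w"
proof -
  let ?v = "Ext w" and ?e = "axis i 1 :: int^'n"
  let ?x = "\<Sum>k\<in>S. ?v (k + ?e) * ?v k" and ?n = "\<Sum>k\<in>S. (?v k)\<^sup>2"
  have "ip S (L i w) w = - ip S (pLam h N i w) w"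
    unfolding L_def by (simp add: ip_def sum_negf)
  also have "\<dots> = (2 * ?n - 2 * ?x) / (h $ i)\<^sup>2"
    unfolding ip_pLam using sum_shift[of S ?v ?v ?e, OF finite_inner_nodes zext_supp zext_supp]
    by (simp add: mult.commute minus_divide_left power2_eq_square)
  finally have eq: "ip S (L i w) w = (2 * ?n - 2 * ?x) / (h $ i)\<^sup>2" .
  have "2 * \<bar>?x\<bar> \<le> (\<Sum>k\<in>S. (?v (k + ?e))\<^sup>2 + (?v k)\<^sup>2)"
  proof -
    have "2 * \<bar>?x\<bar> \<le> 2 * (\<Sum>k\<in>S. \<bar>?v (k + ?e) * ?v k\<bar>)" by (intro mult_left_mono sum_abs) simp
    also have "\<dots> \<le> (\<Sum>k\<in>S. (?v (k + ?e))\<^sup>2 + (?v k)\<^sup>2)"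
      unfolding sum_distrib_left
    proof (rule sum_mono)
      fix k
      have "0 \<le> (\<bar>?v (k + ?e)\<bar> - \<bar>?v k\<bar>)\<^sup>2" by simp
      then show "2 * \<bar>?v (k + ?e) * ?v k\<bar> \<le> (?v (k + ?e))\<^sup>2 + (?v k)\<^sup>2"
        by (simp add: power2_diff abs_mult)
    qed
    finally show ?thesis .
  qed
  also have "\<dots> \<le> 2 * ?n"
    using sum_shift_le[of S ?v ?e, OF finite_inner_nodes zext_supp] by (simp add: sum.distrib)
  finally have x: "\<bar>?x\<bar> \<le> ?n" by simp
  have n: "?n = ip S w w" by (simp add: ip_def zext_def power2_eq_square)
  show "0 \<le> ip S (L i w) w" unfolding eq using x by simp
  have "(2 * ?n - 2 * ?x) / (h $ i)\<^sup>2 \<le> (4 * ?n) / (h $ i)\<^sup>2" using x by (intro divide_right_mono) auto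
  then show "ip S (L i w) w \<le> 4 / (h $ i)\<^sup>2 * ip S w w" unfolding eq n by simp
qed

lemma ip_s: "ip S (s i w) w = ip S w w - ((h $ i)\<^sup>2 / 12) * ip S (L i w) w"
  unfolding s_def by (simp only: ip_diff_left ip_scale_left ip_zext)

lemma s_bounds: "(2/3) * ip S w w \<le> ip S (s i w) w" "ip S (s i w) w \<le> ip S w w"
proof -
  have "((h $ i)\<^sup>2 / 12) * ip S (L i w) w \<le> ((h $ i)\<^sup>2 / 12) * (4 / (h $ i)\<^sup>2 * ip S w w)"
    by (rule mult_left_mono[OF L_bounds(2)]) simp
  also have "\<dots> = (1/3) * ip S w w" using h[of i] by simp
  finally show "(2/3) * ip S w w \<le> ip S (s i w) w" by (simp add: ip_s)
  have "0 \<le> ((h $ i)\<^sup>2 / 12) * ip S (L i w) w" using L_bounds(1) by simp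
  then show "ip S (s i w) w \<le> ip S w w" by (simp add: ip_s)
qed

lemma L_psd: "psd S (L i)"
  using L_bounds(1) by (simp add: psd_def)

lemma s_psd: "psd S (s i)"
  unfolding psd_def
proof
  fix w
  have "0 \<le> (2/3) * ip S w w" by simp
  also have "\<dots> \<le> ip S (s i w) w" by (rule s_bounds)
  finally show "0 \<le> ip S (s i w) w" .
qed

definition SP :: "'n set \<Rightarrow> 'n mesh_fun \<Rightarrow> 'n mesh_fun" where
  "SP T w = Finite_Set.fold s (Ext w) T"

lemma SP_empty: "SP {} = Ext"
  by (auto simp: SP_def)

lemma SP_insert: "i \<notin> T \<Longrightarrow> SP (insert i T) w = s i (SP T w)"
proof -
  interpret comp_fun_commute s
    by unfold_locales (rule ext, simp only: o_apply alg_comm[OF s_alg s_alg])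
  show "i \<notin> T \<Longrightarrow> SP (insert i T) w = s i (SP T w)" by (simp add: SP_def)
qed

lemma SP_alg: "SP T \<in> alg"
  using finite[of T]
proof (induction T rule: finite_induct)
  case empty
  show ?case unfolding SP_empty by (rule alg_one)
next
  case (insert i T)
  have "(\<lambda>w. s i (SP T w)) \<in> alg" by (rule alg_comp[OF s_alg insert.IH])
  also have "(\<lambda>w. s i (SP T w)) = SP (insert i T)"
    by (rule ext) (rule SP_insert[OF insert.hyps(2), symmetric])
  finally show ?case .
qed

lemma SP_expand: "SP T w = (\<lambda>k. \<Sum>V\<in>Pow T. (\<Prod>i\<in>V. (h $ i)\<^sup>2 / 12) * LP V w k)"
proof (rule subset_expansion[where G = "pLam h N" and P = "\<lambda>T. SP T w" and F = "\<lambda>T. LP T w"])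
  show "SP (insert i T) w = (\<lambda>k. SP T w k + ((h $ i)\<^sup>2 / 12) * pLam h N i (SP T w) k)" if "i \<notin> T" for i T
    unfolding SP_insert[OF that] s_def L_def zext_alg[OF SP_alg] by simp
qed (simp_all add: gen_lin SP_empty LP_empty LP_insert)

end

section \<open>Spectral bounds for the three schemes\<close>

definition Bgen :: "(nat \<Rightarrow> real) \<Rightarrow> real^'n::finite \<Rightarrow> 'n mesh_fun \<Rightarrow> 'n mesh_fun" where
  "Bgen bc h w = (\<lambda>k. \<Sum>V\<in>Pow UNIV. bc (card V) * (\<Prod>i\<in>V. (h $ i)\<^sup>2) * Lam_prod h V w k)"

definition Agen :: "(nat \<Rightarrow> real) \<Rightarrow> real^'n::finite \<Rightarrow> real^'n \<Rightarrow> 'n mesh_fun \<Rightarrow> 'n mesh_fun" where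
  "Agen ac a h w = (\<lambda>k. - (\<Sum>l\<in>UNIV. (a $ l)\<^sup>2 *
     (\<Sum>V\<in>Pow (UNIV - {l}). ac (card V) * (\<Prod>i\<in>V. (h $ i)\<^sup>2) * Lam_prod h (insert l V) w k)))"

text \<open>
  The coefficients of \<open>A\<^sub>N\<close> in the representation \<open>Agen\<close>.
\<close>

definition two_terms :: "nat \<Rightarrow> real" where
  "two_terms m = (if m \<le> 1 then (1/12) ^ m else 0)"

fun bcoef :: "scheme \<Rightarrow> nat \<Rightarrow> real" where
  "bcoef (Scheme1 \<beta>) m = (if m \<le> 1 then (1/12) ^ m else \<beta> / 144)"
| "bcoef (Scheme2 \<beta> \<gamma> \<theta>) m = (if m \<le> 1 then (1/12) ^ m else if m = 2 then \<beta> / 144 else \<gamma> / 1728)"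
| "bcoef Scheme3 m = (1/12) ^ m"

fun acoef :: "scheme \<Rightarrow> nat \<Rightarrow> real" where
  "acoef (Scheme1 \<beta>) m = two_terms m"
| "acoef (Scheme2 \<beta> \<gamma> \<theta>) m = (if m \<le> 1 then (1/12) ^ m else \<theta> / 144)"
| "acoef Scheme3 m = (1/12) ^ m"

lemma coef_01: "bcoef sch 0 = 1" "bcoef sch 1 = 1/12" "acoef sch 0 = 1" "acoef sch 1 = 1/12"
  by (cases sch; simp add: two_terms_def)+

lemma Lam_prod_single: "Lam_prod h {i} w = Lam h i w"
  by (simp add: Lam_prod_insert Lam_prod_empty)

lemma prod_div_12: "(\<Prod>i\<in>V. (h $ i)\<^sup>2 / 12) = (1/12) ^ card V * (\<Prod>i\<in>V. (h $ i)\<^sup>2 :: real)"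
  by (simp add: prod_dividef power_divide)

lemma s1_prod_expand:
  "s1_prod h T w k = (\<Sum>V\<in>Pow T. (1/12) ^ card V * (\<Prod>i\<in>V. (h $ i)\<^sup>2) * Lam_prod h V w k)"
proof -
  have "s1_prod h T w = (\<lambda>k. \<Sum>V\<in>Pow T. (\<Prod>i\<in>V. (h $ i)\<^sup>2 / 12) * Lam_prod h V w k)"
    by (rule subset_expansion[where G = "Lam h" and P = "\<lambda>T. s1_prod h T w" and F = "\<lambda>T. Lam_prod h T w"])
      (simp_all add: Lam_lin s1_prod_empty Lam_prod_empty s1_prod_insert Lam_prod_insert s1_def)
  then show ?thesis by (simp add: prod_div_12)
qed

lemma sN_bar_eq: "sN_bar h w = Bgen (\<lambda>m. (1/12) ^ m) h w"
  by (rule ext) (simp add: sN_bar_def Bgen_def s1_prod_expand)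

lemma Lam_prod_insert': "l \<notin> V \<Longrightarrow> Lam_prod h V (Lam h l w) = Lam_prod h (insert l V) w"
  by (simp add: Lam_prod_Lam Lam_prod_insert)

lemma AN_bar_eq: "AN_bar a h w = Agen (\<lambda>m. (1/12) ^ m) a h w"
proof
  fix k
  have "s1_prod h (UNIV - {l}) (Lam h l w) k
    = (\<Sum>V\<in>Pow (UNIV - {l}). (1/12) ^ card V * (\<Prod>i\<in>V. (h $ i)\<^sup>2) * Lam_prod h (insert l V) w k)" for l
    unfolding s1_prod_expand
  proof (rule sum.cong[OF refl])
    fix V assume "V \<in> Pow (UNIV - {l})"
    then have "l \<notin> V" by auto
    then have "Lam_prod h V (Lam h l w) = Lam_prod h (insert l V) w" by (rule Lam_prod_insert')
    then show "(1/12) ^ card V * (\<Prod>i\<in>V. (h $ i)\<^sup>2) * Lam_prod h V (Lam h l w) k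
      = (1/12) ^ card V * (\<Prod>i\<in>V. (h $ i)\<^sup>2) * Lam_prod h (insert l V) w k"
      by (simp only:)
  qed
  then show "AN_bar a h w k = Agen (\<lambda>m. (1/12) ^ m) a h w k"
    unfolding AN_bar_def Agen_def by simp
qed

lemma AN_eq: "AN a h w = Agen two_terms a h w"
proof
  fix k
  have "(\<Sum>V\<in>Pow (UNIV - {l}). two_terms (card V) * (\<Prod>i\<in>V. (h $ i)\<^sup>2) * Lam_prod h (insert l V) w k)
    = sN_hat h l (Lam h l w) k" for l
  proof -
    have "(\<Sum>V\<in>Pow (UNIV - {l}). two_terms (card V) * (\<Prod>i\<in>V. (h $ i)\<^sup>2) * Lam_prod h (insert l V) w k)
      = Lam h l w k + (\<Sum>i\<in>UNIV - {l}. (1/12) * (h $ i)\<^sup>2 * Lam_prod h (insert l {i}) w k)"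
      by (subst sum_Pow_split) (simp_all add: two_terms_def Lam_prod_single)
    also have "(\<Sum>i\<in>UNIV - {l}. (1/12) * (h $ i)\<^sup>2 * Lam_prod h (insert l {i}) w k)
      = (\<Sum>i\<in>UNIV - {l}. (1/12) * ((h $ i)\<^sup>2 * Lam h i (Lam h l w) k))"
      by (rule sum.cong[OF refl]) (simp add: Lam_prod_insert'[symmetric] Lam_prod_single)
    finally show ?thesis by (simp add: sN_hat_def sum_distrib_left)
  qed
  then show "AN a h w k = Agen two_terms a h w k"
    unfolding AN_def Agen_def by simp
qed

lemma sN_split: "sN h w k = Lam_prod h {} w k + (\<Sum>i\<in>UNIV. (1/12) * (h $ i)\<^sup>2 * Lam_prod h {i} w k)"
  by (simp add: sN_def Lam_prod_single Lam_prod_empty sum_distrib_left)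

lemma Bgen_split:
  assumes "bc 0 = 1" "bc 1 = 1/12"
  shows "Bgen bc h w k = sN h w k + (\<Sum>V\<in>{V \<in> Pow UNIV. 2 \<le> card V}. bc (card V) * (\<Prod>i\<in>V. (h $ i)\<^sup>2) * Lam_prod h V w k)"
proof -
  have "bc (Suc 0) = 1/12" using assms by simp
  note bc1 = this
  show ?thesis unfolding Bgen_def sN_split
    by (subst sum_Pow_split) (simp_all add: assms(1) bc1)
qed

lemma sets_card_top: "CARD('n::finite) = m \<Longrightarrow> {V :: 'n set. m \<le> card V} = {UNIV}"
  using card_seteq[of "UNIV :: 'n set"] by auto

lemma Bop_eq:
  assumes "scheme_dim sch CARD('n)"
  shows "Bop sch (h :: real^'n::finite) w = Bgen (bcoef sch) h w"
proof (cases sch)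
  case (Scheme1 \<beta>)
  then have n: "CARD('n) = 2" using assms by simp
  have "(\<Prod>i\<in>UNIV. (h $ i)\<^sup>2 / 12) = (1/144) * (\<Prod>i\<in>UNIV. (h $ i)\<^sup>2)"
    unfolding prod_div_12 n by (simp add: power2_eq_square)
  then show ?thesis
    using coef_01[of sch] sets_card_top[OF n]
    by (intro ext) (simp add: Bgen_split[OF coef_01(1,2)] Scheme1 sN_beta_def n)
next
  case (Scheme2 \<beta> \<gamma> \<theta>)
  then have n: "CARD('n) = 3" using assms by simp
  have "{V :: 'n set. 2 \<le> card V} = {V. card V = 2} \<union> {V. 3 \<le> card V}" by auto
  then have sets: "{V :: 'n set. 2 \<le> card V} = insert UNIV {V. card V = 2}" unfolding sets_card_top[OF n] by auto
  show ?thesis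
  proof
    fix k
    have "(\<Sum>V\<in>{V \<in> Pow UNIV. 2 \<le> card V}. bcoef sch (card V) * (\<Prod>i\<in>V. (h $ i)\<^sup>2) * Lam_prod h V w k)
      = bcoef sch 3 * (\<Prod>i\<in>UNIV. (h $ i)\<^sup>2) * Lam_prod h UNIV w k
        + bcoef sch 2 * (\<Sum>V | card V = 2. (\<Prod>i\<in>V. (h $ i)\<^sup>2) * Lam_prod h V w k)"
      using n by (simp add: sets mult.assoc sum_distrib_left)
    then have "Bgen (bcoef sch) h w k = sN h w k + (bcoef sch 3 * (\<Prod>i\<in>UNIV. (h $ i)\<^sup>2) * Lam_prod h UNIV w k
        + bcoef sch 2 * (\<Sum>V | card V = 2. (\<Prod>i\<in>V. (h $ i)\<^sup>2) * Lam_prod h V w k))"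
      by (simp only: Bgen_split[OF coef_01(1,2)])
    then show "Bop sch h w k = Bgen (bcoef sch) h w k"
      by (simp add: Scheme2 sN_beta_gamma_def sN_bar2_def sN_bar3_def)
  qed
next
  case Scheme3
  then have "bcoef sch = (\<lambda>m. (1/12) ^ m)" by auto
  then show ?thesis by (simp add: Scheme3 sN_bar_eq)
qed

lemma Aop_eq:
  assumes "scheme_dim sch CARD('n)"
  shows "Aop sch a (h :: real^'n::finite) w = Agen (acoef sch) a h w"
proof (cases sch)
  case (Scheme1 \<beta>)
  then have "acoef sch = two_terms" by auto
  then show ?thesis by (simp add: Scheme1 AN_eq)
next
  case (Scheme2 \<beta> \<gamma> \<theta>)
  then have n: "CARD('n) = 3" using assms by simp
  have sets: "{V \<in> Pow (UNIV - {l :: 'n}). 2 \<le> card V} = {UNIV - {l}}" for l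
  proof -
    have c: "card (UNIV - {l}) = 2" using n by (simp add: card_Diff_singleton)
    have "V = UNIV - {l}" if "V \<subseteq> UNIV - {l}" "2 \<le> card V" for V
      by (rule card_seteq[OF _ that(1)]) (use c that(2) in auto)
    then show ?thesis using c by auto
  qed
  show ?thesis
  proof
    fix k
    have "(\<Sum>V\<in>Pow (UNIV - {l}). acoef sch (card V) * (\<Prod>i\<in>V. (h $ i)\<^sup>2) * Lam_prod h (insert l V) w k)
      = (\<Sum>V\<in>Pow (UNIV - {l}). two_terms (card V) * (\<Prod>i\<in>V. (h $ i)\<^sup>2) * Lam_prod h (insert l V) w k)
        + \<theta> / 144 * (\<Prod>i\<in>UNIV - {l}. (h $ i)\<^sup>2) * Lam_prod h UNIV w k" for l
      using n by (subst (1 2) sum_Pow_split)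
        (simp_all only: sets finite, simp add: Scheme2 two_terms_def insert_absorb card_Diff_singleton)
    then have "Agen (acoef sch) a h w k = - (\<Sum>l\<in>UNIV. (a $ l)\<^sup>2 *
        ((\<Sum>V\<in>Pow (UNIV - {l}). two_terms (card V) * (\<Prod>i\<in>V. (h $ i)\<^sup>2) * Lam_prod h (insert l V) w k)
        + \<theta> / 144 * (\<Prod>i\<in>UNIV - {l}. (h $ i)\<^sup>2) * Lam_prod h UNIV w k))"
      by (simp add: Agen_def)
    also have "\<dots> = Agen two_terms a h w k + \<theta> * AN_bar3 a h w k"
      unfolding Agen_def AN_bar3_def distrib_left sum.distrib sum_distrib_left sum_distrib_right sum_negf[symmetric]
      by (simp add: sum_distrib_left sum_distrib_right mult_ac flip: sum_negf)
    finally show "Aop sch a h w k = Agen (acoef sch) a h w k"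
      by (simp add: Scheme2 AN_theta_def AN_eq)
  qed
next
  case Scheme3
  then have "acoef sch = (\<lambda>m. (1/12) ^ m)" by auto
  then show ?thesis by (simp add: Scheme3 AN_bar_eq)
qed


context mesh_ops
begin

definition Balg :: "(nat \<Rightarrow> real) \<Rightarrow> 'n mesh_fun \<Rightarrow> 'n mesh_fun" where
  "Balg bc = (\<lambda>w k. \<Sum>V\<in>Pow UNIV. (bc (card V) * (\<Prod>i\<in>V. (h $ i)\<^sup>2)) * LP V w k)"

definition Aalg :: "(nat \<Rightarrow> real) \<Rightarrow> real^'n \<Rightarrow> 'n mesh_fun \<Rightarrow> 'n mesh_fun" where
  "Aalg ac a = (\<lambda>w k. \<Sum>l\<in>UNIV. (- (a $ l)\<^sup>2) *
     (\<Sum>V\<in>Pow (UNIV - {l}). (ac (card V) * (\<Prod>i\<in>V. (h $ i)\<^sup>2)) * LP (insert l V) w k))"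

lemma Balg_alg: "Balg bc \<in> alg"
  unfolding Balg_def by (rule alg_sum, rule alg_scale, rule LP_alg)

lemma Aalg_alg: "Aalg ac a \<in> alg"
  unfolding Aalg_def by (rule alg_sum, rule alg_scale, rule alg_sum, rule alg_scale, rule LP_alg)

lemma Bgen_Balg:
  assumes "\<And>k. k \<in> nodes N \<Longrightarrow> w k = Ext v k" "k \<in> S"
  shows "Bgen bc h w k = Balg bc v k"
proof -
  have "Lam_prod h V w k = LP V v k" for V
    using Lam_prod_cong_inner[OF assms] assms(2) by (simp add: LP_def zext_def[of S "Lam_prod h V (Ext v)"])
  then show ?thesis by (simp add: Bgen_def Balg_def mult.assoc)
qed

lemma Agen_Aalg:
  assumes "\<And>k. k \<in> nodes N \<Longrightarrow> w k = Ext v k" "k \<in> S"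
  shows "Agen ac a h w k = Aalg ac a v k"
proof -
  have "Lam_prod h V w k = LP V v k" for V
    using Lam_prod_cong_inner[OF assms] assms(2) by (simp add: LP_def zext_def[of S "Lam_prod h V (Ext v)"])
  then show ?thesis by (simp add: Agen_def Aalg_def mult.assoc sum_negf)
qed

lemma SP_bounds: "psd S (SP T)" "ip S (SP T w) w \<le> ip S w w"
proof -
  have "psd S (SP T) \<and> psd S (\<lambda>w k. Ext w k - SP T w k)"
    using finite[of T]
  proof (induction T rule: finite_induct)
    case empty
    show ?case by (simp add: SP_empty psd_def) (simp add: ip_def)
  next
    case (insert i T)
    have le: "ip S (SP T w) w \<le> 1 * ip S w w" for w
      using insert.IH by (simp add: psd_def ip_diff_left)
    have "psd S (\<lambda>w. s i (SP T w))"
      by (rule psd_comp[OF SP_alg s_alg _ s_psd _ le]) (use insert.IH in simp_all)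
    then have 1: "psd S (SP (insert i T))"
      by (simp add: psd_def SP_insert[OF insert.hyps(2)])
    have "psd S (\<lambda>w. L i (SP T w))"
      by (rule psd_comp[OF SP_alg L_alg _ L_psd _ le]) (use insert.IH in simp_all)
    moreover have "ip S (\<lambda>k. Ext w k - SP (insert i T) w k) w
      = ip S (\<lambda>k. Ext w k - SP T w k) w + (h $ i)\<^sup>2 / 12 * ip S (L i (SP T w)) w" for w
      unfolding SP_insert[OF insert.hyps(2)] s_def zext_alg[OF SP_alg] ip_diff_left ip_scale_left by simp
    ultimately have "0 \<le> ip S (\<lambda>k. Ext w k - SP (insert i T) w k) w" for w
      using insert.IH by (simp add: psd_def)
    with 1 show ?case by (simp add: psd_def)
  qed
  then show "psd S (SP T)" "ip S (SP T w) w \<le> ip S w w"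
    by (simp_all add: psd_def ip_diff_left)
qed

text \<open>
  Each factor satisfies \<open>s\<^sub>k \<ge> 2/3\<close>, and inequalities may be multiplied by commuting positive
  operators.
\<close>

lemma L_SP_ge: "(2/3) ^ card T * ip S (L l w) w \<le> ip S (L l (SP T w)) w"
proof -
  have "psd S (\<lambda>w k. L l (SP T w) k - (2/3) ^ card T * L l w k)"
    using finite[of T]
  proof (induction T rule: finite_induct)
    case empty
    show ?case by (simp add: SP_empty psd_def alg_zext[OF L_alg]) (simp add: ip_def)
  next
    case (insert i T)
    let ?U = "\<lambda>w k. L l (SP T w) k - (2/3) ^ card T * L l w k"
    let ?V = "\<lambda>w k. s i w k - (2/3) * Ext w k"
    have U: "?U \<in> alg" by (rule alg_diff[OF alg_comp[OF L_alg SP_alg] alg_scale[OF L_alg]])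
    have V: "?V \<in> alg" by (rule alg_diff[OF s_alg alg_scale[OF alg_one]])
    have a: "psd S (\<lambda>w. ?U (s i w))"
      by (rule psd_comp[OF s_alg U s_psd insert.IH, of 1]) (use s_bounds(2) in simp_all)
    have b: "psd S (\<lambda>w. L l (?V w))"
    proof (rule psd_comp[OF V L_alg _ L_psd, of 1])
      show "psd S ?V"
        unfolding psd_def ip_diff_left ip_scale_left ip_zext using s_bounds(1) by simp
      show "ip S (?V w) w \<le> 1 * ip S w w" for w
        unfolding ip_diff_left ip_scale_left ip_zext
        using s_bounds(2)[of i w] ip_self_nonneg[of S w] by linarith
    qed simp
    have "ip S (\<lambda>k. L l (SP (insert i T) w) k - (2/3) ^ card (insert i T) * L l w k) w
      = ip S (?U (s i w)) w + (2/3) ^ card T * ip S (L l (?V w)) w" for w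
    proof -
      have "L l (SP (insert i T) w) = L l (SP T (s i w))"
        unfolding SP_insert[OF insert.hyps(2)] alg_comm[OF s_alg SP_alg] ..
      moreover have "L l (?V w) = (\<lambda>k. L l (s i w) k - (2/3) * L l w k)"
        unfolding alg_minus[OF L_alg] alg_scaled[OF L_alg] alg_zext[OF L_alg] ..
      ultimately show ?thesis
        unfolding card_insert_disjoint[OF insert.hyps] ip_diff_left ip_scale_left
        by (simp only: ip_diff_left ip_scale_left power_Suc) (simp add: algebra_simps)
    qed
    then show ?case using a b by (simp add: psd_def)
  qed
  then show ?thesis by (simp add: psd_def ip_diff_left ip_scale_left)
qed

lemma ip_sum_left: "ip A (\<lambda>k. \<Sum>i\<in>I. c i * F i k) w = (\<Sum>i\<in>I. c i * ip A (F i) w)"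
  unfolding ip_def sum_distrib_left sum_distrib_right
  by (subst sum.swap) (simp add: mult.assoc)

lemma L_sum: "finite I \<Longrightarrow> L l (\<lambda>k. \<Sum>V\<in>I. c V * F V k) = (\<lambda>k. \<Sum>V\<in>I. c V * L l (F V) k)"
proof (induction I rule: finite_induct)
  case empty
  show ?case by (simp add: alg_0[OF L_alg])
next
  case (insert V I)
  have "L l (\<lambda>k. (\<Sum>V\<in>I. c V * F V k) + c V * F V k) = (\<lambda>k. (\<Sum>V\<in>I. c V * L l (F V) k) + c V * L l (F V) k)"
    unfolding alg_lin[OF L_alg] insert.IH ..
  with insert.hyps show ?case by (simp add: add.commute)
qed

lemma Aalg_L:
  "Aalg ac a w k = (\<Sum>l\<in>UNIV. (a $ l)\<^sup>2 * L l (\<lambda>k. \<Sum>V\<in>Pow (UNIV - {l}). (ac (card V) * (\<Prod>i\<in>V. (h $ i)\<^sup>2)) * LP V w k) k)"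
proof -
  have "(\<Sum>V\<in>Pow (UNIV - {l}). (ac (card V) * (\<Prod>i\<in>V. (h $ i)\<^sup>2)) * LP (insert l V) w k)
    = (\<Sum>V\<in>Pow (UNIV - {l}). (ac (card V) * (\<Prod>i\<in>V. (h $ i)\<^sup>2)) * (- L l (LP V w) k))" for l
    by (rule sum.cong[OF refl]) (auto simp: LP_insert L_def subset_Diff_insert)
  then show ?thesis
    unfolding Aalg_def by (simp add: L_sum sum_negf)
qed

lemma Aalg_bar: "Aalg (\<lambda>m. (1/12) ^ m) a w k = (\<Sum>l\<in>UNIV. (a $ l)\<^sup>2 * L l (SP (UNIV - {l}) w) k)"
  unfolding Aalg_L SP_expand prod_div_12 ..

lemma Aalg_bar_ge:
  assumes "\<And>l. 0 \<le> \<mu> \<and> \<mu> \<le> a $ l"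
  shows "\<mu>\<^sup>2 * (2/3) ^ (CARD('n) - 1) * (\<Sum>l\<in>UNIV. ip S (L l w) w) \<le> ip S (Aalg (\<lambda>m. (1/12) ^ m) a w) w"
proof -
  have "\<mu>\<^sup>2 * (2/3) ^ (CARD('n) - 1) * (\<Sum>l\<in>UNIV. ip S (L l w) w)
    = (\<Sum>l\<in>UNIV. \<mu>\<^sup>2 * ((2/3) ^ card (UNIV - {l}) * ip S (L l w) w))"
    by (simp add: sum_distrib_left mult.assoc card_Diff_singleton)
  also have "\<dots> \<le> (\<Sum>l\<in>UNIV. (a $ l)\<^sup>2 * ip S (L l (SP (UNIV - {l}) w)) w)"
    by (intro sum_mono mult_mono power_mono L_SP_ge) (use assms L_bounds(1) in auto)
  also have "\<dots> = ip S (Aalg (\<lambda>m. (1/12) ^ m) a w) w"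
    unfolding Aalg_bar ip_sum_left ..
  finally show ?thesis .
qed

lemma Balg_bar: "Balg (\<lambda>m. (1/12) ^ m) w = SP UNIV w"
  unfolding Balg_def SP_expand prod_div_12 ..

text \<open>
  This is \<open>-\<Lambda>\<^sub>l \<le> (6/h\<^sub>l\<^sup>2) s\<^sub>l\<^sub>N\<close>, which is \<open>-\<Lambda>\<^sub>l \<le> 4/h\<^sub>l\<^sup>2\<close> rearranged, multiplied by the product of the
  other factors \<open>s\<^sub>k\<^sub>N\<close> and summed with the weights \<open>a\<^sub>l\<^sup>2\<close>.
\<close>

lemma Aalg_bar_le:
  "ip S (Aalg (\<lambda>m. (1/12) ^ m) a w) w \<le> (6 * (\<Sum>l\<in>UNIV. (a $ l)\<^sup>2 / (h $ l)\<^sup>2)) * ip S (Balg (\<lambda>m. (1/12) ^ m) w) w"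
proof -
  have le: "ip S (L l (SP (UNIV - {l}) w)) w \<le> 6 / (h $ l)\<^sup>2 * ip S (SP UNIV w) w" for l
  proof -
    let ?T = "UNIV - {l}"
    let ?U = "\<lambda>w k. 6 / (h $ l)\<^sup>2 * s l w k - L l w k"
    have U: "?U \<in> alg" by (rule alg_diff[OF alg_scale[OF s_alg] L_alg])
    have "0 \<le> ip S (?U w) w" for w
    proof -
      have "ip S (?U w) w = 6 / (h $ l)\<^sup>2 * ip S w w - (3/2) * ip S (L l w) w"
        unfolding ip_diff_left ip_scale_left ip_s using h[of l] by (simp add: right_diff_distrib)
      then show ?thesis using L_bounds(2)[of l w] by simp
    qed
    then have "psd S ?U" by (simp add: psd_def)
    from psd_comp[OF SP_alg U SP_bounds(1) this, of 1 ?T] SP_bounds(2)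
    have "0 \<le> ip S (?U (SP ?T w)) w" by (simp add: psd_def)
    moreover have "s l (SP ?T w) = SP UNIV w"
      using SP_insert[of l ?T w] by (simp add: insert_absorb)
    ultimately show ?thesis unfolding ip_diff_left ip_scale_left by simp
  qed
  have "ip S (Aalg (\<lambda>m. (1/12) ^ m) a w) w = (\<Sum>l\<in>UNIV. (a $ l)\<^sup>2 * ip S (L l (SP (UNIV - {l}) w)) w)"
    unfolding Aalg_bar ip_sum_left ..
  also have "\<dots> \<le> (\<Sum>l\<in>UNIV. (a $ l)\<^sup>2 * (6 / (h $ l)\<^sup>2 * ip S (SP UNIV w) w))"
    by (intro sum_mono mult_left_mono le) simp
  also have "\<dots> = (6 * (\<Sum>l\<in>UNIV. (a $ l)\<^sup>2 / (h $ l)\<^sup>2)) * ip S (SP UNIV w) w"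
    by (simp add: sum_distrib_left sum_distrib_right mult_ac)
  finally show ?thesis by (simp add: Balg_bar)
qed

text \<open>
  Each of the at most three terms in \<open>I - s\<^bsub>N,l\<^esub>\<close> is at most \<open>1/3\<close>, so the factor of \<open>-\<Lambda>\<^sub>l\<close> is
  positive.
\<close>

lemma Aalg_two_terms_nonneg:
  assumes "CARD('n) \<le> 4"
  shows "0 \<le> ip S (Aalg two_terms a w) w"
proof -
  have "0 \<le> ip S (L l (\<lambda>k. \<Sum>V\<in>Pow (UNIV - {l}). (two_terms (card V) * (\<Prod>i\<in>V. (h $ i)\<^sup>2)) * LP V w k)) w" for l
  proof -
    let ?H = "\<lambda>w k. Ext w k - (\<Sum>i\<in>UNIV - {l}. ((h $ i)\<^sup>2 / 12) * L i w k)"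
    have H: "?H \<in> alg" by (rule alg_diff[OF alg_one], rule alg_sum, rule alg_scale, rule L_alg)
    have ipH: "ip S (?H w) w = ip S w w - (\<Sum>i\<in>UNIV - {l}. ((h $ i)\<^sup>2 / 12) * ip S (L i w) w)" for w
      by (simp only: ip_diff_left ip_sum_left ip_zext)
    have le: "(\<Sum>i\<in>UNIV - {l}. ((h $ i)\<^sup>2 / 12) * ip S (L i w) w) \<le> ip S w w" for w
    proof -
      have "(\<Sum>i\<in>UNIV - {l}. ((h $ i)\<^sup>2 / 12) * ip S (L i w) w) \<le> (\<Sum>i\<in>UNIV - {l}. (1/3) * ip S w w)"
      proof (rule sum_mono)
        fix i
        have "((h $ i)\<^sup>2 / 12) * ip S (L i w) w \<le> ((h $ i)\<^sup>2 / 12) * (4 / (h $ i)\<^sup>2 * ip S w w)"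
          by (rule mult_left_mono[OF L_bounds(2)]) simp
        also have "\<dots> = (1/3) * ip S w w" using h[of i] by simp
        finally show "((h $ i)\<^sup>2 / 12) * ip S (L i w) w \<le> (1/3) * ip S w w" .
      qed
      also have "\<dots> = real (CARD('n) - 1) / 3 * ip S w w" by (simp add: card_Diff_singleton)
      also have "\<dots> \<le> 1 * ip S w w" using assms by (intro mult_right_mono) auto
      finally show ?thesis by simp
    qed
    have "psd S ?H" unfolding psd_def ipH using le by simp
    from psd_comp[OF H L_alg this L_psd, of 1] have "0 \<le> ip S (L l (?H w)) w"
      unfolding ipH using L_bounds(1) by (simp add: psd_def sum_nonneg)
    moreover have "(\<lambda>k. \<Sum>V\<in>Pow (UNIV - {l}). (two_terms (card V) * (\<Prod>i\<in>V. (h $ i)\<^sup>2)) * LP V w k) = ?H w"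
    proof
      fix k
      have p: "LP {i} w k = - L i w k" for i
        using LP_insert[of i "{}" w] by (simp add: LP_empty L_def alg_zext[OF alg_gen])
      show "(\<Sum>V\<in>Pow (UNIV - {l}). (two_terms (card V) * (\<Prod>i\<in>V. (h $ i)\<^sup>2)) * LP V w k) = ?H w k"
        by (subst sum_Pow_split) (simp_all add: two_terms_def LP_empty p sum_negf)
    qed
    ultimately show ?thesis by simp
  qed
  then show ?thesis unfolding Aalg_L ip_sum_left by (intro sum_nonneg mult_nonneg_nonneg) auto
qed

lemma Aalg_cong:
  assumes "\<And>m. m < CARD('n) \<Longrightarrow> ac m = ac' m"
  shows "Aalg ac a = Aalg ac' a"
proof -
  have "(\<Sum>V\<in>Pow (UNIV - {l}). (ac (card V) * (\<Prod>i\<in>V. (h $ i)\<^sup>2)) * LP (insert l V) w k)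
    = (\<Sum>V\<in>Pow (UNIV - {l}). (ac' (card V) * (\<Prod>i\<in>V. (h $ i)\<^sup>2)) * LP (insert l V) w k)" for l w k
  proof (rule sum.cong[OF refl])
    fix V assume "V \<in> Pow (UNIV - {l})"
    then have "V \<subset> UNIV" by auto
    then have "card V < CARD('n)" by (intro psubset_card_mono) auto
    then show "(ac (card V) * (\<Prod>i\<in>V. (h $ i)\<^sup>2)) * LP (insert l V) w k = (ac' (card V) * (\<Prod>i\<in>V. (h $ i)\<^sup>2)) * LP (insert l V) w k"
      using assms by simp
  qed
  then show ?thesis unfolding Aalg_def by simp
qed

lemma Aalg_lincomb: "Aalg (\<lambda>m. c * ac m + d * ac' m) a w k = c * Aalg ac a w k + d * Aalg ac' a w k"
  unfolding Aalg_def
  by (simp add: sum_distrib_left distrib_left distrib_right sum.distrib mult_ac)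

end

lemma node_shift: "node h (k + axis i 1) = node h k + (h $ i) *\<^sub>R axis i 1"
  "node h (k - axis i 1) = node h k - (h $ i) *\<^sub>R axis i 1"
  by (simp_all add: vec_eq_iff node_def axis_def algebra_simps)

lemma eta_bx [simp]: "(h, \<tau>) \<bullet> bx i = h $ i"
  by (simp add: bx_def inner_axis)

lemma eta_bt [simp]: "(h, \<tau>) \<bullet> bt = \<tau>"
  by (simp add: bt_def)

lemma Lam_sample: "Lam h i (\<lambda>j. F (node h j, t)) k = cLam (h, \<tau>) (bx i) F (node h k, t)"
  by (simp add: Lam_def cLam_def node_shift) (simp add: bx_def)

lemma Lam_prod_sample: "Lam_prod h V (\<lambda>j. F (node h j, t)) k = LS (h, \<tau>) V F (node h k, t)"
  using finite[of V]
proof (induction V arbitrary: k rule: finite_induct)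
  case empty
  show ?case by (simp add: Lam_prod_empty)
next
  case (insert i V)
  have "Lam_prod h V (\<lambda>j. F (node h j, t)) = (\<lambda>k. LS (h, \<tau>) V F (node h k, t))"
    by (rule ext) (rule insert.IH)
  then show ?case
    using Lam_sample[of h i "LS (h, \<tau>) V F" t k \<tau>] insert.hyps by (simp add: Lam_prod_insert LS_insert)
qed

lemma Bgen_sample: "Bgen bc h (\<lambda>j. F (node h j, t)) k = Bc bc (h, \<tau>) F (node h k, t)"
  unfolding Bgen_def Bc_def Lam_prod_sample[of h _ F t k \<tau>] by simp

lemma Agen_sample: "Agen ac a h (\<lambda>j. F (node h j, t)) k = Ac ac a (h, \<tau>) F (node h k, t)"
  unfolding Agen_def Ac_def Lam_prod_sample[of h _ F t k \<tau>] by simp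

lemma Bgen_diff: "Bgen bc h (\<lambda>k. v k - w k) k = Bgen bc h v k - Bgen bc h w k"
  using Lam_prod_lin[of h _ v "-1" w] by (simp add: Bgen_def algebra_simps sum_subtractf)

lemma Agen_diff: "Agen ac a h (\<lambda>k. v k - w k) k = Agen ac a h v k - Agen ac a h w k"
  using Lam_prod_lin[of h _ v "-1" w] by (simp add: Agen_def algebra_simps sum_subtractf sum_distrib_left)

lemma mesh_inner_ip: "mesh_inner h N v w = (\<Prod>i\<in>UNIV. h $ i) * ip (inner_nodes N) v w"
  by (simp add: mesh_inner_def ip_def)

lemma mesh_step_pos:
  assumes "\<And>i. 0 < X $ i" "\<And>i. 1 \<le> N $ i"
  shows "0 < mesh_step X N $ i" "mesh_step X N $ i \<le> X $ i"
proof -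
  have "1 \<le> real (N $ i)" using assms(2)[of i] by simp
  then show "0 < mesh_step X N $ i" "mesh_step X N $ i \<le> X $ i"
    using assms(1)[of i] by (simp_all add: mesh_step_def field_simps)
qed

lemma node_in_cbox:
  assumes "\<And>i. 0 < X $ i" "\<And>i. 1 \<le> N $ i" "k \<in> nodes N"
  shows "node (mesh_step X N) k \<in> cbox 0 X"
proof -
  have "0 \<le> node (mesh_step X N) k $ i \<and> node (mesh_step X N) k $ i \<le> X $ i" for i
  proof -
    have k: "0 \<le> k $ i" "k $ i \<le> int (N $ i)" using assms(3) by (simp_all add: nodes_def)
    have "node (mesh_step X N) k $ i \<le> of_int (int (N $ i)) * mesh_step X N $ i"
      unfolding node_def vec_lambda_beta
      using k mesh_step_pos(1)[of X N i] assms by (intro mult_right_mono) (simp_all only: of_int_le_iff less_imp_le)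
    also have "\<dots> = X $ i" using assms(2)[of i] by (simp add: mesh_step_def)
    finally show ?thesis
      using k mesh_step_pos(1)[of X N i] assms by (simp add: node_def less_imp_le)
  qed
  then show ?thesis by (simp add: mem_box_cart)
qed

lemma node_in_frontier:
  assumes X: "\<And>i. 0 < X $ i" and N: "\<And>i. 1 \<le> N $ i" and k: "k \<in> bdry_nodes N"
  shows "node (mesh_step X N) k \<in> frontier (box 0 X)"
proof -
  have kn: "k \<in> nodes N" using k by (simp add: bdry_nodes_def)
  obtain i where "\<not> (1 \<le> k $ i \<and> k $ i \<le> int (N $ i) - 1)"
    using k by (auto simp: bdry_nodes_def inner_nodes_def)
  moreover have "0 \<le> k $ i \<and> k $ i \<le> int (N $ i)" using kn by (simp add: nodes_def)
  ultimately have "k $ i = 0 \<or> k $ i = int (N $ i)" by linarith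
  then have "node (mesh_step X N) k $ i = 0 \<or> node (mesh_step X N) k $ i = X $ i"
    using N[of i] by (auto simp: node_def mesh_step_def)
  then have "node (mesh_step X N) k \<notin> box 0 X" by (auto simp: mem_box_cart intro!: exI[of _ i])
  moreover have "box 0 X \<noteq> {}" using X by (simp add: interval_ne_empty_cart)
  ultimately show ?thesis
    using node_in_cbox[OF X N kn] by (simp add: frontier_def closure_box interior_open[OF open_box])
qed

context mesh_ops
begin

lemma mesh_inner_Aop:
  assumes "scheme_dim sch CARD('n)" "\<And>k. k \<in> nodes N \<Longrightarrow> w k = Ext v k"
  shows "mesh_inner h N (Aop sch a h w) w = (\<Prod>i\<in>UNIV. h $ i) * ip S (Aalg (acoef sch) a v) v"
  unfolding mesh_inner_ip Aop_eq[OF assms(1)]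
  using Agen_Aalg[OF assms(2)] assms(2)[OF inner_subset_nodes] by (simp add: zext_def cong: ip_cong)

lemma mesh_inner_Bop:
  assumes "scheme_dim sch CARD('n)" "\<And>k. k \<in> nodes N \<Longrightarrow> w k = Ext v k"
  shows "mesh_inner h N (Bop sch h w) w = (\<Prod>i\<in>UNIV. h $ i) * ip S (Balg (bcoef sch) v) v"
  unfolding mesh_inner_ip Bop_eq[OF assms(1)]
  using Bgen_Balg[OF assms(2)] assms(2)[OF inner_subset_nodes] by (simp add: zext_def cong: ip_cong)

lemma Ext_Hspace: "Ext w \<in> Hspace N"
  by (simp add: Hspace_def zext_def)

lemma prod_h_pos: "0 < (\<Prod>i\<in>UNIV. h $ i)"
  by (simp add: h prod_pos)

text \<open>
  For two directions \<open>A\<^sub>N\<close> and the operator of the third scheme coincide. For three directions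
  \<open>A\<^bsub>N\<theta>\<^esub>\<close> is the convex combination of the operator of the third scheme, with the weight \<open>\<theta> \<ge> \<epsilon>\<^sub>2\<close>, and
  of \<open>A\<^sub>N \<ge> 0\<close>. So only the operator of the third scheme needs a quantitative bound.
\<close>

lemma Aop_lower_bound:
  assumes sch: "scheme_dim sch CARD('n)" and a: "\<And>i. 0 < a $ i"
    and \<epsilon>: "case sch of Scheme1 \<beta> \<Rightarrow> \<epsilon>\<^sub>2 = 1 | Scheme2 \<beta> \<gamma> \<theta> \<Rightarrow> 0 < \<epsilon>\<^sub>2 \<and> \<epsilon>\<^sub>2 \<le> \<theta> \<and> \<theta> \<le> 1 | Scheme3 \<Rightarrow> \<epsilon>\<^sub>2 = 1"
    and w: "w \<in> Hspace N"
  shows "sqrt \<epsilon>\<^sub>2 * (MIN i\<in>UNIV. a $ i) * (2/3) powr ((real CARD('n) - 1) / 2)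
      * op_norm h N (\<lambda>w k. - Lam_sum h w k) w \<le> op_norm h N (Aop sch a h) w"
proof -
  define \<mu> where "\<mu> = (MIN i\<in>UNIV. a $ i)"
  have \<mu>: "0 \<le> \<mu> \<and> \<mu> \<le> a $ l" for l
    using a unfolding \<mu>_def by (auto intro!: Min.boundedI less_imp_le)
  have Ew: "w k = Ext w k" for k using w by (simp add: Hspace_def zext_def)
  have \<epsilon>0: "0 \<le> \<epsilon>\<^sub>2" using \<epsilon> by (cases sch) auto
  define Y where "Y = (\<Sum>l\<in>UNIV. ip S (L l w) w)"
  have Y: "0 \<le> Y" unfolding Y_def by (intro sum_nonneg L_bounds)
  let ?bar = "ip S (Aalg (\<lambda>m. (1/12) ^ m) a w) w"
  have bar: "\<mu>\<^sup>2 * (2/3) ^ (CARD('n) - 1) * Y \<le> ?bar"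
    unfolding Y_def by (rule Aalg_bar_ge[OF \<mu>])
  have "0 \<le> \<mu>\<^sup>2 * (2/3) ^ (CARD('n) - 1) * Y" using Y by simp
  then have bar0: "0 \<le> ?bar" using bar by linarith
  have "\<epsilon>\<^sub>2 * ?bar \<le> ip S (Aalg (acoef sch) a w) w"
  proof (cases sch)
    case (Scheme1 \<beta>)
    then have n: "CARD('n) = 2" using sch by simp
    have "Aalg (acoef sch) a = Aalg (\<lambda>m. (1/12) ^ m) a"
      by (rule Aalg_cong) (use n Scheme1 in \<open>auto simp: two_terms_def\<close>)
    then show ?thesis using \<epsilon> Scheme1 by simp
  next
    case (Scheme2 \<beta> \<gamma> \<theta>)
    then have n: "CARD('n) = 3" using sch by simp
    have "Aalg (acoef sch) a = Aalg (\<lambda>m. \<theta> * (1/12) ^ m + (1 - \<theta>) * two_terms m) a"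
    proof (rule Aalg_cong)
      fix m assume "m < CARD('n)"
      then have "m = 0 \<or> m = 1 \<or> m = 2" using n by linarith
      then show "acoef sch m = \<theta> * (1/12) ^ m + (1 - \<theta>) * two_terms m"
        using Scheme2 by (auto simp: two_terms_def power2_eq_square field_simps)
    qed
    then have eq: "ip S (Aalg (acoef sch) a w) w = \<theta> * ?bar + (1 - \<theta>) * ip S (Aalg two_terms a w) w"
    proof -
      assume eq: "Aalg (acoef sch) a = Aalg (\<lambda>m. \<theta> * (1/12) ^ m + (1 - \<theta>) * two_terms m) a"
      have "Aalg (acoef sch) a w = (\<lambda>k. \<theta> * Aalg (\<lambda>m. (1/12) ^ m) a w k + (1 - \<theta>) * Aalg two_terms a w k)"
        unfolding eq by (rule ext) (rule Aalg_lincomb)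
      then show ?thesis by (simp only: ip_lin_left ip_scale_left)
    qed
    have "0 \<le> (1 - \<theta>) * ip S (Aalg two_terms a w) w"
      using \<epsilon> Scheme2 n by (intro mult_nonneg_nonneg Aalg_two_terms_nonneg) auto
    moreover have "\<epsilon>\<^sub>2 * ?bar \<le> \<theta> * ?bar" using \<epsilon> Scheme2 bar0 by (intro mult_right_mono) auto
    ultimately show ?thesis unfolding eq by linarith
  next
    case Scheme3
    then have "acoef sch = (\<lambda>m. (1/12) ^ m)" by auto
    then show ?thesis using \<epsilon> Scheme3 by simp
  qed
  moreover have "\<epsilon>\<^sub>2 * (\<mu>\<^sup>2 * (2/3) ^ (CARD('n) - 1) * Y) \<le> \<epsilon>\<^sub>2 * ?bar"
    by (rule mult_left_mono[OF bar \<epsilon>0])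
  ultimately have main: "\<epsilon>\<^sub>2 * (\<mu>\<^sup>2 * (2/3) ^ (CARD('n) - 1) * Y) \<le> ip S (Aalg (acoef sch) a w) w" by linarith
  have LY: "mesh_inner h N (\<lambda>k. - Lam_sum h w k) w = (\<Prod>i\<in>UNIV. h $ i) * Y"
  proof -
    have "- Lam_sum h w k = (\<Sum>l\<in>UNIV. 1 * L l w k)" if "k \<in> S" for k
    proof -
      have "Ext w = w" using Ew by auto
      then show ?thesis using that by (simp add: Lam_sum_def L_def pLam_def zext_def sum_negf)
    qed
    then have "ip S (\<lambda>k. - Lam_sum h w k) w = ip S (\<lambda>k. \<Sum>l\<in>UNIV. 1 * L l w k) w"
      by (intro ip_cong) auto
    then show ?thesis unfolding mesh_inner_ip ip_sum_left Y_def by simp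
  qed
  have pw: "(2/3) powr ((real CARD('n) - 1) / 2) = sqrt ((2/3) ^ (CARD('n) - 1) :: real)"
  proof -
    have "real CARD('n) - 1 = real (CARD('n) - 1)" by (simp add: of_nat_diff Suc_le_eq)
    then have p: "(2/3 :: real) ^ (CARD('n) - 1) = (2/3) powr (real CARD('n) - 1)"
      by (simp only:) (rule powr_realpow[symmetric], simp)
    have "sqrt ((2/3 :: real) powr (real CARD('n) - 1)) = ((2/3) powr (real CARD('n) - 1)) powr (1/2)"
      by (simp add: powr_half_sqrt)
    also have "\<dots> = (2/3) powr ((real CARD('n) - 1) / 2)" by (simp add: powr_powr)
    finally show ?thesis unfolding p ..
  qed
  have "sqrt \<epsilon>\<^sub>2 * \<mu> * (2/3) powr ((real CARD('n) - 1) / 2) * op_norm h N (\<lambda>w k. - Lam_sum h w k) w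
    = sqrt ((\<Prod>i\<in>UNIV. h $ i) * (\<epsilon>\<^sub>2 * (\<mu>\<^sup>2 * (2/3) ^ (CARD('n) - 1) * Y)))"
    unfolding op_norm_def LY pw real_sqrt_mult using \<mu> by simp
  also have "\<dots> \<le> sqrt ((\<Prod>i\<in>UNIV. h $ i) * ip S (Aalg (acoef sch) a w) w)"
    using main prod_h_pos by (intro real_sqrt_le_mono mult_left_mono) auto
  also have "\<dots> = op_norm h N (Aop sch a h) w"
    unfolding op_norm_def mesh_inner_Aop[OF sch Ew] ..
  finally show ?thesis by (simp only: \<mu>_def)
qed

end

section \<open>Error bound and norm bound\<close>

lemma Lam_t_sample:
  assumes "1 \<le> m"
  shows "Lam_t \<tau> (\<lambda>m j. F (node h j, real m * \<tau>)) m j = cLam (h, \<tau>) bt F (node h j, real m * \<tau>)"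
proof -
  have "real (m - 1) * \<tau> = real m * \<tau> - \<tau>" "real (m + 1) * \<tau> = real m * \<tau> + \<tau>"
    using assms by (simp_all add: of_nat_diff algebra_simps)
  then show ?thesis by (simp add: Lam_t_def cLam_def) (simp add: bt_def)
qed

lemma dt_fwd_sample: "dt_fwd \<tau> (\<lambda>m j. F (node h j, real m * \<tau>)) 0 j = fD (h, \<tau>) bt F (node h j, 0)"
  by (simp add: dt_fwd_def fD_def) (simp add: bt_def)

lemma mesh_size_norm: "mesh_size h \<tau> = norm (h, \<tau>)"
  by (simp add: mesh_size_def norm_Pair norm_vec_def L2_set_def sum_nonneg)

context solution
begin

abbreviation F :: "(real^'n) \<times> real \<Rightarrow> real" where "F \<equiv> \<lambda>z. f (fst z) (snd z)"
abbreviation R :: "scheme \<Rightarrow> (real^'n) \<times> real \<Rightarrow> (real^'n) \<times> real \<Rightarrow> real" where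
  "R sch \<equiv> residual (bcoef sch) (acoef sch) a W U F"
abbreviation R0 :: "scheme \<Rightarrow> (real^'n) \<times> real \<Rightarrow> (real^'n) \<times> real \<Rightarrow> real" where
  "R0 sch \<equiv> initial_residual (bcoef sch) (acoef sch) a W U F"

lemma bnd_R:
  "bnd (admissible Basis) 4 (R sch)"
  "bnd (\<lambda>\<eta> z. admissible (range bx) \<eta> z \<and> z + (\<eta> \<bullet> bt) *\<^sub>R bt \<in> Q) 4 (R0 sch)"
proof -
  interpret truncation Q X T a "bcoef sch" "acoef sch" W U F
    by unfold_locales (rule coef_01 W_smooth U_smooth f_eq, assumption?)+
  show "bnd (admissible Basis) 4 (R sch)"
    by (rule truncation_error)
  show "bnd (\<lambda>\<eta> z. admissible (range bx) \<eta> z \<and> z + (\<eta> \<bullet> bt) *\<^sub>R bt \<in> Q) 4 (R0 sch)"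
    by (rule initial_truncation_error)
qed

lemma restr_t_u: "restr_t h \<tau> u = (\<lambda>m j. U (node h j, real m * \<tau>))"
  by (intro ext) (simp add: restr_t_def U_def)

text \<open>
  Inserting the exact solution into the scheme gives the residual sampled at the nodes.
\<close>

lemma residual_sample:
  assumes sch: "scheme_dim sch CARD('n)" and m: "1 \<le> m"
  shows "Bop sch h (\<lambda>j. restr h \<rho> j * Lam_t \<tau> (restr_t h \<tau> u) m j) k
    + (1/12) * \<tau>\<^sup>2 * Aop sch a h (Lam_t \<tau> (restr_t h \<tau> u) m) k + Aop sch a h (restr_t h \<tau> u m) k
    - fN h \<tau> f m k = R sch (h, \<tau>) (node h k, real m * \<tau>)"
proof -
  let ?z = "(node h k, real m * \<tau>)"
  have W: "(\<lambda>j. restr h \<rho> j * Lam_t \<tau> (restr_t h \<tau> u) m j) = (\<lambda>j. cLam (h, \<tau>) bt W (node h j, real m * \<tau>))"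
  proof
    fix j
    have "restr h \<rho> j * Lam_t \<tau> (restr_t h \<tau> u) m j = Lam_t \<tau> (\<lambda>m j. W (node h j, real m * \<tau>)) m j"
      by (simp add: Lam_t_def restr_t_u restr_def W_def algebra_simps)
    then show "restr h \<rho> j * Lam_t \<tau> (restr_t h \<tau> u) m j = cLam (h, \<tau>) bt W (node h j, real m * \<tau>)"
      by (simp only: Lam_t_sample[OF m])
  qed
  have U: "Lam_t \<tau> (restr_t h \<tau> u) m = (\<lambda>j. cLam (h, \<tau>) bt U (node h j, real m * \<tau>))"
    unfolding restr_t_u by (rule ext) (rule Lam_t_sample[OF m])
  have rf: "restr_t h \<tau> f = (\<lambda>m j. F (node h j, real m * \<tau>))"
    by (intro ext) (simp add: restr_t_def)
  have fN: "fN h \<tau> f m k = F ?z + (1/12) * (\<Sum>i\<in>UNIV. (h $ i)\<^sup>2 * cLam (h, \<tau>) (bx i) F ?z) + (1/12) * \<tau>\<^sup>2 * cLam (h, \<tau>) bt F ?z"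
    unfolding fN_def sN_def rf Lam_t_sample[where F = F, OF m] Lam_sample[where F = F and \<tau> = \<tau>] by simp
  show ?thesis
    unfolding Bop_eq[OF sch] Aop_eq[OF sch] W
    unfolding U
    unfolding restr_t_u Bgen_sample[of _ h _ _ k \<tau>] Agen_sample[of _ a h _ _ k \<tau>] fN residual_def
    by simp
qed

lemma W1: "z \<in> Q \<Longrightarrow> (pd Q bt ^^ 1) W z = \<rho> (fst z) * (pd Q bt ^^ 1) U z"
  by (rule W_time) simp_all

text \<open>
  On the first level the data \<open>u\<^sub>1\<close> and \<open>\<rho> u\<^sub>1\<close> are time derivatives of the solution, also at
  boundary nodes. The approximation of \<open>f\<^sub>d\<close> enters with the factor \<open>\<tau>/2\<close>, so its error \<open>\<O>(\<tau>\<^sup>3)\<close> contributes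
  to the fourth order.
\<close>

lemma initial_residual_sample:
  assumes sch: "scheme_dim sch CARD('n)" and N: "\<And>i. 1 \<le> N $ i" and h: "h = mesh_step X N" and k: "k \<in> inner_nodes N"
  shows "Bop sch h (\<lambda>j. restr h \<rho> j * dt_fwd \<tau> (restr_t h \<tau> u) 0 j) k
    + (1/12) * \<tau>\<^sup>2 * Aop sch a h (dt_fwd \<tau> (restr_t h \<tau> u) 0) k + (1/2) * \<tau> * Aop sch a h (restr_t h \<tau> u 0) k
    - u1N a h \<tau> \<rho> u\<^sub>1 k - (1/2) * \<tau> * fN0 h fdh f k
    = R0 sch (h, \<tau>) (node h k, 0) - (1/2) * \<tau> * (fdh k - fd0 T \<tau> f (node h k))"
proof -
  let ?z = "(node h k, 0 :: real)"
  have nd: "node h j \<in> cbox 0 X" if "j \<in> nodes N" for j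
    unfolding h by (rule node_in_cbox[OF X N that])
  have W: "(\<lambda>j. restr h \<rho> j * dt_fwd \<tau> (restr_t h \<tau> u) 0 j) = (\<lambda>j. fD (h, \<tau>) bt W (node h j, 0))"
  proof
    fix j
    have "restr h \<rho> j * dt_fwd \<tau> (restr_t h \<tau> u) 0 j = dt_fwd \<tau> (\<lambda>m j. W (node h j, real m * \<tau>)) 0 j"
      by (simp add: dt_fwd_def restr_t_u restr_def W_def right_diff_distrib)
    then show "restr h \<rho> j * dt_fwd \<tau> (restr_t h \<tau> u) 0 j = fD (h, \<tau>) bt W (node h j, 0)"
      by (simp only: dt_fwd_sample)
  qed
  have U: "dt_fwd \<tau> (restr_t h \<tau> u) 0 = (\<lambda>j. fD (h, \<tau>) bt U (node h j, 0))"
    unfolding restr_t_u by (rule ext) (rule dt_fwd_sample)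
  have U0: "restr_t h \<tau> u 0 = (\<lambda>j. U (node h j, 0))"
    unfolding restr_t_u by simp
  have u1: "restr h u\<^sub>1 j = (pd Q bt ^^ 1) U (node h j, 0)" if "j \<in> nodes N" for j
    using u1_eq[OF nd[OF that]] by (simp add: restr_def)
  have \<rho>u1: "restr h (\<lambda>x. \<rho> x * u\<^sub>1 x) j = (pd Q bt ^^ 1) W (node h j, 0)" if "j \<in> nodes N" for j
    using u1_eq[OF nd[OF that]] W1[of "(node h j, 0)"] nd[OF that] T by (simp add: restr_def Q_def)
  have L1: "Lam h i (restr h u\<^sub>1) k = cLam (h, \<tau>) (bx i) ((pd Q bt ^^ 1) U) ?z" for i
    using Lam_prod_cong_inner[where v = "restr h u\<^sub>1" and w = "\<lambda>j. (pd Q bt ^^ 1) U (node h j, 0)" and h = h and S = "{i}", OF u1 k] unfolding Lam_prod_single Lam_sample[where \<tau> = \<tau>] .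
  have LW: "Lam h i (restr h (\<lambda>x. \<rho> x * u\<^sub>1 x)) k = cLam (h, \<tau>) (bx i) ((pd Q bt ^^ 1) W) ?z" for i
    using Lam_prod_cong_inner[where v = "restr h (\<lambda>x. \<rho> x * u\<^sub>1 x)" and w = "\<lambda>j. (pd Q bt ^^ 1) W (node h j, 0)" and h = h and S = "{i}", OF \<rho>u1 k] unfolding Lam_prod_single Lam_sample[where \<tau> = \<tau>] .
  have u1N: "u1N a h \<tau> \<rho> u\<^sub>1 k = (pd Q bt ^^ 1) W ?z + (1/12) * (\<Sum>i\<in>UNIV. (h $ i)\<^sup>2 * cLam (h, \<tau>) (bx i) ((pd Q bt ^^ 1) W) ?z)
     + (1/12) * \<tau>\<^sup>2 * (\<Sum>l\<in>UNIV. (a $ l)\<^sup>2 * cLam (h, \<tau>) (bx l) ((pd Q bt ^^ 1) U) ?z)"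
    unfolding u1N_def sN_def L1 LW \<rho>u1[OF inner_subset_nodes[OF k]] ..
  have rf: "restr h (\<lambda>x. f x 0) = (\<lambda>j. F (node h j, 0))" by (rule ext) (simp add: restr_def)
  have fN0: "fN0 h fdh f k = fdh k + (1/12) * (\<Sum>i\<in>UNIV. (h $ i)\<^sup>2 * cLam (h, \<tau>) (bx i) F ?z)"
    unfolding fN0_def rf Lam_sample[where F = F and \<tau> = \<tau>] ..
  note ft = f_time[OF nd[OF inner_subset_nodes[OF k]]]
  have fd0: "fd0 T \<tau> f (node h k) = F ?z
      + (1/3) * \<tau> * ((pd Q bt ^^ 3) W ?z - (\<Sum>l\<in>UNIV. (a $ l)\<^sup>2 * (pd Q (bx l) ^^ 2) ((pd Q bt ^^ 1) U) ?z))
      + (1/12) * \<tau>\<^sup>2 * ((pd Q bt ^^ 4) W ?z - (\<Sum>l\<in>UNIV. (a $ l)\<^sup>2 * (pd Q (bx l) ^^ 2) ((pd Q bt ^^ 2) U) ?z))"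
    unfolding fd0_def ft by simp
  show ?thesis
    unfolding Bop_eq[OF sch] Aop_eq[OF sch] W
    unfolding U U0
    unfolding Bgen_sample[of _ h _ _ k \<tau>] Agen_sample[of _ a h _ _ k \<tau>]
      u1N fN0 initial_residual_def eta_bt eta_bx fst_conv snd_conv fd0
    by (simp add: algebra_simps)
qed

end

context solution
begin

text \<open>
  The three schemes differ in the source of the bound \<open>A\<^sub>h \<le> q B\<^sub>h\<close> only: it is assumed in the first
  two and holds with \<open>q = 6 (a\<^sub>1\<^sup>2/h\<^sub>1\<^sup>2 + \<dots> + a\<^sub>n\<^sup>2/h\<^sub>n\<^sup>2)\<close> in the third.
\<close>

lemma step_condition_bound:
  assumes sch: "scheme_dim sch CARD('n)" and h: "\<And>i. 0 < h $ i"
    and step: "step_condition sch a h N \<tau> \<rho>min \<epsilon>\<^sub>0"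
  obtains q where "(1/6) * \<tau>\<^sup>2 * q \<le> (1 - \<epsilon>\<^sub>0\<^sup>2) * \<rho>min"
    "\<And>w. ip (inner_nodes N) (mesh_ops.Aalg h N (acoef sch) a w) w
      \<le> q * ip (inner_nodes N) (mesh_ops.Balg h N (bcoef sch) w) w"
proof -
  interpret mesh_ops h N by unfold_locales (rule h)
  show ?thesis
  proof (cases "sch = Scheme3")
    case True
    then have c: "acoef sch = (\<lambda>m. (1/12) ^ m)" "bcoef sch = (\<lambda>m. (1/12) ^ m)" by auto
    show ?thesis
    proof (rule that)
      show "(1/6) * \<tau>\<^sup>2 * (6 * (\<Sum>l\<in>UNIV. (a $ l)\<^sup>2 / (h $ l)\<^sup>2)) \<le> (1 - \<epsilon>\<^sub>0\<^sup>2) * \<rho>min"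
        using step True by (simp add: step_condition_def)
    qed (unfold c, rule Aalg_bar_le)
  next
    case False
    then obtain \<alpha> where \<alpha>: "op_le h N (Aop sch a h) (\<lambda>w k. \<alpha>\<^sup>2 * Bop sch h w k)"
      "(1/6) * \<tau>\<^sup>2 * \<alpha>\<^sup>2 \<le> (1 - \<epsilon>\<^sub>0\<^sup>2) * \<rho>min"
      using step by (auto simp: step_condition_def)
    show ?thesis
    proof (rule that[OF \<alpha>(2)])
      fix w
      have "mesh_inner h N (Aop sch a h (Ext w)) (Ext w) \<le> mesh_inner h N (\<lambda>k. \<alpha>\<^sup>2 * Bop sch h (Ext w) k) (Ext w)"
        using \<alpha>(1) Ext_Hspace[of w] by (simp add: op_le_def)
      also have "\<dots> = \<alpha>\<^sup>2 * mesh_inner h N (Bop sch h (Ext w)) (Ext w)"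
        unfolding mesh_inner_ip ip_scale_left by simp
      finally have "(\<Prod>i\<in>UNIV. h $ i) * ip S (Aalg (acoef sch) a w) w
          \<le> (\<Prod>i\<in>UNIV. h $ i) * (\<alpha>\<^sup>2 * ip S (Balg (bcoef sch) w) w)"
        unfolding mesh_inner_Aop[OF sch refl] mesh_inner_Bop[OF sch refl] by (simp add: mult.left_commute)
      then show "ip S (Aalg (acoef sch) a w) w \<le> \<alpha>\<^sup>2 * ip S (Balg (bcoef sch) w) w"
        using prod_h_pos by (simp add: mult_le_cancel_left_pos)
    qed
  qed
qed

text \<open>
  The error extended by zero from the inner nodes satisfies the scheme with the residuals as
  right-hand sides and zero initial and boundary values; the energy estimate bounds it by the norms of
  these residuals. The weighted number of inner nodes is at most the volume of the domain, which
  passes from pointwise bounds to norms.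
\<close>

theorem convergence:
  assumes sch: "scheme_dim sch CARD('n)" and \<rho>min: "0 < \<rho>min" "\<And>x. x \<in> cbox 0 X \<Longrightarrow> \<rho>min \<le> \<rho> x"
    and \<nu>: "0 < \<nu>\<^sub>0" "\<nu>\<^sub>0 \<le> \<nu>" and \<epsilon>: "0 < \<epsilon>\<^sub>0" "\<epsilon>\<^sub>0 < 1"
  shows "\<exists>C. \<forall>(N::nat^'n) M h \<tau> fdh v.
    (\<forall>i. 1 \<le> N $ i) \<and> 2 \<le> M \<and> h = mesh_step X N \<and> \<tau> = T / real M \<and>
    op_pos h N (Bop sch h) \<and> op_pos h N (Aop sch a h) \<and>
    op_le h N (\<lambda>w k. \<nu>\<^sub>0 * w k) (Bop sch h) \<and> op_le h N (Bop sch h) (\<lambda>w k. \<nu> * w k) \<and>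
    step_condition sch a h N \<tau> \<rho>min \<epsilon>\<^sub>0 \<and>
    (\<forall>k\<in>inner_nodes N. \<bar>fdh k - fd0 T \<tau> f (node h k)\<bar> \<le> c * \<tau> ^ 3) \<and>
    solves_scheme sch a h N \<tau> M \<rho> f g u\<^sub>0 u\<^sub>1 fdh v
    \<longrightarrow> (let e = (\<lambda>m k. restr_t h \<tau> u m k - v m k) in
         (MAX m\<in>{1..M}. \<epsilon>\<^sub>0 * mesh_norm h N (\<lambda>k. sqrt (restr h \<rho> k) * dt_bar \<tau> e m k)
                       + op_norm h N (Aop sch a h) (st_bar e m))
         \<le> C * mesh_size h \<tau> ^ 4)"
proof -
  obtain C1 where C1: "0 \<le> C1" "\<And>\<eta> z. admissible Basis \<eta> z \<Longrightarrow> \<bar>R sch \<eta> z\<bar> \<le> C1 * norm \<eta> ^ 4"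
    using bnd_R(1)[of sch] by (rule bndE) auto
  obtain C0 where C0: "0 \<le> C0" "\<And>\<eta> z. admissible (range bx) \<eta> z \<and> z + (\<eta> \<bullet> bt) *\<^sub>R bt \<in> Q \<Longrightarrow> \<bar>R0 sch \<eta> z\<bar> \<le> C0 * norm \<eta> ^ 4"
    using bnd_R(2)[of sch] by (rule bndE) auto
  define Cr where "Cr = C1 + C0 + \<bar>c\<bar>"
  have Cr: "C1 \<le> Cr" "C0 + \<bar>c\<bar> \<le> Cr" "0 \<le> Cr" using C1(1) C0(1) by (simp_all add: Cr_def)
  define C where "C = (1 + sqrt \<nu>) * ((1 + T) * (Cr * sqrt (\<Prod>i\<in>UNIV. X $ i) / (\<nu>\<^sub>0 * (\<epsilon>\<^sub>0 * sqrt \<rho>min))))"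
  show ?thesis
  proof (rule exI[of _ C], intro allI impI, elim conjE)
    fix N :: "nat^'n" and M h \<tau> fdh v
    assume N: "\<forall>i. 1 \<le> N $ i" and M: "2 \<le> M" and hX: "h = mesh_step X N" and \<tau>: "\<tau> = T / real M"
      and Bpos: "op_pos h N (Bop sch h)" and Apos: "op_pos h N (Aop sch a h)"
      and Blow: "op_le h N (\<lambda>w k. \<nu>\<^sub>0 * w k) (Bop sch h)" and Bup: "op_le h N (Bop sch h) (\<lambda>w k. \<nu> * w k)"
      and step: "step_condition sch a h N \<tau> \<rho>min \<epsilon>\<^sub>0"
      and fdh: "\<forall>k\<in>inner_nodes N. \<bar>fdh k - fd0 T \<tau> f (node h k)\<bar> \<le> c * \<tau> ^ 3"
      and solves: "solves_scheme sch a h N \<tau> M \<rho> f g u\<^sub>0 u\<^sub>1 fdh v"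
    define \<eta> where "\<eta> = (h, \<tau>)"
    have N1: "1 \<le> N $ i" for i using N by simp
    have h_pos: "0 < h $ i" "h $ i \<le> X $ i" for i
      unfolding hX by (rule mesh_step_pos[OF X N1])+
    have \<tau>_pos: "0 < \<tau>" and M\<tau>: "real M * \<tau> = T" using T M by (simp_all add: \<tau>)
    have \<tau>T: "\<tau> \<le> T" using T M by (simp add: \<tau> field_simps)
    interpret mesh_ops h N by unfold_locales (rule h_pos)
    have node_cbox: "node h k \<in> cbox 0 X" if "k \<in> nodes N" for k
      unfolding hX by (rule node_in_cbox[OF X N1 that])

    have pos: "pos \<eta>" unfolding pos_def Basis_cyl using h_pos \<tau>_pos by (auto simp: \<eta>_def)
    have \<eta>Q: "\<eta> \<in> Q"
      using h_pos \<tau>_pos \<tau>T by (auto simp: \<eta>_def Q_def mem_box_cart less_imp_le)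
    have nbr: "k + axis i 1 \<in> nodes N" "k - axis i 1 \<in> nodes N" if "k \<in> S" for k i
    proof -
      have "1 \<le> k $ j \<and> k $ j \<le> int (N $ j) - 1" for j using that by (simp add: inner_nodes_def)
      then have "0 \<le> (k + axis i 1) $ j \<and> (k + axis i 1) $ j \<le> int (N $ j)"
        "0 \<le> (k - axis i 1) $ j \<and> (k - axis i 1) $ j \<le> int (N $ j)" for j
        by (smt (verit) axis_nth vector_add_component vector_minus_component)+
      then show "k + axis i 1 \<in> nodes N" "k - axis i 1 \<in> nodes N" by (simp_all add: nodes_def)
    qed
    have adm_x: "admissible (range bx) \<eta> (node h k, t)" if "k \<in> S" "t \<in> {0..T}" for k t
    proof -
      have "(node h k, t) + (\<eta> \<bullet> bx i) *\<^sub>R bx i \<in> Q \<and> (node h k, t) - (\<eta> \<bullet> bx i) *\<^sub>R bx i \<in> Q" for i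
        using node_cbox[OF nbr(1)[OF that(1)], of i] node_cbox[OF nbr(2)[OF that(1)], of i] that(2)
        by (simp add: \<eta>_def node_shift) (simp add: bx_def Q_def)
      moreover have "(node h k, t) \<in> Q"
        using node_cbox[OF inner_subset_nodes[OF that(1)]] that(2) by (simp add: Q_def)
      ultimately show ?thesis
        using pos \<eta>Q unfolding admissible_def D_def by simp
    qed
    have adm: "admissible Basis \<eta> (node h k, real m * \<tau>)" if "k \<in> S" "1 \<le> m" "m < M" for k m
    proof -
      have "real (m + 1) * \<tau> \<le> real M * \<tau>" "real 1 * \<tau> \<le> real m * \<tau>"
        using that \<tau>_pos by (intro mult_right_mono; simp)+
      then have t: "0 \<le> real m * \<tau> - \<tau>" "real m * \<tau> + \<tau> \<le> T" by (simp_all add: algebra_simps flip: M\<tau>)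
      have x: "admissible (range bx) \<eta> (node h k, real m * \<tau>)" by (rule adm_x[OF that(1)]) (use t \<tau>_pos in auto)
      have "(node h k, real m * \<tau>) + (\<eta> \<bullet> bt) *\<^sub>R bt \<in> Q \<and> (node h k, real m * \<tau>) - (\<eta> \<bullet> bt) *\<^sub>R bt \<in> Q"
        using t \<tau>_pos node_cbox[OF inner_subset_nodes[OF that(1)]] by (simp add: \<eta>_def) (simp add: bt_def Q_def)
      then show ?thesis using x by (auto simp: admissible_def D_def Basis_cyl)
    qed

    define e where "e = (\<lambda>m k. restr_t h \<tau> u m k - v m k)"
    define E where "E = (\<lambda>m. Ext (e m))"
    have e0: "e 0 k = 0" if "k \<in> nodes N" for k
      using solves that u0_eq[OF node_cbox[OF that]] by (simp add: e_def restr_t_def solves_scheme_def restr_def)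
    \<comment> \<open>the error vanishes at boundary nodes, so its extension by zero agrees with it on the whole mesh\<close>
    have eE: "e m k = E m k" if "m \<le> M" "k \<in> nodes N" for m k
    proof (cases "k \<in> S")
      case False
      have "e m k = 0"
      proof (cases "m = 0")
        case False
        have k: "k \<in> bdry_nodes N" using that(2) \<open>k \<notin> S\<close> by (simp add: bdry_nodes_def)
        have t: "0 < real m * \<tau>" using False \<tau>_pos by simp
        have "real m * \<tau> \<le> real M * \<tau>" using that(1) \<tau>_pos by (intro mult_right_mono) auto
        then have "u (node h k) (real m * \<tau>) = g (node h k) (real m * \<tau>)"
          using g_eq[OF node_in_frontier[OF X N1 k] t] by (simp add: M\<tau> hX)
        then show ?thesis using solves k that(1) False by (simp add: e_def restr_t_def solves_scheme_def)
      qed (use e0 that in simp)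
      then show ?thesis using False by (simp add: E_def zext_def)
    qed (simp add: E_def zext_def)

    let ?A = "Aalg (acoef sch) a" and ?B = "Balg (bcoef sch)"
    \<comment> \<open>residual of the equation on the first level at m = 0, of the three-level equation at m > 0\<close>
    define \<psi> where "\<psi> = (\<lambda>m k. if m = 0 then R0 sch \<eta> (node h k, 0) - (1/2) * \<tau> * (fdh k - fd0 T \<tau> f (node h k))
      else R sch \<eta> (node h k, real m * \<tau>))"
    have eq: "?B (\<lambda>j. restr h \<rho> j * ((E (m + 1) j - 2 * E m j + E (m - 1) j) / \<tau>\<^sup>2)) k
      + (1/12) * \<tau>\<^sup>2 * ?A (\<lambda>j. (E (m + 1) j - 2 * E m j + E (m - 1) j) / \<tau>\<^sup>2) k + ?A (E m) k = \<psi> m k"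
      if m: "1 \<le> m" "m < M" and k: "k \<in> S" for m k
    proof -
      have ee: "Lam_t \<tau> e m j = Ext (\<lambda>j. (E (m + 1) j - 2 * E m j + E (m - 1) j) / \<tau>\<^sup>2) j"
        "restr h \<rho> j * Lam_t \<tau> e m j = Ext (\<lambda>j. restr h \<rho> j * ((E (m + 1) j - 2 * E m j + E (m - 1) j) / \<tau>\<^sup>2)) j"
        "e m j = Ext (E m) j" if j: "j \<in> nodes N" for j
        using eE[OF _ j, of "m + 1"] eE[OF _ j, of m] eE[OF _ j, of "m - 1"] m
        by (auto simp: Lam_t_def zext_def E_def)
      have le: "Lam_t \<tau> e m = (\<lambda>j. Lam_t \<tau> (restr_t h \<tau> u) m j - Lam_t \<tau> v m j)"
        by (rule ext) (simp add: Lam_t_def e_def diff_divide_distrib add_divide_distrib)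
      have "Bop sch h (\<lambda>j. restr h \<rho> j * Lam_t \<tau> e m j) k + (1/12) * \<tau>\<^sup>2 * Aop sch a h (Lam_t \<tau> e m) k + Aop sch a h (e m) k = \<psi> m k"
      proof -
        have "Bop sch h (\<lambda>j. restr h \<rho> j * Lam_t \<tau> v m j) k + (1/12) * \<tau>\<^sup>2 * Aop sch a h (Lam_t \<tau> v m) k
          + Aop sch a h (v m) k = fN h \<tau> f m k"
          using solves m k by (simp add: solves_scheme_def)
        moreover have "\<psi> m k = R sch (h, \<tau>) (node h k, real m * \<tau>)" using m by (simp add: \<psi>_def \<eta>_def)
        moreover note residual_sample[OF sch m(1), of h \<tau> k]
        ultimately show ?thesis
          unfolding le
          unfolding e_def right_diff_distrib Bop_eq[OF sch] Aop_eq[OF sch] Bgen_diff Agen_diff by linarith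
      qed
      moreover have "Bop sch h (\<lambda>j. restr h \<rho> j * Lam_t \<tau> e m j) k
        = ?B (\<lambda>j. restr h \<rho> j * ((E (m + 1) j - 2 * E m j + E (m - 1) j) / \<tau>\<^sup>2)) k"
        unfolding Bop_eq[OF sch] by (rule Bgen_Balg[OF _ k]) (rule ee(2))
      moreover have "Aop sch a h (Lam_t \<tau> e m) k = ?A (\<lambda>j. (E (m + 1) j - 2 * E m j + E (m - 1) j) / \<tau>\<^sup>2) k"
        unfolding Aop_eq[OF sch] by (rule Agen_Aalg[OF _ k]) (rule ee(1))
      moreover have "Aop sch a h (e m) k = ?A (E m) k"
        unfolding Aop_eq[OF sch] by (rule Agen_Aalg[OF _ k]) (rule ee(3))
      ultimately show ?thesis by (simp only:)
    qed
    have eq0: "?B (\<lambda>j. restr h \<rho> j * ((E 1 j - E 0 j) / \<tau>)) k + (1/12) * \<tau>\<^sup>2 * ?A (\<lambda>j. (E 1 j - E 0 j) / \<tau>) k = \<psi> 0 k"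
      if k: "k \<in> S" for k
    proof -
      have ee: "dt_fwd \<tau> e 0 j = Ext (\<lambda>j. (E 1 j - E 0 j) / \<tau>) j"
        "restr h \<rho> j * dt_fwd \<tau> e 0 j = Ext (\<lambda>j. restr h \<rho> j * ((E 1 j - E 0 j) / \<tau>)) j"
        "e 0 j = Ext (\<lambda>_. 0) j" if j: "j \<in> nodes N" for j
        using eE[OF _ j, of 1] eE[OF _ j, of 0] M e0[OF j]
        by (auto simp: dt_fwd_def zext_def E_def)
      have le: "dt_fwd \<tau> e 0 = (\<lambda>j. dt_fwd \<tau> (restr_t h \<tau> u) 0 j - dt_fwd \<tau> v 0 j)"
        by (rule ext) (simp add: dt_fwd_def e_def diff_divide_distrib)
      have "Bop sch h (\<lambda>j. restr h \<rho> j * dt_fwd \<tau> e 0 j) k + (1/12) * \<tau>\<^sup>2 * Aop sch a h (dt_fwd \<tau> e 0) k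
        + (1/2) * \<tau> * Aop sch a h (e 0) k = \<psi> 0 k"
      proof -
        have "Bop sch h (\<lambda>j. restr h \<rho> j * dt_fwd \<tau> v 0 j) k + (1/12) * \<tau>\<^sup>2 * Aop sch a h (dt_fwd \<tau> v 0) k
          + (1/2) * \<tau> * Aop sch a h (v 0) k = u1N a h \<tau> \<rho> u\<^sub>1 k + (1/2) * \<tau> * fN0 h fdh f k"
          using solves k by (simp add: solves_scheme_def)
        moreover have "\<psi> 0 k = R0 sch (h, \<tau>) (node h k, 0) - (1/2) * \<tau> * (fdh k - fd0 T \<tau> f (node h k))"
          by (simp add: \<psi>_def \<eta>_def)
        moreover note initial_residual_sample[OF sch N1 hX k, of \<tau> fdh]
        ultimately show ?thesis
          unfolding le
          unfolding e_def right_diff_distrib Bop_eq[OF sch] Aop_eq[OF sch] Bgen_diff Agen_diff by linarith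
      qed
      moreover have "Bop sch h (\<lambda>j. restr h \<rho> j * dt_fwd \<tau> e 0 j) k = ?B (\<lambda>j. restr h \<rho> j * ((E 1 j - E 0 j) / \<tau>)) k"
        unfolding Bop_eq[OF sch] by (rule Bgen_Balg[OF _ k]) (rule ee(2))
      moreover have "Aop sch a h (dt_fwd \<tau> e 0) k = ?A (\<lambda>j. (E 1 j - E 0 j) / \<tau>) k"
        unfolding Aop_eq[OF sch] by (rule Agen_Aalg[OF _ k]) (rule ee(1))
      moreover have "Aop sch a h (e 0) k = ?A (\<lambda>_. 0) k"
        unfolding Aop_eq[OF sch] by (rule Agen_Aalg[OF _ k]) (rule ee(3))
      ultimately show ?thesis by (simp only: alg_0[OF Aalg_alg] mult_zero_right add_0_right)
    qed

    have \<psi>_le: "\<bar>\<psi> m k\<bar> \<le> Cr * norm \<eta> ^ 4" if "m < M" "k \<in> S" for m k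
    proof (cases "m = 0")
      case True
      have "(node h k, 0) + (\<eta> \<bullet> bt) *\<^sub>R bt \<in> Q"
        using \<tau>_pos \<tau>T node_cbox[OF inner_subset_nodes[OF that(2)]] by (simp add: \<eta>_def) (simp add: bt_def Q_def)
      then have "\<bar>R0 sch \<eta> (node h k, 0)\<bar> \<le> C0 * norm \<eta> ^ 4"
        using C0(2)[of \<eta> "(node h k, 0)"] adm_x[OF that(2), of 0] T by simp
      moreover have "\<bar>(1/2) * \<tau> * (fdh k - fd0 T \<tau> f (node h k))\<bar> \<le> \<bar>c\<bar> * norm \<eta> ^ 4"
      proof -
        have n: "\<tau> \<le> norm \<eta>" using Basis_le_norm[OF bt_Basis, of \<eta>] \<tau>_pos by (simp add: \<eta>_def)
        have "\<bar>fdh k - fd0 T \<tau> f (node h k)\<bar> \<le> \<bar>c\<bar> * \<tau> ^ 3"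
          using fdh that(2) \<tau>_pos by (meson abs_ge_self mult_right_mono order_trans zero_le_power less_imp_le)
        then have "((1/2) * \<tau>) * \<bar>fdh k - fd0 T \<tau> f (node h k)\<bar> \<le> \<tau> * (\<bar>c\<bar> * \<tau> ^ 3)"
          using \<tau>_pos by (intro mult_mono) auto
        also have "\<dots> = \<bar>c\<bar> * \<tau> ^ 4" by (simp add: power4_eq_xxxx power3_eq_cube)
        also have "\<dots> \<le> \<bar>c\<bar> * norm \<eta> ^ 4" using n \<tau>_pos by (intro mult_left_mono power_mono) auto
        finally show ?thesis using \<tau>_pos by (simp add: abs_mult)
      qed
      ultimately have "\<bar>\<psi> m k\<bar> \<le> (C0 + \<bar>c\<bar>) * norm \<eta> ^ 4"
        unfolding \<psi>_def using True by (simp add: distrib_right)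
      also have "\<dots> \<le> Cr * norm \<eta> ^ 4" using Cr by (intro mult_right_mono) auto
      finally show ?thesis .
    next
      case False
      have "\<bar>\<psi> m k\<bar> \<le> C1 * norm \<eta> ^ 4"
        using C1(2)[OF adm[OF that(2) _ that(1)]] False by (simp add: \<psi>_def)
      also have "\<dots> \<le> Cr * norm \<eta> ^ 4" using Cr by (intro mult_right_mono) auto
      finally show ?thesis .
    qed
    define \<delta> where "\<delta> = Cr * norm \<eta> ^ 4 * sqrt (real (card S))"
    have \<psi>_norm: "sqrt (ip S (\<psi> m) (\<psi> m)) \<le> \<delta>" if "m < M" for m
    proof -
      have "ip S (\<psi> m) (\<psi> m) \<le> (\<Sum>k\<in>S. (Cr * norm \<eta> ^ 4)\<^sup>2)"
        unfolding ip_def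
      proof (rule sum_mono)
        fix k assume "k \<in> S"
        then have "\<bar>\<psi> m k\<bar>\<^sup>2 \<le> (Cr * norm \<eta> ^ 4)\<^sup>2" by (intro power_mono \<psi>_le that) auto
        then show "\<psi> m k * \<psi> m k \<le> (Cr * norm \<eta> ^ 4)\<^sup>2" by (simp add: power2_eq_square)
      qed
      then have "sqrt (ip S (\<psi> m) (\<psi> m)) \<le> sqrt (real (card S) * (Cr * norm \<eta> ^ 4)\<^sup>2)"
        by (intro real_sqrt_le_mono) simp
      also have "\<dots> = \<delta>" using Cr(3) by (simp add: \<delta>_def real_sqrt_mult)
      finally show ?thesis .
    qed

    obtain q where q: "(1/6) * \<tau>\<^sup>2 * q \<le> (1 - \<epsilon>\<^sub>0\<^sup>2) * \<rho>min" "\<And>w. ip S (?A w) w \<le> q * ip S (?B w) w"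
      using step_condition_bound[OF sch h_pos(1) step] by auto
    let ?P = "\<Prod>i\<in>UNIV. h $ i"
    note Pp = prod_h_pos
    have scaled: "mesh_inner h N (\<lambda>k. x * Ext w k) (Ext w) = ?P * (x * ip S w w)" for x w
      unfolding mesh_inner_ip ip_scale_left by simp
    interpret energy_scheme S "pLam h N" ?A ?B \<nu>\<^sub>0 \<nu> q "restr h \<rho>" \<rho>min \<tau> \<epsilon>\<^sub>0
    proof
      show "?A \<in> alg" "?B \<in> alg" by (rule Aalg_alg Balg_alg)+
      show "psd S ?A"
        unfolding psd_def
      proof
        fix w
        show "0 \<le> ip S (?A w) w"
        proof (cases "Ext w = (\<lambda>_. 0)")
          case True
          have "?A w = ?A (Ext w)" by (rule alg_zext[OF Aalg_alg, symmetric])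
          also have "\<dots> = (\<lambda>_. 0)" unfolding True by (rule alg_0[OF Aalg_alg])
          finally show ?thesis by (simp add: ip_def)
        next
          case False
          then have "0 < mesh_inner h N (Aop sch a h (Ext w)) (Ext w)"
            using Apos Ext_Hspace[of w] unfolding op_pos_def by blast
          then show ?thesis
            unfolding mesh_inner_Aop[OF sch refl] using Pp by (simp add: zero_less_mult_iff)
        qed
      qed
      show "0 < \<nu>\<^sub>0" "0 < \<nu>" using \<nu> by simp_all
      fix w
      have "mesh_inner h N (\<lambda>k. \<nu>\<^sub>0 * Ext w k) (Ext w) \<le> mesh_inner h N (Bop sch h (Ext w)) (Ext w)"
        using Blow Ext_Hspace[of w] by (simp add: op_le_def)
      then show "\<nu>\<^sub>0 * ip S w w \<le> ip S (?B w) w"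
        unfolding scaled mesh_inner_Bop[OF sch refl] using Pp by (simp add: mult_le_cancel_left_pos)
      have "mesh_inner h N (Bop sch h (Ext w)) (Ext w) \<le> mesh_inner h N (\<lambda>k. \<nu> * Ext w k) (Ext w)"
        using Bup Ext_Hspace[of w] by (simp add: op_le_def)
      then show "ip S (?B w) w \<le> \<nu> * ip S w w"
        unfolding scaled mesh_inner_Bop[OF sch refl] using Pp by (simp add: mult_le_cancel_left_pos)
      show "ip S (?A w) w \<le> q * ip S (?B w) w" by (rule q)
      show "0 < \<rho>min" "0 < \<tau>" "0 < \<epsilon>\<^sub>0" "\<epsilon>\<^sub>0 < 1" by (rule \<rho>min \<tau>_pos \<epsilon>)+
      show "\<rho>min \<le> restr h \<rho> k" if "k \<in> S" for k
        unfolding restr_def by (rule \<rho>min(2)[OF node_cbox[OF inner_subset_nodes[OF that]]])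
      show "(1/6) * \<tau>\<^sup>2 * q \<le> (1 - \<epsilon>\<^sub>0\<^sup>2) * \<rho>min" by (rule q)
    qed

    have bound: "\<epsilon>\<^sub>0 * mesh_norm h N (\<lambda>k. sqrt (restr h \<rho> k) * dt_bar \<tau> e m k) + op_norm h N (Aop sch a h) (st_bar e m)
      \<le> C * mesh_size h \<tau> ^ 4" if m: "m \<in> {1..M}" for m
    proof -
      let ?d = "\<lambda>k. (E m k - E (m - 1) k) / \<tau>" and ?s = "\<lambda>k. (E (m - 1) k + E m k) / 2"
      have m1: "1 \<le> m" "m \<le> M" "m - 1 \<le> M" using m by auto
      have main: "\<epsilon>\<^sub>0 * sqrt (ip S (\<lambda>k. restr h \<rho> k * ?d k) ?d) + sqrt (ip S (?A ?s) ?s)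
        \<le> (1 + sqrt \<nu>) * ((1 + real M * \<tau>) * (\<delta> / (\<nu>\<^sub>0 * \<kappa>)))"
      proof (rule energy_estimate[OF _ eq eq0 \<psi>_norm m1(1,2)])
        show "E 0 k = 0" if "k \<in> S" for k
          using e0[OF inner_subset_nodes[OF that]] by (simp add: E_def zext_def)
      qed
      have d: "mesh_norm h N (\<lambda>k. sqrt (restr h \<rho> k) * dt_bar \<tau> e m k) = sqrt ?P * sqrt (ip S (\<lambda>k. restr h \<rho> k * ?d k) ?d)"
      proof -
        have "ip S (\<lambda>k. sqrt (restr h \<rho> k) * dt_bar \<tau> e m k) (\<lambda>k. sqrt (restr h \<rho> k) * dt_bar \<tau> e m k)
          = ip S (\<lambda>k. restr h \<rho> k * ?d k) ?d"
          unfolding ip_def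
        proof (rule sum.cong[OF refl])
          fix k assume k: "k \<in> S"
          have "0 \<le> restr h \<rho> k"
            using \<rho>min \<rho>[OF k] by linarith
          then have "sqrt (restr h \<rho> k) * sqrt (restr h \<rho> k) = restr h \<rho> k" by simp
          moreover have "dt_bar \<tau> e m k = ?d k"
            using k by (simp add: dt_bar_def E_def zext_def)
          ultimately show "sqrt (restr h \<rho> k) * dt_bar \<tau> e m k * (sqrt (restr h \<rho> k) * dt_bar \<tau> e m k)
            = restr h \<rho> k * ?d k * ?d k"
            by (metis (no_types) mult.assoc mult.left_commute)
        qed
        then show ?thesis unfolding mesh_norm_def mesh_inner_ip real_sqrt_mult by simp
      qed
      have s: "op_norm h N (Aop sch a h) (st_bar e m) = sqrt ?P * sqrt (ip S (?A ?s) ?s)"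
      proof -
        have "st_bar e m k = Ext ?s k" if "k \<in> nodes N" for k
          using eE[OF m1(2) that] eE[OF m1(3) that] by (auto simp: st_bar_def zext_def E_def)
        then have "mesh_inner h N (Aop sch a h (st_bar e m)) (st_bar e m) = ?P * ip S (?A ?s) ?s"
          by (rule mesh_inner_Aop[OF sch])
        then show ?thesis unfolding op_norm_def by (simp only: real_sqrt_mult)
      qed
      have "?P * real (card S) \<le> (\<Prod>i\<in>UNIV. X $ i)"
      proof -
        have "?P * real (card S) \<le> ?P * real (\<Prod>i\<in>UNIV. N $ i)"
          using Pp card_inner_nodes[of N] by (intro mult_left_mono) (simp_all only: of_nat_le_iff less_imp_le)
        also have "\<dots> = (\<Prod>i\<in>UNIV. h $ i * real (N $ i))" by (simp add: prod.distrib)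
        also have "\<dots> = (\<Prod>i\<in>UNIV. X $ i)"
          by (rule prod.cong[OF refl]) (use N1 in \<open>simp add: hX mesh_step_def Suc_le_eq\<close>)
        finally show ?thesis .
      qed
      then have vol: "sqrt ?P * sqrt (real (card S)) \<le> sqrt (\<Prod>i\<in>UNIV. X $ i)"
        unfolding real_sqrt_mult[symmetric] by (rule real_sqrt_le_mono)
      have "\<epsilon>\<^sub>0 * mesh_norm h N (\<lambda>k. sqrt (restr h \<rho> k) * dt_bar \<tau> e m k) + op_norm h N (Aop sch a h) (st_bar e m)
        = sqrt ?P * (\<epsilon>\<^sub>0 * sqrt (ip S (\<lambda>k. restr h \<rho> k * ?d k) ?d) + sqrt (ip S (?A ?s) ?s))"
        unfolding d s by (simp add: algebra_simps)
      also have "\<dots> \<le> sqrt ?P * ((1 + sqrt \<nu>) * ((1 + real M * \<tau>) * (\<delta> / (\<nu>\<^sub>0 * \<kappa>))))"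
        using Pp by (intro mult_left_mono main) auto
      also have "\<dots> = (1 + sqrt \<nu>) * ((1 + T) * (Cr * (sqrt ?P * sqrt (real (card S))) / (\<nu>\<^sub>0 * \<kappa>))) * norm \<eta> ^ 4"
        by (simp add: M\<tau> \<delta>_def)
      also have "\<dots> \<le> (1 + sqrt \<nu>) * ((1 + T) * (Cr * sqrt (\<Prod>i\<in>UNIV. X $ i) / (\<nu>\<^sub>0 * \<kappa>))) * norm \<eta> ^ 4"
        using vol Cr(3) T \<nu> \<nu>\<^sub>0 \<kappa>_pos by (intro mult_right_mono mult_left_mono divide_right_mono) auto
      also have "\<dots> = C * mesh_size h \<tau> ^ 4"
        by (simp add: C_def \<kappa>_def mesh_size_norm \<eta>_def)
      finally show ?thesis .
    qed
    have "(MAX m\<in>{1..M}. \<epsilon>\<^sub>0 * mesh_norm h N (\<lambda>k. sqrt (restr h \<rho> k) * dt_bar \<tau> e m k)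
        + op_norm h N (Aop sch a h) (st_bar e m)) \<le> C * mesh_size h \<tau> ^ 4"
      using M bound by (intro Max.boundedI) auto
    then show "let e = (\<lambda>m k. restr_t h \<tau> u m k - v m k) in
         (MAX m\<in>{1..M}. \<epsilon>\<^sub>0 * mesh_norm h N (\<lambda>k. sqrt (restr h \<rho> k) * dt_bar \<tau> e m k)
                       + op_norm h N (Aop sch a h) (st_bar e m))
         \<le> C * mesh_size h \<tau> ^ 4"
      unfolding Let_def e_def .
  qed
qed

end

theorem theorem2:
  shows
    "(\<exists>K::nat.
       \<forall>(sch::scheme) (X::real^'n::finite) (T::real) (a::real^'n) (\<rho>::real^'n \<Rightarrow> real) (\<rho>min::real)
         (f::real^'n \<Rightarrow> real \<Rightarrow> real) (g::real^'n \<Rightarrow> real \<Rightarrow> real) (u\<^sub>0::real^'n \<Rightarrow> real) (u\<^sub>1::real^'n \<Rightarrow> real)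
         (u::real^'n \<Rightarrow> real \<Rightarrow> real) (\<nu>\<^sub>0::real) (\<nu>::real) (\<epsilon>\<^sub>0::real) (c::real).
         scheme_dim sch CARD('n) \<and>
         (\<forall>i. 0 < X $ i) \<and> 0 < T \<and> (\<forall>i. 0 < a $ i) \<and>
         0 < \<rho>min \<and> (\<forall>x\<in>cbox 0 X. \<rho>min \<le> \<rho> x) \<and>
         solves_ibvp X T a \<rho> f g u\<^sub>0 u\<^sub>1 u \<and> data_continuous X T f g u\<^sub>0 u\<^sub>1 \<and>
         Ck_on K (cbox 0 X) \<rho> \<and> Ck_on K (cbox 0 X \<times> {0..T}) (\<lambda>(x, t). u x t) \<and>
         0 < \<nu>\<^sub>0 \<and> \<nu>\<^sub>0 \<le> \<nu> \<and> 0 < \<epsilon>\<^sub>0 \<and> \<epsilon>\<^sub>0 < 1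
         \<longrightarrow>
         (\<exists>C::real. \<forall>(N::nat^'n) (M::nat) (h::real^'n) (ht::real) (fdh::int^'n \<Rightarrow> real)
            (v::nat \<Rightarrow> int^'n \<Rightarrow> real).
            (\<forall>i. 1 \<le> N $ i) \<and> 2 \<le> M \<and> h = mesh_step X N \<and> ht = T / real M \<and>
            op_pos h N (Bop sch h) \<and> op_pos h N (Aop sch a h) \<and>
            op_le h N (\<lambda>w k. \<nu>\<^sub>0 * w k) (Bop sch h) \<and> op_le h N (Bop sch h) (\<lambda>w k. \<nu> * w k) \<and>
            step_condition sch a h N ht \<rho>min \<epsilon>\<^sub>0 \<and>
            (\<forall>k\<in>inner_nodes N. \<bar>fdh k - fd0 T ht f (node h k)\<bar> \<le> c * ht ^ 3) \<and>
            solves_scheme sch a h N ht M \<rho> f g u\<^sub>0 u\<^sub>1 fdh v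
            \<longrightarrow>
            (let e = (\<lambda>m k. restr_t h ht u m k - v m k) in
             (MAX m\<in>{1..M}. \<epsilon>\<^sub>0 * mesh_norm h N (\<lambda>k. sqrt (restr h \<rho> k) * dt_bar ht e m k)
                           + op_norm h N (Aop sch a h) (st_bar e m))
             \<le> C * mesh_size h ht ^ 4)))
     \<and>
     (\<forall>(sch::scheme) (X::real^'n) (a::real^'n) (N::nat^'n) (h::real^'n) (\<epsilon>\<^sub>2::real).
        scheme_dim sch CARD('n) \<and>
        (\<forall>i. 0 < X $ i) \<and> (\<forall>i. 0 < a $ i) \<and> (\<forall>i. 1 \<le> N $ i) \<and> h = mesh_step X N \<and>
        (case sch of Scheme1 \<beta> \<Rightarrow> \<epsilon>\<^sub>2 = 1
                   | Scheme2 \<beta> \<gamma> \<theta> \<Rightarrow> 0 < \<epsilon>\<^sub>2 \<and> \<epsilon>\<^sub>2 \<le> \<theta> \<and> \<theta> \<le> 1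
                   | Scheme3 \<Rightarrow> \<epsilon>\<^sub>2 = 1)
        \<longrightarrow>
        (\<forall>w\<in>Hspace N.
           sqrt \<epsilon>\<^sub>2 * (MIN i\<in>UNIV. a $ i) * (2/3) powr ((real CARD('n) - 1) / 2)
             * op_norm h N (\<lambda>w k. - Lam_sum h w k) w
           \<le> op_norm h N (Aop sch a h) w))"
proof (intro conjI exI[of _ "2 * CARD('n) + 8"] allI impI, goal_cases)
  case (1 sch X T a \<rho> \<rho>min f g u\<^sub>0 u\<^sub>1 u \<nu>\<^sub>0 \<nu> \<epsilon>\<^sub>0 c)
  then interpret solution X T a \<rho> f g u\<^sub>0 u\<^sub>1 u
    by unfold_locales simp_all
  show ?case
    by (rule convergence) (use 1 in auto)
next
  case (2 sch X a N h \<epsilon>\<^sub>2)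
  then interpret mesh_ops h N
    by unfold_locales (use mesh_step_pos(1)[of X N] in auto)
  show ?case
    by (intro ballI Aop_lower_bound) (use 2 in auto)
qed

end
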